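(* Let $R=(K_0(R),I_R,\Delta_{re}(R),c_R)$ be an irreducible positive definite simply-laced generalized root system. Then the Coxeter element $c_R$ is admissible.
   Context: A simply-laced generalized root system $R$ of rank $\mu$ consists of: a free $\mathbb{Z}$-module $K_0(R)$ of rank $\mu$; a symmetric bilinear form $I_R:K_0(R)\times K_0(R)\to\mathbb{Z}$ (the Cartan form); a subset $\Delta_{re}(R)\subset K_0(R)$ (the set of real roots); and an element $c_R$ of the Weyl group $W(R)$ (the Coxeter transformation, or Coxeter element), such that: (1) $K_0(R)=\mathbb{Z}\Delta_{re}(R)$. (2) $I_R(\alpha,\alpha)=2$ for all $\alpha\in\Delta_{re}(R)$. (3) For all $\alpha\in\Delta_{re}(R)$, the element $r_\alpha\in\mathrm{Aut}(K_0(R),I_R)$ defined by $r_\alpha(\lambda):=\lambda-I_R(\lambda,\alpha)\alpha$ satisfies $r_\alpha(\Delta_{re}(R))=\Delta_{re}(R)$. (4) Let $W(R):=\langle r_\alpha\mid\alpha\in\Delta_{re}(R)\rangle\subset\mathrm{Aut}(K_0(R),I_R)$. There exists an ordered set $B=(\alpha_1,\dots,\alpha_\mu)$ of elements of $\Delta_{re}(R)$ (a root basis) such that $K_0(R)=\bigoplus_{i=1}^\mu\mathbb{Z}\alpha_i$, $W(R)=\langle r_{\alpha_1},\dots,r_{\alpha_\mu}\rangle$, $\Delta_{re}(R)=W(R)B$, and $c_R=r_{\alpha_1}\cdots r_{\alpha_\mu}$. $R$ is positive definite if $I_R$ on $K_0(R)\otimes_{\mathbb{Z}}\mathbb{R}$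 is positive definite. $R$ is reducible if $\Delta_{re}(R)=\Delta_1\cup\Delta_2$ with $\Delta_1,\Delta_2$ non-empty, $\Delta_1\cap\Delta_2=\emptyset$, and $I_R(\alpha_1,\alpha_2)=0$ for all $\alpha_1\in\Delta_1,\alpha_2\in\Delta_2$; it is irreducible if it is not reducible. Let $\Phi=\Delta_{re}(R)\subset K_0(R)\otimes_{\mathbb{Z}}\mathbb{R}$ with inner product $I_R$ and $W=W(R)$. An admissible representation of $w\in W$ is an expression $w=(r_{\beta_1}\cdots r_{\beta_{k_1}})(r_{\beta_{k_1+1}}\cdots r_{\beta_{k_2}})$ with $1\le k_1\le k_2\le\mu$, such that $\beta_1,\dots,\beta_{k_2}\in\Phi$ are linearly independent over $\mathbb{R}$, $\beta_1,\dots,\beta_{k_1}$ are orthogonal to each other, and $\beta_{k_1+1},\dots,\beta_{k_2}$ are orthogonal to each other. The element $w$ is called admissible if an admissible representation of $w$ satisfies $W=\langle r_{\beta_1},\dots,r_{\beta_{k_2}}\rangle$. *)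

theory Defs
  imports "HOL-Analysis.Finite_Function_Topology" "HOL-Algebra.Generated_Groups"
begin

section \<open>Abelian groups as modules over the integers\<close>

definition zscale :: "int \<Rightarrow> 'k::ab_group_add \<Rightarrow> 'k" where
  "zscale n x = (\<Sum>i<nat n. x) - (\<Sum>i<nat (- n). x)"

lemma sum_const_lessThan_add:
  "(\<Sum>i<m + n. x) = (\<Sum>i<m. x) + (\<Sum>i<n. x)" for m n :: nat and x :: "'k::ab_group_add"
  by (induction n) (simp_all add: algebra_simps)

lemma zscale_diff_of_nat:
  "zscale (int m - int n) x = (\<Sum>i<m. x) - (\<Sum>i<n. x)" for x :: "'k::ab_group_add"
proof (cases "n \<le> m")
  case True
  then obtain d where "m = n + d" using le_Suc_ex by blast
  then show ?thesis by (simp add: zscale_def sum_const_lessThan_add)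
next
  case False
  then obtain d where "n = m + d" using le_Suc_ex nat_le_linear by blast
  then show ?thesis by (simp add: zscale_def sum_const_lessThan_add)
qed

lemma zscale_of_nat: "zscale (int m) x = (\<Sum>i<m. x)" for x :: "'k::ab_group_add"
  using zscale_diff_of_nat[of m 0 x] by simp

lemma zscale_minus: "zscale (- a) x = - zscale a x" for x :: "'k::ab_group_add"
  by (simp add: zscale_def)

lemma zscale_add_left: "zscale (a + b) x = zscale a x + zscale b x" for x :: "'k::ab_group_add"
proof -
  obtain m n where a: "a = int m - int n" by (rule int_diff_cases)
  obtain p q where b: "b = int p - int q" by (rule int_diff_cases)
  have "a + b = int (m + p) - int (n + q)" using a b by simp
  then have "zscale (a + b) x = (\<Sum>i<m + p. x) - (\<Sum>i<n + q. x)"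
    by (simp only: zscale_diff_of_nat)
  then show ?thesis
    unfolding a b zscale_diff_of_nat sum_const_lessThan_add by simp
qed

lemma zscale_add_right: "zscale a (x + y) = zscale a x + zscale a y" for x :: "'k::ab_group_add"
  by (simp add: zscale_def sum.distrib)

lemma zscale_zscale: "zscale a (zscale b x) = zscale (a * b) x" for x :: "'k::ab_group_add"
proof -
  have nat: "zscale (int m) (zscale b x) = zscale (int m * b) x" for m
  proof (induction m)
    case 0
    then show ?case by (simp add: zscale_def)
  next
    case (Suc m)
    have "zscale (int (Suc m)) (zscale b x) = zscale (int m) (zscale b x) + zscale b x"
      unfolding zscale_of_nat by simp
    also have "\<dots> = zscale (int m * b + b) x" by (simp only: Suc zscale_add_left)
    finally show ?case by (simp add: algebra_simps)
  qed
  show ?thesis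
    by (cases a rule: int_cases2) (simp_all add: nat zscale_minus)
qed

interpretation zmod: module "zscale :: int \<Rightarrow> 'k::ab_group_add \<Rightarrow> 'k"
proof
  show "zscale 1 x = x" for x :: 'k by (simp add: zscale_def)
qed (simp_all add: zscale_add_left zscale_add_right zscale_zscale)

definition zbasis :: "'k::ab_group_add list \<Rightarrow> bool" where
  "zbasis B \<longleftrightarrow> distinct B \<and> zmod.independent (set B) \<and> zmod.span (set B) = UNIV"


section \<open>Extension of scalars from the integers to the reals\<close>

text \<open>
  For an abelian group \<open>K\<close>, the real vector space \<open>K \<otimes> \<real>\<close> is presented by generators \<open>k \<otimes> 1\<close>
  for \<open>k \<in> K\<close> and relations \<open>(k + l) \<otimes> 1 = k \<otimes> 1 + l \<otimes> 1\<close>.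
\<close>

definition tensor_relations :: "('k::ab_group_add \<Rightarrow>\<^sub>0 real) set" where
  "tensor_relations =
     {Poly_Mapping.single (k + l) 1 - Poly_Mapping.single k 1 - Poly_Mapping.single l 1 | k l. True}"

definition tensor_eq :: "('k::ab_group_add \<Rightarrow>\<^sub>0 real) \<Rightarrow> ('k \<Rightarrow>\<^sub>0 real) \<Rightarrow> bool" where
  "tensor_eq f g \<longleftrightarrow> f - g \<in> span tensor_relations"

lemma equivp_tensor_eq: "equivp (tensor_eq :: ('k::ab_group_add \<Rightarrow>\<^sub>0 real) \<Rightarrow> _)"
proof (intro equivpI reflpI sympI transpI)
  fix f g h :: "'k \<Rightarrow>\<^sub>0 real"
  show "tensor_eq f f" by (simp add: tensor_eq_def span_zero)
  show "tensor_eq g f" if "tensor_eq f g"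
    using that unfolding tensor_eq_def by (metis minus_diff_eq span_neg)
  show "tensor_eq f h" if "tensor_eq f g" "tensor_eq g h"
  proof -
    from that have "(f - g) + (g - h) \<in> span tensor_relations"
      unfolding tensor_eq_def by (rule span_add)
    then show ?thesis by (simp add: tensor_eq_def)
  qed
qed

quotient_type (overloaded) 'k tensor_real = "('k::ab_group_add) \<Rightarrow>\<^sub>0 real" / tensor_eq
  by (rule equivp_tensor_eq)

instantiation tensor_real :: (ab_group_add) real_vector
begin

lift_definition zero_tensor_real :: "'a tensor_real" is 0 .

lift_definition plus_tensor_real :: "'a tensor_real \<Rightarrow> 'a tensor_real \<Rightarrow> 'a tensor_real" is "(+)"
  unfolding tensor_eq_def add_diff_add by (rule span_add)

lift_definition uminus_tensor_real :: "'a tensor_real \<Rightarrow> 'a tensor_real" is uminus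
  unfolding tensor_eq_def minus_diff_minus by (rule span_neg)

lift_definition minus_tensor_real :: "'a tensor_real \<Rightarrow> 'a tensor_real \<Rightarrow> 'a tensor_real" is "(-)"
proof -
  fix f f' g g' :: "'a \<Rightarrow>\<^sub>0 real"
  assume "tensor_eq f f'" "tensor_eq g g'"
  then have "(f - f') - (g - g') \<in> span tensor_relations"
    unfolding tensor_eq_def by (rule span_diff)
  then show "tensor_eq (f - g) (f' - g')"
    by (simp add: tensor_eq_def algebra_simps)
qed

lift_definition scaleR_tensor_real :: "real \<Rightarrow> 'a tensor_real \<Rightarrow> 'a tensor_real" is scaleR
  unfolding tensor_eq_def scaleR_right_diff_distrib[symmetric] by (rule span_scale)

instance
proof
  fix a b c :: "'a tensor_real" and r s :: real
  show "a + b + c = a + (b + c)" by transfer (simp add: tensor_eq_def span_zero add.assoc)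
  show "a + b = b + a" by transfer (simp add: tensor_eq_def span_zero add.commute)
  show "0 + a = a" by transfer (simp add: tensor_eq_def span_zero)
  show "- a + a = 0" by transfer (simp add: tensor_eq_def span_zero)
  show "a - b = a + - b" by transfer (simp add: tensor_eq_def span_zero)
  show "r *\<^sub>R (a + b) = r *\<^sub>R a + r *\<^sub>R b"
    by transfer (simp add: tensor_eq_def span_zero scaleR_add_right)
  show "(r + s) *\<^sub>R a = r *\<^sub>R a + s *\<^sub>R a"
    by transfer (simp add: tensor_eq_def span_zero scaleR_add_left)
  show "r *\<^sub>R s *\<^sub>R a = (r * s) *\<^sub>R a" by transfer (simp add: tensor_eq_def span_zero)
  show "1 *\<^sub>R a = a" by transfer (simp add: tensor_eq_def span_zero)
qed

end

lift_definition tensor_one :: "'k::ab_group_add \<Rightarrow> 'k tensor_real"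
  is "\<lambda>k. Poly_Mapping.single k 1" .

definition free_extension ::
  "('k \<Rightarrow> 'v::real_vector) \<Rightarrow> ('k \<Rightarrow>\<^sub>0 real) \<Rightarrow> 'v" where
  "free_extension h f = (\<Sum>k\<in>Poly_Mapping.keys f. Poly_Mapping.lookup f k *\<^sub>R h k)"

text \<open>
  For additive \<open>h\<close> the following is the \<open>\<real>\<close>-linear map with \<open>k \<otimes> 1 \<mapsto> h k\<close>; it then does not
  depend on the representative chosen by \<open>rep_tensor_real\<close> (see \<open>linear_extension_abs\<close> below).
\<close>

definition linear_extension ::
  "('k::ab_group_add \<Rightarrow> 'v::real_vector) \<Rightarrow> 'k tensor_real \<Rightarrow> 'v" where
  "linear_extension h x = free_extension h (rep_tensor_real x)"

text \<open>The \<open>\<real>\<close>-bilinear form on \<open>K \<otimes> \<real>\<close> with \<open>(k \<otimes> 1, l \<otimes> 1) \<mapsto> b k l\<close>, for bi-additive \<open>b\<close>.\<close>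

definition real_form ::
  "('k::ab_group_add \<Rightarrow> 'k \<Rightarrow> int) \<Rightarrow> 'k tensor_real \<Rightarrow> 'k tensor_real \<Rightarrow> real" where
  "real_form b x y = linear_extension (\<lambda>k. linear_extension (\<lambda>l. real_of_int (b k l)) y) x"

lemma free_extension_superset:
  assumes "finite A" "Poly_Mapping.keys f \<subseteq> A"
  shows "free_extension h f = (\<Sum>k\<in>A. Poly_Mapping.lookup f k *\<^sub>R h k)"
  unfolding free_extension_def
  by (rule sum.mono_neutral_left) (use assms in \<open>auto simp: in_keys_iff\<close>)

lemma lookup_scaleR: "Poly_Mapping.lookup (r *\<^sub>R f) k = r * Poly_Mapping.lookup f k"
  for f :: "'k \<Rightarrow>\<^sub>0 real"
  by (simp add: scaleR_poly_mapping_def)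

lemma linear_free_extension: "linear (free_extension h)"
proof (rule linearI)
  fix f g :: "'a \<Rightarrow>\<^sub>0 real" and r :: real
  define A where "A = Poly_Mapping.keys f \<union> Poly_Mapping.keys g"
  have A: "finite A" "Poly_Mapping.keys f \<subseteq> A" "Poly_Mapping.keys g \<subseteq> A"
    "Poly_Mapping.keys (f + g) \<subseteq> A" "Poly_Mapping.keys (r *\<^sub>R f) \<subseteq> A"
    using Poly_Mapping.keys_add[of f g] by (auto simp: A_def in_keys_iff lookup_scaleR)
  show "free_extension h (f + g) = free_extension h f + free_extension h g"
    using A by (simp add: free_extension_superset[of A] lookup_add scaleR_add_left sum.distrib)
  show "free_extension h (r *\<^sub>R f) = r *\<^sub>R free_extension h f"
    using A by (simp add: free_extension_superset[of A] lookup_scaleR scaleR_sum_right)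
qed

lemma free_extension_single [simp]: "free_extension h (Poly_Mapping.single k c) = c *\<^sub>R h k"
  by (simp add: free_extension_def)

lemma linear_extension_abs:
  assumes "additive h"
  shows "linear_extension h (abs_tensor_real f) = free_extension h f"
proof -
  interpret h: additive h by fact
  interpret L: linear "free_extension h" by (rule linear_free_extension)
  have "tensor_eq (rep_tensor_real (abs_tensor_real f)) f"
    by (rule Quotient_rep_abs[OF Quotient_tensor_real]) (simp add: tensor_eq_def span_zero)
  then have "rep_tensor_real (abs_tensor_real f) - f \<in> span tensor_relations"
    by (simp add: tensor_eq_def)
  then have "free_extension h (rep_tensor_real (abs_tensor_real f) - f) = 0"
    by (rule linear_eq_0_on_span[OF linear_free_extension, rotated])
      (auto simp: tensor_relations_def L.diff h.add)
  then show ?thesis by (simp add: linear_extension_def L.diff)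
qed

lemma tensor_real_abs_cases: obtains f where "x = abs_tensor_real f"
  by (metis Quotient_abs_rep Quotient_tensor_real)

lemma linear_linear_extension:
  assumes "additive h"
  shows "linear (linear_extension h)"
proof (rule linearI)
  interpret L: linear "free_extension h" by (rule linear_free_extension)
  show "linear_extension h (x + y) = linear_extension h x + linear_extension h y" for x y
    by (rule tensor_real_abs_cases[of x], rule tensor_real_abs_cases[of y])
      (simp add: plus_tensor_real.abs_eq linear_extension_abs[OF assms] L.add)
  show "linear_extension h (r *\<^sub>R x) = r *\<^sub>R linear_extension h x" for r x
    by (rule tensor_real_abs_cases[of x])
      (simp add: scaleR_tensor_real.abs_eq linear_extension_abs[OF assms] L.scaleR)
qed

lemma linear_extension_tensor_one:
  assumes "additive h"
  shows "linear_extension h (tensor_one k) = h k"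
  by (simp add: tensor_one.abs_eq linear_extension_abs[OF assms])

lemma additive_tensor_one: "additive tensor_one"
proof
  fix k l :: 'a
  show "tensor_one (k + l) = tensor_one k + tensor_one l"
    by transfer (auto simp: tensor_eq_def tensor_relations_def diff_diff_add[symmetric] intro!: span_base)
qed

lemma tensor_one_zscale: "tensor_one (zscale n k) = of_int n *\<^sub>R tensor_one k"
proof -
  interpret t: additive "tensor_one :: 'a \<Rightarrow> _" by (rule additive_tensor_one)
  have "tensor_one (zscale n k) = (of_nat (nat n) - of_nat (nat (- n))) *\<^sub>R tensor_one k"
    by (simp add: zscale_def t.diff t.sum sum_constant_scaleR scaleR_left_diff_distrib
        del: sum_constant)
  also have "of_nat (nat n) - of_nat (nat (- n)) = (of_int n :: real)" by (cases "0 \<le> n") auto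
  finally show ?thesis .
qed

lemma span_tensor_one_UNIV: "span (range (tensor_one :: 'k::ab_group_add \<Rightarrow> _)) = UNIV"
proof -
  have lin: "linear (abs_tensor_real :: ('k \<Rightarrow>\<^sub>0 real) \<Rightarrow> _)"
    by (rule linearI) (simp_all add: plus_tensor_real.abs_eq scaleR_tensor_real.abs_eq)
  have "abs_tensor_real f \<in> span (range (tensor_one :: 'k \<Rightarrow> _))" for f :: "'k \<Rightarrow>\<^sub>0 real"
  proof -
    have "f = (\<Sum>k\<in>Poly_Mapping.keys f. Poly_Mapping.lookup f k *\<^sub>R Poly_Mapping.single k 1)"
      by (rule poly_mapping_eqI)
        (simp add: lookup_sum lookup_scaleR lookup_single when_def in_keys_iff if_distrib cong: if_cong)
    then have "abs_tensor_real f =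
        (\<Sum>k\<in>Poly_Mapping.keys f. Poly_Mapping.lookup f k *\<^sub>R tensor_one k)"
      by (metis (no_types, lifting) lin linear_scale linear_sum sum.cong tensor_one.abs_eq)
    then show ?thesis by (simp add: span_base span_scale span_sum)
  qed
  then show ?thesis by (metis UNIV_eq_I tensor_real_abs_cases)
qed

lemma tensor_one_zbasis:
  fixes B :: "'k::ab_group_add list"
  assumes "zbasis B"
  shows "inj_on tensor_one (set B)" "independent (tensor_one ` set B)"
    "span (tensor_one ` set B) = UNIV"
proof -
  have ind: "zmod.independent (set B)" and spn: "zmod.span (set B) = UNIV"
    using assms by (simp_all add: zbasis_def)
  define coord where "coord b = linear_extension (\<lambda>k. real_of_int (zmod.representation (set B) k b))"
    for b
  have add: "additive (\<lambda>k. real_of_int (zmod.representation (set B) k b))" for b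
    by standard (simp add: zmod.representation_add[OF ind] spn)
  have coord: "coord b (tensor_one b') = (if b = b' then 1 else 0)" if "b' \<in> set B" for b b'
    using that zmod.representation_basis[OF ind that]
    by (simp add: coord_def linear_extension_tensor_one[OF add])
  have lin: "linear (coord b)" for b
    unfolding coord_def by (rule linear_linear_extension[OF add])
  show inj: "inj_on tensor_one (set B)"
    by (rule inj_onI) (metis coord zero_neq_one)
  show "independent (tensor_one ` set B)"
  proof (rule independent_if_scalars_zero)
    fix u x
    assume 0: "(\<Sum>x\<in>tensor_one ` set B. u x *\<^sub>R x) = 0" and "x \<in> tensor_one ` set B"
    then obtain b where b: "b \<in> set B" "x = tensor_one b" by blast
    have "0 = coord b (\<Sum>b'\<in>set B. u (tensor_one b') *\<^sub>R tensor_one b')"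
      using 0 by (simp add: sum.reindex[OF inj] linear_0[OF lin])
    also have "\<dots> = (\<Sum>b'\<in>set B. u (tensor_one b') *\<^sub>R coord b (tensor_one b'))"
      by (simp add: linear_sum[OF lin] linear_scale[OF lin])
    also have "\<dots> = (\<Sum>b'\<in>set B. if b = b' then u (tensor_one b') else 0)"
      by (rule sum.cong) (simp_all add: coord)
    finally show "u x = 0" using b by simp
  qed simp
  have "tensor_one k \<in> span (tensor_one ` set B)" for k
  proof -
    have "k \<in> zmod.span (set B)" using spn by simp
    then show ?thesis
    proof (induction rule: zmod.span_induct_alt)
      case base
      then show ?case by (simp add: additive.zero[OF additive_tensor_one] span_zero)
    next
      case (step c x y)
      then show ?case
        by (simp add: additive.add[OF additive_tensor_one] tensor_one_zscale span_add span_scale span_base)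
    qed
  qed
  then have "span (range tensor_one) \<subseteq> span (tensor_one ` set B)"
    by (intro span_minimal) auto
  then show "span (tensor_one ` set B) = UNIV"
    using span_tensor_one_UNIV by blast
qed

lemma real_form_tensor_one:
  assumes "\<And>k. additive (b k)" "\<And>l. additive (\<lambda>k. b k l)"
  shows "real_form b (tensor_one k) (tensor_one l) = real_of_int (b k l)"
proof -
  have 1: "additive (\<lambda>l. real_of_int (b k l))" for k
    using assms(1) by (simp add: additive_def)
  have 2: "additive (\<lambda>k. real_of_int (b k l))"
    using assms(2) by (simp add: additive_def)
  show ?thesis
    by (simp add: real_form_def linear_extension_tensor_one[OF 1] linear_extension_tensor_one[OF 2])
qed


section \<open>Simply-laced generalized root systems\<close>

text \<open>The \<open>\<int>\<close>-module \<open>K\<^sub>0(R)\<close> is the whole type \<open>'k\<close>.\<close>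

record 'k root_data =
  cartan :: "'k \<Rightarrow> 'k \<Rightarrow> int"
  re_roots :: "'k set"
  coxeter :: "'k \<Rightarrow> 'k"

definition aut_group :: "('k::ab_group_add) root_data \<Rightarrow> ('k \<Rightarrow> 'k) monoid" where
  "aut_group R =
     \<lparr>carrier = {f. bij f \<and> additive f \<and> (\<forall>x y. cartan R (f x) (f y) = cartan R x y)},
      monoid.mult = (\<circ>), one = id\<rparr>"

definition reflection :: "('k::ab_group_add) root_data \<Rightarrow> 'k \<Rightarrow> 'k \<Rightarrow> 'k" where
  "reflection R \<alpha> x = x - zscale (cartan R x \<alpha>) \<alpha>"

definition reflection_group :: "('k::ab_group_add) root_data \<Rightarrow> 'k set \<Rightarrow> ('k \<Rightarrow> 'k) set" where
  "reflection_group R S = generate (aut_group R) (reflection R ` S)"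

definition weyl_group :: "('k::ab_group_add) root_data \<Rightarrow> ('k \<Rightarrow> 'k) set" where
  "weyl_group R = reflection_group R (re_roots R)"

text \<open>\<open>reflection_prod R [\<beta>\<^sub>1, \<dots>, \<beta>\<^sub>k]\<close> is the composite with \<open>\<beta>\<^sub>k\<close> acting first.\<close>

definition reflection_prod :: "('k::ab_group_add) root_data \<Rightarrow> 'k list \<Rightarrow> 'k \<Rightarrow> 'k" where
  "reflection_prod R \<beta>s = foldr (\<lambda>\<beta> f. reflection R \<beta> \<circ> f) \<beta>s id"

definition root_basis :: "('k::ab_group_add) root_data \<Rightarrow> 'k list \<Rightarrow> bool" where
  "root_basis R B \<longleftrightarrow>
     set B \<subseteq> re_roots R \<and> zbasis B \<and>
     weyl_group R = reflection_group R (set B) \<and>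
     re_roots R = {w \<beta> | w \<beta>. w \<in> weyl_group R \<and> \<beta> \<in> set B} \<and>
     coxeter R = reflection_prod R B"

locale generalized_root_system =
  fixes R :: "('k::ab_group_add) root_data" and \<mu> :: nat
  assumes free_of_rank: "\<exists>E :: 'k list. zbasis E \<and> length E = \<mu>"
    and cartan_additive: "additive (cartan R x)"
    and cartan_sym: "cartan R x y = cartan R y x"
    and coxeter_in_weyl_group: "coxeter R \<in> weyl_group R"
    and span_re_roots: "zmod.span (re_roots R) = UNIV"
    and cartan_re_root: "\<alpha> \<in> re_roots R \<Longrightarrow> cartan R \<alpha> \<alpha> = 2"
    and reflection_re_roots: "\<alpha> \<in> re_roots R \<Longrightarrow> reflection R \<alpha> ` re_roots R = re_roots R"
    and ex_root_basis: "\<exists>B. root_basis R B \<and> length B = \<mu>"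

definition positive_definite :: "('k::ab_group_add) root_data \<Rightarrow> bool" where
  "positive_definite R \<longleftrightarrow> (\<forall>x. x \<noteq> 0 \<longrightarrow> real_form (cartan R) x x > 0)"

definition reducible :: "('k::ab_group_add) root_data \<Rightarrow> bool" where
  "reducible R \<longleftrightarrow>
     (\<exists>\<Delta>\<^sub>1 \<Delta>\<^sub>2. re_roots R = \<Delta>\<^sub>1 \<union> \<Delta>\<^sub>2 \<and> \<Delta>\<^sub>1 \<noteq> {} \<and> \<Delta>\<^sub>2 \<noteq> {} \<and> \<Delta>\<^sub>1 \<inter> \<Delta>\<^sub>2 = {} \<and>
       (\<forall>\<alpha>\<in>\<Delta>\<^sub>1. \<forall>\<beta>\<in>\<Delta>\<^sub>2. cartan R \<alpha> \<beta> = 0))"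

text \<open>
  The lists \<open>\<beta>s\<close> and \<open>\<gamma>s\<close> are \<open>(\<beta>\<^sub>1, \<dots>, \<beta>\<^sub>k\<^sub>1)\<close> and \<open>(\<beta>\<^sub>k\<^sub>1\<^sub>+\<^sub>1, \<dots>, \<beta>\<^sub>k\<^sub>2)\<close>, so that
  \<open>k\<^sub>1 \<le> k\<^sub>2\<close> is automatic. Distinctness of the images in \<open>K\<^sub>0(R) \<otimes> \<real>\<close> is part of the linear
  independence of the family.
\<close>

definition admissible_representation ::
  "nat \<Rightarrow> ('k::ab_group_add) root_data \<Rightarrow> ('k \<Rightarrow> 'k) \<Rightarrow> 'k list \<Rightarrow> 'k list \<Rightarrow> bool" where
  "admissible_representation \<mu> R w \<beta>s \<gamma>s \<longleftrightarrow>
     w = reflection_prod R \<beta>s \<circ> reflection_prod R \<gamma>s \<and>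
     1 \<le> length \<beta>s \<and> length \<beta>s + length \<gamma>s \<le> \<mu> \<and>
     set (\<beta>s @ \<gamma>s) \<subseteq> re_roots R \<and>
     distinct (map tensor_one (\<beta>s @ \<gamma>s)) \<and> independent (tensor_one ` set (\<beta>s @ \<gamma>s)) \<and>
     sorted_wrt (\<lambda>\<alpha> \<beta>. cartan R \<alpha> \<beta> = 0) \<beta>s \<and>
     sorted_wrt (\<lambda>\<alpha> \<beta>. cartan R \<alpha> \<beta> = 0) \<gamma>s"

definition admissible :: "nat \<Rightarrow> ('k::ab_group_add) root_data \<Rightarrow> ('k \<Rightarrow> 'k) \<Rightarrow> bool" where
  "admissible \<mu> R w \<longleftrightarrow>
     w \<in> weyl_group R \<and>
     (\<exists>\<beta>s \<gamma>s. admissible_representation \<mu> R w \<beta>s \<gamma>s \<and>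
       weyl_group R = reflection_group R (set (\<beta>s @ \<gamma>s)))"

lemma group_aut_group: "group (aut_group R)"
proof (rule groupI)
  fix f assume f: "f \<in> carrier (aut_group R)"
  then have bij: "bij f" and add: "f (x + y) = f x + f y"
    and iso: "cartan R (f x) (f y) = cartan R x y" for x y
    by (auto simp: aut_group_def additive_def)
  define g where "g = inv_into UNIV f"
  have fg: "f (g x) = x" and gf: "g (f x) = x" for x
    using bij by (simp_all add: g_def bij_is_surj surj_f_inv_f bij_is_inj)
  have "bij g" using bij by (simp add: g_def bij_imp_bij_inv)
  moreover have "g (x + y) = g x + g y" for x y
  proof -
    have "g (x + y) = g (f (g x + g y))" by (simp add: add fg)
    then show ?thesis by (simp only: gf)
  qed
  moreover have "cartan R (g x) (g y) = cartan R x y" for x y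
    using iso[of "g x" "g y"] by (simp add: fg)
  ultimately have "g \<in> carrier (aut_group R)"
    by (simp add: aut_group_def additive_def)
  then show "\<exists>g\<in>carrier (aut_group R). g \<otimes>\<^bsub>aut_group R\<^esub> f = \<one>\<^bsub>aut_group R\<^esub>"
    by (rule bexI[rotated]) (auto simp: aut_group_def gf)
qed (auto simp: aut_group_def additive_def bij_comp)

context generalized_root_system
begin

lemma cartan_additive_left: "additive (\<lambda>x. cartan R x y)"
  using cartan_additive cartan_sym by (simp add: additive_def)

lemma cartan_zscale: "cartan R x (zscale n y) = n * cartan R x y"
proof -
  interpret c: additive "cartan R x" by (rule cartan_additive)
  show ?thesis
    by (cases "0 \<le> n") (simp_all add: zscale_def c.diff c.sum c.minus c.zero)
qed

lemma reflection_in_aut_group: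
  assumes "\<alpha> \<in> re_roots R"
  shows "reflection R \<alpha> \<in> carrier (aut_group R)"
proof -
  have add: "cartan R x (y - z) = cartan R x y - cartan R x z"
    "cartan R (y - z) x = cartan R y x - cartan R z x"
    "cartan R (y + z) x = cartan R y x + cartan R z x" for x y z
    using additive.diff[OF cartan_additive] additive.diff[OF cartan_additive_left]
      additive.add[OF cartan_additive_left] by auto
  have left: "cartan R (zscale n y) x = n * cartan R y x" for n x y
    by (metis cartan_sym cartan_zscale)
  have "reflection R \<alpha> (reflection R \<alpha> x) = x" for x
    by (simp add: reflection_def add left cartan_re_root[OF assms] zmod.scale_minus_left)
  then have "bij (reflection R \<alpha>)" by (rule involuntory_imp_bij)
  moreover have "additive (reflection R \<alpha>)"
    by standard (simp add: reflection_def add zmod.scale_left_distrib)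
  moreover have "cartan R (reflection R \<alpha> x) (reflection R \<alpha> y) = cartan R x y" for x y
  proof -
    have "cartan R (x - zscale m \<alpha>) (y - zscale n \<alpha>) =
        cartan R x y - n * cartan R x \<alpha> - m * cartan R \<alpha> y + 2 * m * n" for m n
      by (simp add: add left cartan_zscale cartan_re_root[OF assms] right_diff_distrib)
    from this[of "cartan R x \<alpha>" "cartan R y \<alpha>"] show ?thesis
      unfolding reflection_def cartan_sym[of \<alpha> y] by (simp add: mult.commute)
  qed
  ultimately show ?thesis by (simp add: aut_group_def)
qed

lemma real_form_cartan: "real_form (cartan R) (tensor_one k) (tensor_one l) = cartan R k l"
  by (rule real_form_tensor_one[OF cartan_additive cartan_additive_left])

end

end

theory Submission
  imports Defs
begin

text \<open>
  On the root basis \<open>\<alpha>\<^sub>1, \<dots>, \<alpha>\<^sub>\<mu>\<close> let \<open>S\<close> be the bilinear form with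
  \<open>S \<alpha>\<^sub>i \<alpha>\<^sub>i = 1\<close>, \<open>S \<alpha>\<^sub>i \<alpha>\<^sub>j = I\<^sub>R \<alpha>\<^sub>i \<alpha>\<^sub>j\<close> for \<open>i < j\<close> and
  \<open>S \<alpha>\<^sub>i \<alpha>\<^sub>j = 0\<close> for \<open>i > j\<close>, so that \<open>S\<close> plus its transpose is the Cartan form.
  The Coxeter transformation \<open>c\<close> is determined by \<open>S w (c z) = - S z w\<close>, hence it is the product
  of the reflections in any basis in which \<open>S\<close> is unitriangular. It therefore suffices to find a
  basis in which \<open>S\<close> has a block matrix with rows \<open>(1, M)\<close> and \<open>(0, 1)\<close>.

  Such a basis is obtained from normal forms of \<open>S\<close>, by induction on the rank: when one more root is
  added to a normal form of rank \<open>k\<close>, the new column of \<open>S\<close> is confined by positive definiteness.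
  For \<open>k \<le> 7\<close> only finitely many columns remain, and a change of basis is tabulated for each of
  them. For \<open>k \<ge> 8\<close> the form is of type \<open>A\<close> or \<open>D\<close>, or it is of type \<open>E\<^sub>8\<close> and then, being
  unimodular, has no extension; null vectors of affine diagrams exclude everything but \<open>A\<close> and
  \<open>D\<close> in rank \<open>k + 1\<close>.

  Finally, a basis of the lattice consisting of roots generates the Weyl group, because in a lattice
  spanned by a simply-laced root system the vectors of norm \<open>2\<close> are exactly the roots.
\<close>

section \<open>Exceptional lists for a positive definite integral form\<close>

text \<open>A root basis is an arbitrary lattice basis consisting of roots and need not be a system
  of simple roots. So \<open>coxeter R\<close> can be a quasi-Coxeter element that is not a Coxeter
  element of the Weyl group, and a 2-colouring of the Dynkin diagram does not settle the matter.
  This is why \<open>S\<close> has several normal forms in types D and E: in type D one for each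
  splitting of the rank into two cycle lengths, in type E the tabulated ones, 3, 5 and 9 in number
  like Carter's diagrams for E6, E7 and E8.

  \<open>S\<close> is not symmetric, but \<open>S x x\<close> is half the Cartan norm, so positivity
  survives and roots have \<open>S x x = 1\<close>. Unitriangularity gives projections over the
  integers; with them a root standing anywhere in the ordered basis can be moved to the end, where
  only its column is unknown.

  Rank 8 is the threshold because from there on every unwanted column contains a null vector: a
  column over A with at least three vertices on each of two levels has at least 9 vertices in all,
  enough for affine E7 or E8, and a spin column over D has the 8 coordinates that affine E8
  needs.\<close>

locale integral_form =
  fixes S :: "'k::ab_group_add \<Rightarrow> 'k \<Rightarrow> int"
  assumes add_left: "S (x + y) z = S x z + S y z"
    and add_right: "S x (y + z) = S x y + S x z"
    and pos: "x \<noteq> 0 \<Longrightarrow> 0 < S x x"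
begin

lemma additive_left: "additive (\<lambda>x. S x y)" and additive_right: "additive (S x)"
  by (simp_all add: additive_def add_left add_right)

lemma zero_left: "S 0 y = 0" and zero_right: "S x 0 = 0"
  using additive.zero[OF additive_left] additive.zero[OF additive_right] by auto

lemma minus_left: "S (- x) y = - S x y" and minus_right: "S x (- y) = - S x y"
  using additive.minus[OF additive_left] additive.minus[OF additive_right] by auto

lemma diff_left: "S (x - y) z = S x z - S y z" and diff_right: "S x (y - z) = S x y - S x z"
  using additive.diff[OF additive_left] additive.diff[OF additive_right] by auto

lemma zscale_left: "S (zscale n x) y = n * S x y"
proof -
  interpret additive "\<lambda>x. S x y" by (rule additive_left)
  show ?thesis by (cases "0 \<le> n") (simp_all add: zscale_def diff sum minus zero)
qed

lemma zscale_right: "S x (zscale n y) = n * S x y"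
proof -
  interpret additive "S x" by (rule additive_right)
  show ?thesis by (cases "0 \<le> n") (simp_all add: zscale_def diff sum minus zero)
qed

lemma sum_left: "S (sum f A) y = (\<Sum>a\<in>A. S (f a) y)"
  using additive.sum[OF additive_left] .

lemma sum_right: "S x (sum f A) = (\<Sum>a\<in>A. S x (f a))"
  using additive.sum[OF additive_right] .

lemmas bilin = add_left add_right zero_left zero_right minus_left minus_right
  diff_left diff_right zscale_left zscale_right

lemma eq_0_if_nonpos: "S x x \<le> 0 \<Longrightarrow> x = 0"
  using pos by fastforce

lemma vanish_left_on_span:
  assumes "\<And>x. x \<in> X \<Longrightarrow> S x y = 0" "w \<in> zmod.span X"
  shows "S w y = 0"
  using assms(2) by (induction rule: zmod.span_induct_alt) (simp_all add: bilin assms(1))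

lemma vanish_right_on_span:
  assumes "\<And>x. x \<in> X \<Longrightarrow> S y x = 0" "w \<in> zmod.span X"
  shows "S y w = 0"
  using assms(2) by (induction rule: zmod.span_induct_alt) (simp_all add: bilin assms(1))

definition exceptional :: "'k list \<Rightarrow> bool" where
  "exceptional xs \<longleftrightarrow> (\<forall>x\<in>set xs. S x x = 1) \<and> sorted_wrt (\<lambda>x y. S y x = 0) xs"

lemma exceptional_append:
  "exceptional (xs @ ys) \<longleftrightarrow> exceptional xs \<and> exceptional ys \<and> (\<forall>x\<in>set xs. \<forall>y\<in>set ys. S y x = 0)"
  by (auto simp: exceptional_def sorted_wrt_append)

lemma exceptional_Cons:
  "exceptional (x # xs) \<longleftrightarrow> S x x = 1 \<and> exceptional xs \<and> (\<forall>y\<in>set xs. S y x = 0)"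
  by (auto simp: exceptional_def)

lemma exceptional_Nil [simp]: "exceptional []"
  by (simp add: exceptional_def)

lemma exceptional_filter: "exceptional xs \<Longrightarrow> exceptional (filter P xs)"
  by (auto simp: exceptional_def sorted_wrt_filter)

text \<open>The functional \<open>S x\<close> kills all predecessors of \<open>x\<close> but not
  \<open>x\<close>, because \<open>S x x > 0\<close>. Arbitrary nonzero vectors are allowed so that
  residues of projections fit in, as in \<open>exceptional_spans\<close>.\<close>

lemma semiorthogonal_independent:
  assumes "sorted_wrt (\<lambda>x y. S y x = 0) xs" "0 \<notin> set xs"
  shows "distinct (map tensor_one xs) \<and> independent (tensor_one ` set xs)"
  using assms
proof (induction xs rule: rev_induct)
  case Nil
  then show ?case by (simp add: independent_empty)
next
  case (snoc x xs)
  define f where "f = linear_extension (\<lambda>z. real_of_int (S x z))"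
  have add: "additive (\<lambda>z. real_of_int (S x z))" by (simp add: additive_def bilin)
  have lin: "linear f" unfolding f_def by (rule linear_linear_extension[OF add])
  have f: "f (tensor_one z) = real_of_int (S x z)" for z
    unfolding f_def by (rule linear_extension_tensor_one[OF add])
  have "f v = 0" if "v \<in> span (tensor_one ` set xs)" for v
    using that by (rule linear_eq_0_on_span[OF lin, rotated])
      (use snoc.prems in \<open>auto simp: f sorted_wrt_append\<close>)
  moreover have "f (tensor_one x) \<noteq> 0" using snoc.prems pos[of x] by (auto simp: f)
  ultimately have "tensor_one x \<notin> span (tensor_one ` set xs)" by blast
  moreover from this have "tensor_one x \<notin> tensor_one ` set xs" using span_base by blast
  ultimately show ?case
    using snoc by (auto simp: sorted_wrt_append independent_insert)
qed

lemma exceptional_nonzero: "exceptional xs \<Longrightarrow> 0 \<notin> set xs"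
  unfolding exceptional_def using zero_left[of 0] by fastforce

lemma exceptional_independent:
  assumes "exceptional xs"
  shows "distinct (map tensor_one xs)" "independent (tensor_one ` set xs)"
  using semiorthogonal_independent[of xs] exceptional_nonzero[OF assms] assms
  by (simp_all add: exceptional_def)

lemma exceptional_distinct: "exceptional xs \<Longrightarrow> distinct xs"
  using exceptional_independent(1) distinct_map by blast

text \<open>A unitriangular matrix is invertible over the integers, so the functional given by
  \<open>z\<close> is represented by a lattice vector of the span. Back substitution: correcting by
  a multiple of the front element \<open>x\<close> leaves \<open>S w d\<close> unchanged for later
  \<open>w\<close>, as \<open>S w x = 0\<close>.\<close>

lemma ex_right_projection:
  assumes "exceptional xs"
  shows "\<exists>d\<in>zmod.span (set xs). \<forall>w\<in>zmod.span (set xs). S w d = S w z"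
proof -
  have "\<exists>d\<in>zmod.span (set xs). \<forall>w\<in>set xs. S w d = S w z"
    using assms
  proof (induction xs)
    case Nil
    then show ?case by simp
  next
    case (Cons x xs)
    then obtain d where d: "d \<in> zmod.span (set xs)" "\<forall>w\<in>set xs. S w d = S w z"
      by (auto simp: exceptional_Cons)
    have "d + zscale (S x z - S x d) x \<in> zmod.span (set (x # xs))"
      using d(1) by (auto intro!: zmod.span_add zmod.span_scale intro: zmod.span_base
          subsetD[OF zmod.span_mono, rotated])
    moreover have "\<forall>w\<in>set (x # xs). S w (d + zscale (S x z - S x d) x) = S w z"
      using Cons.prems d(2) by (auto simp: exceptional_Cons bilin)
    ultimately show ?case by blast
  qed
  then obtain d where d: "d \<in> zmod.span (set xs)" "\<forall>w\<in>set xs. S w d = S w z" by blast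
  have "S w (d - z) = 0" if "w \<in> zmod.span (set xs)" for w
    using vanish_left_on_span[OF _ that, of "d - z"] d(2) by (simp add: bilin)
  then show ?thesis using d(1) by (auto simp: bilin)
qed

text \<open>Mirror image of the right projection: the triangular system is now solved from the other
  end, so the last element is peeled off.\<close>

lemma ex_left_projection:
  assumes "exceptional xs"
  shows "\<exists>d\<in>zmod.span (set xs). \<forall>w\<in>zmod.span (set xs). S d w = S z w"
proof -
  have "\<exists>d\<in>zmod.span (set xs). \<forall>w\<in>set xs. S d w = S z w"
    using assms
  proof (induction xs rule: rev_induct)
    case Nil
    then show ?case by simp
  next
    case (snoc x xs)
    then obtain d where d: "d \<in> zmod.span (set xs)" "\<forall>w\<in>set xs. S d w = S z w"
      by (auto simp: exceptional_append)
    have "d + zscale (S z x - S d x) x \<in> zmod.span (set (xs @ [x]))"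
      using d(1) by (auto intro!: zmod.span_add zmod.span_scale intro: zmod.span_base
          subsetD[OF zmod.span_mono, rotated])
    moreover have "\<forall>w\<in>set (xs @ [x]). S (d + zscale (S z x - S d x) x) w = S z w"
      using snoc.prems d(2) by (auto simp: exceptional_append exceptional_Cons bilin)
    ultimately show ?case by blast
  qed
  then obtain d where d: "d \<in> zmod.span (set xs)" "\<forall>w\<in>set xs. S d w = S z w" by blast
  have "S (d - z) w = 0" if "w \<in> zmod.span (set xs)" for w
    using vanish_right_on_span[OF _ that, of "d - z"] d(2) by (simp add: bilin)
  then show ?thesis using d(1) by (auto simp: bilin)
qed

lemma tensor_one_span:
  assumes "x \<in> zmod.span X"
  shows "tensor_one x \<in> span (tensor_one ` X)"
  using assms
proof (induction rule: zmod.span_induct_alt)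
  case base
  then show ?case by (simp add: additive.zero[OF additive_tensor_one] span_zero)
next
  case (step c x y)
  then show ?case
    by (simp add: additive.add[OF additive_tensor_one] tensor_one_zscale span_add span_scale span_base)
qed

text \<open>Counting ranks alone would only give a sublattice of finite index. Equality comes from
  the integral projection: the residue \<open>r\<close> of a missing vector could be put in front of
  \<open>ys\<close>, which yields more independent vectors than \<open>X\<close> permits.\<close>

lemma exceptional_spans:
  assumes exc: "exceptional ys" and sub: "set ys \<subseteq> zmod.span X"
    and X: "finite X" "card X \<le> length ys"
  shows "zmod.span X = zmod.span (set ys)"
proof
  show "zmod.span (set ys) \<subseteq> zmod.span X"
    using sub by (simp add: zmod.span_minimal zmod.subspace_span)
  have "x \<in> zmod.span (set ys)" if "x \<in> X" for x
  proof (rule ccontr)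
    assume x: "x \<notin> zmod.span (set ys)"
    obtain d where d: "d \<in> zmod.span (set ys)" "\<forall>w\<in>zmod.span (set ys). S w d = S w x"
      using ex_right_projection[OF exc] by blast
    define r where "r = x - d"
    have "r \<noteq> 0" using x d(1) by (auto simp: r_def)
    moreover have "\<forall>y\<in>set ys. S y r = 0" using d(2) by (simp add: r_def bilin zmod.span_base)
    ultimately have ind: "distinct (map tensor_one (r # ys))" "independent (tensor_one ` set (r # ys))"
      using semiorthogonal_independent[of "r # ys"] exceptional_nonzero[OF exc] exc
      by (simp_all add: exceptional_def)
    have "set (r # ys) \<subseteq> zmod.span X"
      using sub that d(1) \<open>zmod.span (set ys) \<subseteq> zmod.span X\<close>
      by (auto simp: r_def intro!: zmod.span_diff intro: zmod.span_base)
    then have "tensor_one ` set (r # ys) \<subseteq> span (tensor_one ` X)"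
      using tensor_one_span by blast
    then have "card (tensor_one ` set (r # ys)) \<le> card (tensor_one ` X)"
      using independent_span_bound[OF _ ind(2)] X(1) by blast
    moreover have "card (tensor_one ` set (r # ys)) = Suc (length ys)"
      using distinct_card[OF ind(1)] by simp
    ultimately show False using card_image_le[OF X(1), of tensor_one] X(2) by linarith
  qed
  then show "zmod.span X \<subseteq> zmod.span (set ys)"
    by (simp add: zmod.span_minimal zmod.subspace_span subsetI)
qed

text \<open>The following element is the last one after a sequence of mutations of \<open>x\<close> to the right.\<close>

lemma ex_mutation:
  assumes "exceptional (x # xs)"
  shows "\<exists>d\<in>zmod.span (set xs). (\<forall>w\<in>zmod.span (set xs). S (x - d) w = 0) \<and> S (x - d) (x - d) = 1"
proof -
  obtain d where d: "d \<in> zmod.span (set xs)" "\<forall>w\<in>zmod.span (set xs). S d w = S x w"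
    using ex_left_projection assms exceptional_Cons by blast
  have "S d x = 0"
    using vanish_left_on_span[OF _ d(1), of x] assms by (auto simp: exceptional_Cons)
  \<comment> \<open>The choice of \<open>d\<close> gives \<open>S d d = S x d\<close>, which cancels
    the remaining cross term.\<close>
  then have "S (x - d) (x - d) = 1" using d assms by (simp add: bilin exceptional_Cons)
  then show ?thesis using d by (intro bexI[of _ d]) (simp_all add: bilin)
qed

end

section \<open>Verified extension of normal forms\<close>

text \<open>Surplus entries are ignored, so a short coefficient list acts as one padded with zeros;
  bounds on prefixes rely on this.\<close>

fun dot :: "int list \<Rightarrow> int list \<Rightarrow> int" where
  "dot (x # xs) (y # ys) = x * y + dot xs ys"
| "dot _ _ = 0"

definition mat_vec :: "int list list \<Rightarrow> int list \<Rightarrow> int list" where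
  "mat_vec M v = map (\<lambda>r. dot r v) M"

text \<open>This is \<open>P M P^T\<close>; each row of \<open>P\<close> holds the coordinates of a
  new vector.\<close>

definition congruent_matrix :: "int list list \<Rightarrow> int list list \<Rightarrow> int list list" where
  "congruent_matrix P M = (let Q = map (mat_vec M) P in map (\<lambda>r. map (dot r) Q) P)"

definition extend_matrix :: "int list list \<Rightarrow> int list \<Rightarrow> int list list" where
  "extend_matrix M v = map2 (\<lambda>r c. r @ [c]) M v @ [replicate (length M) 0 @ [1]]"

definition admits :: "(int \<times> int list) list \<Rightarrow> int list \<Rightarrow> bool" where
  "admits Z v \<longleftrightarrow> list_all (\<lambda>(t, z). \<bar>dot z v\<bar> < 2 * t) Z"

text \<open>Columns are enumerated up to sign by making the first nonzero entry 1. They grow from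
  the front, and each bound prunes as soon as its coordinates are known; hence \<open>Zs\<close>
  starts with the bounds for the longest prefix.\<close>

fun candidates :: "(int \<times> int list) list list \<Rightarrow> int list list" where
  "candidates [] = [[]]"
| "candidates (Z # Zs) =
     concat (map (\<lambda>v. filter (admits Z)
       (map (\<lambda>c. v @ [c]) (if list_all (\<lambda>a. a = 0) v then [0, 1] else [- 1, 0, 1])))
     (candidates Zs))"

text \<open>A bound that is tested on a prefix must not involve later coordinates, since otherwise
  pruning could lose columns.\<close>

fun well_sized :: "(int \<times> int list) list list \<Rightarrow> bool" where
  "well_sized [] \<longleftrightarrow> True"
| "well_sized (Z # Zs) \<longleftrightarrow> list_all (\<lambda>(t, z). length z \<le> Suc (length Zs)) Z \<and> well_sized Zs"

text \<open>The number counts tested vectors: \<open>v, g v, ..., g^(n-1) v\<close>, each up to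
  sign.\<close>

fun reaches :: "int list list \<Rightarrow> int list list \<Rightarrow> nat \<Rightarrow> int list \<Rightarrow> bool" where
  "reaches g T 0 v \<longleftrightarrow> False"
| "reaches g T (Suc n) v \<longleftrightarrow>
     List.member T v \<or> List.member T (map uminus v) \<or> reaches g T n (mat_vec g v)"

text \<open>
  Here \<open>M\<close> is the matrix of an exceptional list in \<open>L\<close> that is to be extended by \<open>\<beta>\<close>, and \<open>g\<close> is
  an isometry of \<open>M\<close>. Bounds \<open>(t, z)\<close> with \<open>S z z \<le> t\<^sup>2\<close> confine the row \<open>S (-) \<beta>\<close> to finitely many
  candidates; up to sign and powers of \<open>g\<close> each is listed in \<open>tab\<close> together with a change of basis
  from \<open>L + \<int>\<beta>\<close> to a list with a matrix in \<open>Ns\<close>.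
\<close>

definition extension_check ::
  "int list list \<Rightarrow> int list list list \<Rightarrow> (int \<times> int list) list list \<Rightarrow> int list list \<Rightarrow>
    (int list \<times> int list list) list \<Rightarrow> nat \<Rightarrow> bool" where
  "extension_check M Ns Zs g tab n \<longleftrightarrow>
     length Zs = length M \<and> well_sized Zs \<and>
     list_all (list_all (\<lambda>(t, z). 0 < t \<and> dot z (mat_vec M z) \<le> t * t)) Zs \<and>
     congruent_matrix g M = M \<and>
     list_all (\<lambda>(v, P). List.member Ns (congruent_matrix P (extend_matrix M v))) tab \<and>
     list_all (\<lambda>v. list_all (\<lambda>a. a = 0) v \<or> reaches g (map fst tab) n v) (candidates Zs)"

lemma dot_map_uminus: "dot x (map uminus y) = - dot x y"
  by (induction x y rule: dot.induct) auto

lemma dot_append_right: "length x \<le> length y \<Longrightarrow> dot x (y @ z) = dot x y"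
  by (induction x y rule: dot.induct) auto

lemma candidates_complete:
  assumes "length v = length Zs" "well_sized Zs" "set v \<subseteq> {-1, 0, 1}"
    and "\<And>Z t z. Z \<in> set Zs \<Longrightarrow> (t, z) \<in> set Z \<Longrightarrow> \<bar>dot z v\<bar> < 2 * t"
  shows "v \<in> set (candidates Zs) \<or> map uminus v \<in> set (candidates Zs)"
  using assms
proof (induction Zs arbitrary: v)
  case Nil
  then show ?case by simp
next
  case (Cons Z Zs)
  then obtain u c where v: "v = u @ [c]" by (cases v rule: rev_cases) auto
  have u: "length u = length Zs" using Cons.prems(1) v by simp
  have short: "length z \<le> length u" if "Z' \<in> set Zs" "(t, z) \<in> set Z'" for Z' t z
  proof -
    have "well_sized Zs \<Longrightarrow> length z \<le> length Zs"
      using that by (induction Zs) (fastforce simp: list_all_iff)+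
    then show ?thesis using Cons.prems(2) u by simp
  qed
  have "u \<in> set (candidates Zs) \<or> map uminus u \<in> set (candidates Zs)"
  proof (rule Cons.IH)
    show "\<bar>dot z u\<bar> < 2 * t" if "Z' \<in> set Zs" "(t, z) \<in> set Z'" for Z' t z
      using Cons.prems(4)[of Z' t z] that short[OF that] by (simp add: v dot_append_right)
  qed (use Cons.prems u v in auto)
  moreover have adm: "admits Z v" "admits Z (map uminus v)"
    using Cons.prems(4)[of Z] by (auto simp: admits_def list_all_iff dot_map_uminus)
  moreover have c: "c \<in> {-1, 0, 1}" using Cons.prems(3) v by simp
  \<comment> \<open>After a zero prefix only the entries 0 and 1 are listed. The entry -1 is covered
    by the negated column, whose prefix must be the same list.\<close>
  moreover have "u = map uminus u" if "list_all (\<lambda>a. a = 0) u"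
    using that by (induction u) auto
  moreover have "list_all (\<lambda>a. a = 0) (map uminus u) \<longleftrightarrow> list_all (\<lambda>a. a = 0) u"
    by (induction u) auto
  ultimately show ?case
    by (cases "list_all (\<lambda>a. a = 0) u") (fastforce simp: v)+
qed

context integral_form
begin

definition S_matrix :: "'k list \<Rightarrow> int list list" where
  "S_matrix xs = map (\<lambda>x. map (S x) xs) xs"

fun combination :: "'k list \<Rightarrow> int list \<Rightarrow> 'k" where
  "combination (x # xs) (c # cs) = zscale c x + combination xs cs"
| "combination _ _ = 0"

lemma S_combination_right: "S x (combination xs cs) = dot (map (S x) xs) cs"
  by (induction xs cs rule: combination.induct) (simp_all add: bilin)

lemma S_combination_left: "S (combination xs cs) y = dot cs (map (\<lambda>x. S x y) xs)"
  by (induction xs cs rule: combination.induct) (simp_all add: bilin)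

lemma S_combination:
  "S (combination xs a) (combination xs b) = dot a (mat_vec (S_matrix xs) b)"
  unfolding S_combination_left by (simp add: S_combination_right S_matrix_def mat_vec_def o_def)

lemma combination_span: "combination xs cs \<in> zmod.span (set xs)"
proof (induction xs cs rule: combination.induct)
  case (1 x xs c cs)
  then show ?case
    by (auto intro!: zmod.span_add zmod.span_scale intro: zmod.span_base
        subsetD[OF zmod.span_mono, rotated])
qed (simp_all add: zmod.span_zero)

lemma S_matrix_combination:
  "S_matrix (map (combination xs) P) = congruent_matrix P (S_matrix xs)"
proof -
  have "S_matrix (map (combination xs) P) = map (\<lambda>a. map (\<lambda>b. S (combination xs a) (combination xs b)) P) P"
    by (simp add: S_matrix_def o_def)
  then show ?thesis by (simp add: S_combination congruent_matrix_def Let_def o_def)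
qed

lemma S_matrix_snoc:
  assumes "\<forall>x\<in>set xs. S \<beta> x = 0" "S \<beta> \<beta> = 1"
  shows "S_matrix (xs @ [\<beta>]) = extend_matrix (S_matrix xs) (map (\<lambda>x. S x \<beta>) xs)"
proof -
  have "map (S \<beta>) xs = replicate (length xs) 0"
    using assms(1) by (intro replicate_eqI) auto
  moreover have "map2 (\<lambda>r c. r @ [c]) (map f ys) (map h ys) = map (\<lambda>y. f y @ [h y]) ys"
    for f :: "'k \<Rightarrow> int list" and h ys
    by (induction ys) auto
  ultimately show ?thesis using assms(2) by (simp add: S_matrix_def extend_matrix_def)
qed

text \<open>Cauchy-Schwarz for the Cartan form. It is strict because \<open>S \<beta> z = 0\<close>
  and \<open>S \<beta> \<beta> = 1\<close> keep a nonzero multiple of \<open>\<beta>\<close> from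
  cancelling \<open>z\<close>, so \<open>z\<close> plus or minus \<open>t\<close> times
  \<open>\<beta>\<close> has positive norm. The value \<open>2t\<close> would mean a null vector of
  an affine diagram; the affine exclusions below all end in a contradiction to this bound.\<close>

lemma S_bound:
  assumes "S \<beta> z = 0" "S \<beta> \<beta> = 1" "0 < t" "S z z \<le> t * t"
  shows "\<bar>S z \<beta>\<bar> < 2 * t"
proof -
  have "z + zscale c \<beta> \<noteq> 0" if "c \<noteq> 0" for c
    using that assms(1,2) zero_right[of \<beta>] by (auto simp: bilin dest: arg_cong[of _ _ "S \<beta>"])
  from pos[OF this[of t]] pos[OF this[of "- t"]]
  have "0 < S z z + t * S z \<beta> + t * t" "0 < S z z - t * S z \<beta> + t * t"
    using assms by (auto simp: bilin algebra_simps)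
  then have "0 < t * (2 * t + S z \<beta>)" "0 < t * (2 * t - S z \<beta>)"
    using assms(4) by (simp_all add: algebra_simps)
  then show ?thesis using assms(3) by (simp add: zero_less_mult_iff)
qed

text \<open>An isometry \<open>g\<close> replaces \<open>xs\<close> by another list in its span with
  the same matrix, and the column of \<open>\<beta>\<close> against that list is
  \<open>mat_vec g v\<close>; so one table entry serves a whole orbit. Invertibility of
  \<open>P\<close> is not tested: the forms used for \<open>Ns\<close> are unitriangular, and
  \<open>exceptional_spans\<close> then supplies the spanning.\<close>

lemma reaches_sound:
  assumes "reaches g (map fst tab) n (map (\<lambda>x. S x \<beta>) xs)"
    and "\<forall>x\<in>set xs. S \<beta> x = 0" "S \<beta> \<beta> = 1"
    and g: "congruent_matrix g (S_matrix xs) = S_matrix xs"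
    and tab: "list_all (\<lambda>(v, P). List.member Ns (congruent_matrix P (extend_matrix (S_matrix xs) v))) tab"
  shows "\<exists>ys. set ys \<subseteq> zmod.span (insert \<beta> (set xs)) \<and> S_matrix ys \<in> set Ns"
  using assms
proof (induction n arbitrary: xs)
  case 0
  then show ?case by simp
next
  case (Suc n)
  let ?v = "map (\<lambda>x. S x \<beta>) xs"
  have found: ?case if T: "map (\<lambda>x. S x \<gamma>) xs \<in> set (map fst tab)"
    and \<gamma>: "\<forall>x\<in>set xs. S \<gamma> x = 0" "S \<gamma> \<gamma> = 1" "\<gamma> \<in> zmod.span {\<beta>}" for \<gamma>
  proof -
    obtain P where "(map (\<lambda>x. S x \<gamma>) xs, P) \<in> set tab" using T by auto
    then have "S_matrix (map (combination (xs @ [\<gamma>])) P) \<in> set Ns"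
      using Suc.prems(5) by (auto simp: S_matrix_combination S_matrix_snoc[OF \<gamma>(1,2)] list_all_iff)
    moreover have "zmod.span (set (xs @ [\<gamma>])) \<subseteq> zmod.span (insert \<beta> (set xs))"
      using \<gamma>(3) by (intro zmod.span_minimal zmod.subspace_span)
        (auto intro: zmod.span_base subsetD[OF zmod.span_mono, rotated])
    then have "set (map (combination (xs @ [\<gamma>])) P) \<subseteq> zmod.span (insert \<beta> (set xs))"
      using combination_span by (auto simp del: set_append)
    ultimately show ?thesis by blast
  qed
  consider "?v \<in> set (map fst tab)" | "map uminus ?v \<in> set (map fst tab)"
    | "reaches g (map fst tab) n (mat_vec g ?v)"
    using Suc.prems(1) by auto
  then show ?case
  proof cases
    case 1
    then show ?thesis using found[of \<beta>] Suc.prems by (simp add: zmod.span_base)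
  next
    case 2
    then show ?thesis using found[of "- \<beta>"] Suc.prems
      by (simp add: o_def bilin zmod.span_base zmod.span_neg)
  next
    case 3
    let ?xs = "map (combination xs) g"
    have span: "set ?xs \<subseteq> zmod.span (set xs)" using combination_span by auto
    have M: "S_matrix ?xs = S_matrix xs" by (simp add: S_matrix_combination Suc.prems(4))
    have "\<exists>ys. set ys \<subseteq> zmod.span (insert \<beta> (set ?xs)) \<and> S_matrix ys \<in> set Ns"
    proof (rule Suc.IH)
      show "reaches g (map fst tab) n (map (\<lambda>x. S x \<beta>) ?xs)"
        using 3 by (simp add: mat_vec_def o_def S_combination_left)
      show "\<forall>x\<in>set ?xs. S \<beta> x = 0"
        using span vanish_right_on_span[of "set xs" \<beta>] Suc.prems(2) by blast
    qed (use Suc.prems M in auto)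
    moreover have "zmod.span (insert \<beta> (set ?xs)) \<subseteq> zmod.span (insert \<beta> (set xs))"
      using span by (intro zmod.span_minimal zmod.subspace_span)
        (auto intro: zmod.span_base subsetD[OF zmod.span_mono, rotated])
    ultimately show ?thesis by blast
  qed
qed

lemma extension_check_sound:
  assumes check: "extension_check (S_matrix xs) Ns Zs g tab n"
    and \<beta>: "\<forall>x\<in>set xs. S \<beta> x = 0" "S \<beta> \<beta> = 1"
    and adj: "\<exists>x\<in>set xs. S x \<beta> \<noteq> 0"
    and xs: "\<forall>x\<in>set xs. S x x = 1"
  shows "\<exists>ys. set ys \<subseteq> zmod.span (insert \<beta> (set xs)) \<and> S_matrix ys \<in> set Ns"
proof -
  let ?v = "map (\<lambda>x. S x \<beta>) xs"
  \<comment> \<open>Members of \<open>xs\<close> have norm one, so \<open>S_bound\<close> with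
    \<open>t = 1\<close> leaves three values per entry.\<close>
  have "set ?v \<subseteq> {-1, 0, 1}"
    using S_bound[of \<beta> _ 1] \<beta> xs by fastforce
  moreover have "\<bar>dot z ?v\<bar> < 2 * t" if "Z \<in> set Zs" "(t, z) \<in> set Z" for Z t z
  proof -
    let ?z = "combination xs z"
    have "0 < t" "dot z (mat_vec (S_matrix xs) z) \<le> t * t"
      using check that by (auto simp: extension_check_def list_all_iff)
    then have "S ?z ?z \<le> t * t"
      by (simp add: S_combination)
    moreover have "S \<beta> ?z = 0"
      using vanish_right_on_span[OF _ combination_span] \<beta> by blast
    ultimately show ?thesis
      using S_bound[OF _ \<beta>(2) \<open>0 < t\<close>, of ?z] by (simp add: S_combination_left)
  qed
  moreover have "length Zs = length xs" "well_sized Zs"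
    using check by (auto simp: extension_check_def S_matrix_def)
  ultimately have "?v \<in> set (candidates Zs) \<or> map uminus ?v \<in> set (candidates Zs)"
    using candidates_complete[of ?v Zs] by simp
  moreover have "\<not> list_all (\<lambda>a. a = 0) ?v" "\<not> list_all (\<lambda>a. a = 0) (map uminus ?v)"
    using adj by (auto simp: list_all_iff)
  ultimately have "reaches g (map fst tab) n ?v \<or> reaches g (map fst tab) n (map uminus ?v)"
    using check by (auto simp: extension_check_def list_all_iff)
  then consider "reaches g (map fst tab) n ?v"
    | "reaches g (map fst tab) n (map (\<lambda>x. S x (- \<beta>)) xs)"
    by (auto simp: o_def bilin)
  then show ?thesis
  proof cases
    case 1
    then show ?thesis
      using reaches_sound[OF 1 \<beta>] check by (simp add: extension_check_def)
  next
    case 2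
    have "\<exists>ys. set ys \<subseteq> zmod.span (insert (- \<beta>) (set xs)) \<and> S_matrix ys \<in> set Ns"
      using reaches_sound[OF 2] \<beta> check by (simp add: extension_check_def bilin)
    moreover have "zmod.span (insert (- \<beta>) (set xs)) \<subseteq> zmod.span (insert \<beta> (set xs))"
      by (intro zmod.span_minimal zmod.subspace_span)
        (auto intro: zmod.span_base zmod.span_neg subsetD[OF zmod.span_mono, rotated])
    ultimately show ?thesis by blast
  qed
qed

end

section \<open>The types A and D\<close>

context integral_form
begin

definition orthonormal :: "'k list \<Rightarrow> bool" where
  "orthonormal xs \<longleftrightarrow> (\<forall>x\<in>set xs. S x x = 1) \<and> sorted_wrt (\<lambda>x y. S x y = 0 \<and> S y x = 0) xs"

lemma orthonormal_append:
  "orthonormal (xs @ ys) \<longleftrightarrow> orthonormal xs \<and> orthonormal ys \<and>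
     (\<forall>x\<in>set xs. \<forall>y\<in>set ys. S x y = 0 \<and> S y x = 0)"
  by (auto simp: orthonormal_def sorted_wrt_append)

lemma orthonormal_map_upt:
  assumes "\<And>i. i < n \<Longrightarrow> S (f i) (f i) = 1"
    and "\<And>i j. i < n \<Longrightarrow> j < n \<Longrightarrow> i \<noteq> j \<Longrightarrow> S (f i) (f j) = 0"
  shows "orthonormal (map f [0..<n])"
  using assms by (auto simp: orthonormal_def sorted_wrt_iff_nth_less)

definition bipartite_pair :: "'k list \<Rightarrow> 'k list \<Rightarrow> bool" where
  "bipartite_pair A B \<longleftrightarrow> orthonormal A \<and> orthonormal B \<and> (\<forall>a\<in>set A. \<forall>b\<in>set B. S b a = 0)"

definition has_bipartite :: "nat \<Rightarrow> 'k set \<Rightarrow> bool" where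
  "has_bipartite n L \<longleftrightarrow>
     (\<exists>A B. bipartite_pair A B \<and> length A + length B = n \<and> set (A @ B) \<subseteq> L)"

lemma bipartite_pair_exceptional: "bipartite_pair A B \<Longrightarrow> exceptional (A @ B)"
  using sorted_wrt_mono_rel[of _ "\<lambda>x y. S x y = 0 \<and> S y x = 0" "\<lambda>x y. S y x = 0"]
  by (auto simp: bipartite_pair_def orthonormal_def exceptional_def sorted_wrt_append)

text \<open>
  A chain models \<open>s i = e\<^sub>i - e\<^sub>i\<^sub>+\<^sub>1\<close> in the lattice \<open>A\<^sub>k\<close> with vertices \<open>e\<^sub>0, \<dots>, e\<^sub>k\<close>, and
  \<open>partial_sum s k j\<close> is \<open>e\<^sub>j - e\<^sub>k\<close>.
\<close>

definition chain :: "nat \<Rightarrow> (nat \<Rightarrow> 'k) \<Rightarrow> 'k set \<Rightarrow> bool" where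
  "chain k s L \<longleftrightarrow> (\<forall>i<k. s i \<in> L) \<and>
     (\<forall>i<k. \<forall>j<k. S (s i) (s j) = (if i = j then 1 else if j = Suc i then - 1 else 0))"

definition partial_sum :: "(nat \<Rightarrow> 'k) \<Rightarrow> nat \<Rightarrow> nat \<Rightarrow> 'k" where
  "partial_sum s k j = (\<Sum>i=j..<k. s i)"

lemma partial_sum_k [simp]: "partial_sum s k k = 0"
  by (simp add: partial_sum_def)

lemma partial_sum_rec: "j < k \<Longrightarrow> partial_sum s k j = s j + partial_sum s k (Suc j)"
  by (simp add: partial_sum_def sum.atLeast_Suc_lessThan)

lemma partial_sum_in:
  assumes "chain k s L" "zmod.subspace L"
  shows "partial_sum s k j \<in> L"
  using assms by (auto simp: partial_sum_def chain_def intro: zmod.subspace_sum)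

lemma S_chain_partial_sum:
  assumes "chain k s L" "j \<le> k" "a < k"
  shows "S (s a) (partial_sum s k j) = (if j \<le> a then 1 else 0) - (if j \<le> Suc a \<and> Suc a < k then 1 else 0)"
  using assms(2)
proof (induction j rule: inc_induct)
  case base
  then show ?case using assms(3) by (simp add: bilin)
next
  case (step j)
  have "S (s a) (s j) = (if a = j then 1 else if j = Suc a then - 1 else 0)"
    using assms(1,3) step.hyps by (simp add: chain_def)
  then show ?case using step assms(3) by (auto simp: partial_sum_rec bilin)
qed

lemma S_partial_sums:
  assumes "chain k s L" "i \<le> k" "j \<le> k"
  shows "S (partial_sum s k i) (partial_sum s k j) = (if j \<le> i \<and> i < k then 1 else 0)"
  using assms(2)
proof (induction i rule: inc_induct)
  case base
  then show ?case by (simp add: bilin)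
next
  case (step i)
  then show ?case using S_chain_partial_sum[OF assms(1,3), of i]
    by (auto simp: partial_sum_rec[of i] bilin)
qed

lemma chain_exceptional: "chain k s L \<Longrightarrow> exceptional (map s [0..<k])"
  by (auto simp: chain_def exceptional_def sorted_wrt_iff_nth_less)

text \<open>In type A the Coxeter transformation rotates a polygon with \<open>k + 1\<close>
  vertices, and a rotation is a product of two reflections of the polygon. \<open>?A\<close> pairs
  the vertices \<open>i\<close> and \<open>k - i\<close>, \<open>?B\<close> pairs
  \<open>i + 1\<close> and \<open>k - i\<close>; within each list the pairs are nested, which makes
  \<open>S\<close> vanish in both orders.\<close>

lemma chain_has_bipartite:
  assumes "chain k s L" "zmod.subspace L"
  shows "has_bipartite k L"
proof -
  let ?t = "partial_sum s k"
  let ?B = "map (\<lambda>i. ?t (Suc i) - ?t (k - i)) [0..<k div 2]"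
  let ?A = "map (\<lambda>i. ?t i - ?t (k - i)) [0..<Suc k div 2]"
  note t = S_partial_sums[OF assms(1)]
  have "orthonormal ?A"
    by (rule orthonormal_map_upt) (auto simp: bilin t)
  moreover have "orthonormal ?B"
    by (rule orthonormal_map_upt) (auto simp: bilin t)
  moreover have "\<forall>a\<in>set ?A. \<forall>b\<in>set ?B. S a b = 0"
    by (auto simp: bilin t)
  ultimately have "bipartite_pair ?B ?A" by (simp add: bipartite_pair_def)
  moreover have "set (?B @ ?A) \<subseteq> L"
    using partial_sum_in[OF assms] assms(2) by (auto intro!: zmod.subspace_diff)
  moreover have "length ?B + length ?A = k" by simp
  ultimately show ?thesis unfolding has_bipartite_def by blast
qed

text \<open>Here \<open>\<beta>\<close> is \<open>e_v\<close> minus a new vertex placed right after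
  \<open>e_v\<close>. For \<open>v < k\<close> the edge \<open>s v\<close> is split into
  \<open>\<beta>\<close> and \<open>s v - \<beta>\<close>; for \<open>v = k\<close> the chain is
  prolonged.\<close>

lemma chain_insert_vertex:
  assumes s: "chain k s L" and L: "zmod.subspace L'" "L \<subseteq> L'" "\<beta> \<in> L'"
    and \<beta>: "\<forall>i<k. S \<beta> (s i) = 0" "S \<beta> \<beta> = 1"
    and v: "v \<le> k" "\<forall>i<k. S (s i) \<beta> = (if i = v then 1 else if Suc i = v then - 1 else 0)"
  shows "\<exists>s'. chain (Suc k) s' L'"
proof
  let ?s = "\<lambda>i. if i < v then s i else if i = v then \<beta> else if i = Suc v then s v - \<beta> else s (i - 1)"
  have "\<forall>i<Suc k. ?s i \<in> L'"
    using s L v(1) by (auto simp: chain_def intro!: zmod.subspace_diff)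
  moreover have "S (?s i) (?s j) = (if i = j then 1 else if j = Suc i then - 1 else 0)"
    if "i < Suc k" "j < Suc k" for i j
  proof -
    have ss: "S (s a) (s b) = (if a = b then 1 else if b = Suc a then - 1 else 0)"
      if "a < k" "b < k" for a b
      using s that by (simp add: chain_def)
    have s\<beta>: "S (s a) \<beta> = (if a = v then 1 else if Suc a = v then - 1 else 0)" "S \<beta> (s a) = 0"
      if "a < k" for a
      using \<beta> v that by simp_all
    have "i < v \<or> i = v \<or> i = Suc v \<or> (\<exists>a. i = Suc a \<and> v < a)"
      "j < v \<or> j = v \<or> j = Suc v \<or> (\<exists>b. j = Suc b \<and> v < b)"
      by presburger+
    then show ?thesis
      using that v(1) by (elim disjE exE conjE) (simp_all add: bilin ss s\<beta> \<beta>(2))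
  qed
  ultimately show "chain (Suc k) ?s L'" by (simp add: chain_def)
qed

text \<open>
  In the lattice \<open>D\<^sub>p\<^sub>+\<^sub>q\<close>, \<open>E i\<close> and \<open>F i\<close> are twice the standard basis vectors; the corresponding
  Coxeter transformation has two negative cycles, of lengths \<open>p\<close> and \<open>q\<close>.
\<close>

definition halvable :: "'k set \<Rightarrow> 'k set \<Rightarrow> bool" where
  "halvable \<Gamma> L \<longleftrightarrow> (\<forall>x\<in>\<Gamma>. \<forall>y\<in>\<Gamma>. \<exists>u\<in>L. u + u = x + y)"

definition cycle_pair :: "nat \<Rightarrow> nat \<Rightarrow> (nat \<Rightarrow> 'k) \<Rightarrow> (nat \<Rightarrow> 'k) \<Rightarrow> 'k set \<Rightarrow> bool" where
  "cycle_pair p q E F L \<longleftrightarrow>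
     (\<forall>i<p. \<forall>j<p. S (E i) (E j) = (if j \<le> i then 2 else - 2)) \<and>
     (\<forall>i<q. \<forall>j<q. S (F i) (F j) = (if j \<le> i then 2 else - 2)) \<and>
     (\<forall>i<p. \<forall>j<q. S (E i) (F j) = 0 \<and> S (F j) (E i) = 0) \<and>
     halvable (E ` {..<p} \<union> F ` {..<q}) L"

lemma double_inject: "x + x = y + y \<Longrightarrow> x = y" for x y :: 'k
proof -
  assume "x + x = y + y"
  then have "(x - y) + (x - y) = 0" by (simp add: algebra_simps)
  then have "S (x - y) ((x - y) + (x - y)) = 0" by (simp only: zero_right)
  then have "S (x - y) (x - y) = 0" unfolding add_right by simp
  then show "x = y" using eq_0_if_nonpos[of "x - y"] by simp
qed

text \<open>The diagonal case of halvability: the positive form excludes 2-torsion, so the half of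
  \<open>x + x\<close> is \<open>x\<close>.\<close>

lemma halvable_in:
  assumes "halvable \<Gamma> L" "x \<in> \<Gamma>"
  shows "x \<in> L"
proof -
  obtain u where "u \<in> L" "u + u = x + x" using assms unfolding halvable_def by blast
  then show ?thesis using double_inject[of u x] by simp
qed

lemma halvable_signs:
  assumes "halvable \<Gamma> L" "zmod.subspace L"
  shows "halvable (\<Gamma> \<union> uminus ` \<Gamma>) L"
proof -
  have "\<exists>u\<in>L. u + u = x - y" if "x \<in> \<Gamma>" "y \<in> \<Gamma>" for x y
  proof -
    obtain u where "u \<in> L" "u + u = x + y" using assms(1) \<open>x \<in> \<Gamma>\<close> \<open>y \<in> \<Gamma>\<close> unfolding halvable_def by blast
    then show ?thesis using halvable_in[OF assms(1) \<open>y \<in> \<Gamma>\<close>]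
      by (intro bexI[of _ "u - y"]) (auto simp: algebra_simps intro: zmod.subspace_diff[OF assms(2)])
  qed
  moreover have "\<exists>u\<in>L. u + u = - x - y" if "x \<in> \<Gamma>" "y \<in> \<Gamma>" for x y
  proof -
    obtain u where "u \<in> L" "u + u = x + y" using assms(1) \<open>x \<in> \<Gamma>\<close> \<open>y \<in> \<Gamma>\<close> unfolding halvable_def by blast
    then have "(- u) + (- u) = - x - y" by (metis add_uminus_conv_diff minus_add_distrib)
    then show ?thesis using \<open>u \<in> L\<close> zmod.subspace_neg[OF assms(2)] by blast
  qed
  moreover have "\<exists>u\<in>L. u + u = x + y" if "x \<in> \<Gamma>" "y \<in> \<Gamma>" for x y
    using that assms(1) unfolding halvable_def by blast
  ultimately show ?thesis unfolding halvable_def by (auto simp: add.commute)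
qed

lemma halvableD: "halvable \<Gamma> L \<Longrightarrow> x \<in> \<Gamma> \<Longrightarrow> y \<in> \<Gamma> \<Longrightarrow> \<exists>u\<in>L. u + u = x + y"
  unfolding halvable_def by blast

lemma halvable_mono: "halvable \<Gamma> L \<Longrightarrow> \<Gamma>' \<subseteq> \<Gamma> \<Longrightarrow> L \<subseteq> L' \<Longrightarrow> halvable \<Gamma>' L'"
  unfolding halvable_def by blast

lemma S_halves: "4 * S u v = S (u + u) (v + v)"
  by (simp add: bilin)

lemma bipartite_pair_append:
  assumes "orthonormal A1" "orthonormal A2" "orthonormal B1" "orthonormal B2" "orthonormal B3"
    and "\<forall>x\<in>set A1. \<forall>y\<in>set A2. S x y = 0 \<and> S y x = 0"
    and "\<forall>x\<in>set B1. \<forall>y\<in>set B2. S x y = 0 \<and> S y x = 0"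
    and "\<forall>x\<in>set B1. \<forall>y\<in>set B3. S x y = 0 \<and> S y x = 0"
    and "\<forall>x\<in>set B2. \<forall>y\<in>set B3. S x y = 0 \<and> S y x = 0"
    and "\<forall>x\<in>set A1. \<forall>y\<in>set B1. S y x = 0" "\<forall>x\<in>set A2. \<forall>y\<in>set B1. S y x = 0"
    and "\<forall>x\<in>set A1. \<forall>y\<in>set B2. S y x = 0" "\<forall>x\<in>set A2. \<forall>y\<in>set B2. S y x = 0"
    and "\<forall>x\<in>set A1. \<forall>y\<in>set B3. S y x = 0" "\<forall>x\<in>set A2. \<forall>y\<in>set B3. S y x = 0"
  shows "bipartite_pair (A1 @ A2) (B1 @ B2 @ B3)"
  using assms unfolding bipartite_pair_def orthonormal_append by auto

text \<open>Pairs with a constant sum are nested, and the four values of \<open>S\<close> cancel for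
  distinct nested pairs. The value 4 turns into norm one after halving both arguments.\<close>

lemma S_reversal_same:
  fixes E :: "nat \<Rightarrow> 'k"
  assumes "\<forall>i<p. \<forall>j<p. S (E i) (E j) = (if j \<le> i then 2 else - 2)"
    and "i + i' = n" "j + j' = n" "i < i'" "j < j'" "n < p"
  shows "S (E i - E i') (E j - E j') = (if i = j then 4 else 0)"
proof -
  have S: "S (E a) (E b) = (if b \<le> a then 2 else - 2)" if "a \<le> n" "b \<le> n" for a b
    using assms(1,6) that by simp
  show ?thesis
    using assms(2-5) by (cases i j rule: linorder_cases) (simp_all add: bilin S)
qed

text \<open>Sums \<open>n\<close> and \<open>n + 1\<close> belong to two reversals whose product
  shifts the cycle by one. Vanishing in this one order is what separates the two lists of a
  bipartite pair.\<close>

lemma S_reversal_shifted: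
  fixes E :: "nat \<Rightarrow> 'k"
  assumes "\<forall>i<p. \<forall>j<p. S (E i) (E j) = (if j \<le> i then 2 else - 2)"
    and "i + i' = n" "j + j' = Suc n" "i < i'" "j < j'" "Suc n < p"
  shows "S (E i - E i') (E j - E j') = 0"
proof -
  have S: "S (E a) (E b) = (if b \<le> a then 2 else - 2)" if "a \<le> Suc n" "b \<le> Suc n" for a b
    using assms(1,6) that by simp
  show ?thesis
    using assms(2-5) by (cases i j rule: linorder_cases) (simp_all add: bilin S)
qed

text \<open>Up to the sign of its last coordinate, a negative cycle is the product of a reversal and
  a shorter reversal that fixes this coordinate. The reflections in the halves of
  \<open>?e + ?f\<close> and \<open>?e - ?f\<close> change the signs of the last coordinates of both
  cycles at once, which is why the cycles are treated as a pair. The final clause traces a nonzero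
  column on \<open>A @ B\<close> back to \<open>E\<close> or \<open>F\<close>.\<close>

lemma cycle_pair_has_bipartite:
  assumes EF: "cycle_pair p q E F L" and L: "zmod.subspace L" and pq: "0 < p" "0 < q"
  shows "\<exists>A B. bipartite_pair A B \<and> length A + length B = p + q \<and> set (A @ B) \<subseteq> L \<and>
    (\<forall>\<beta>. (\<forall>i<p. S (E i) \<beta> = 0) \<longrightarrow> (\<forall>i<q. S (F i) \<beta> = 0) \<longrightarrow> (\<forall>x\<in>set (A @ B). S x \<beta> = 0))"
proof -
  obtain P Q where PQ: "p = Suc P" "q = Suc Q" using pq by (metis gr0_implies_Suc)
  let ?\<Gamma> = "E ` {..<p} \<union> F ` {..<q}"
  have SE: "S (E i) (E j) = (if j \<le> i then 2 else - 2)" if "i < p" "j < p" for i j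
    using EF that by (simp add: cycle_pair_def)
  have SF: "S (F i) (F j) = (if j \<le> i then 2 else - 2)" if "i < q" "j < q" for i j
    using EF that by (simp add: cycle_pair_def)
  have SEF: "S (E i) (F j) = 0" "S (F j) (E i) = 0" if "i < p" "j < q" for i j
    using EF that by (simp_all add: cycle_pair_def)
  have \<Gamma>: "halvable ?\<Gamma> L" using EF by (simp add: cycle_pair_def)
  have half: "\<exists>u\<in>L. u + u = x + y" if "x \<in> ?\<Gamma> \<union> uminus ` ?\<Gamma>" "y \<in> ?\<Gamma> \<union> uminus ` ?\<Gamma>" for x y
    using halvable_signs[OF \<Gamma> L] that unfolding halvable_def by meson
  define h where "h x = (SOME u. u \<in> L \<and> u + u = x)" for x
  have h: "h (x + y) \<in> L \<and> h (x + y) + h (x + y) = x + y"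
    if "x \<in> ?\<Gamma> \<union> uminus ` ?\<Gamma>" "y \<in> ?\<Gamma> \<union> uminus ` ?\<Gamma>" for x y
    unfolding h_def by (rule someI_ex) (use half[OF that] in blast)
  have hE: "h (E i - E j) \<in> L" "h (E i - E j) + h (E i - E j) = E i - E j" if "i < p" "j < p" for i j
    using h[of "E i" "- E j"] that by auto
  have hF: "h (F i - F j) \<in> L" "h (F i - F j) + h (F i - F j) = F i - F j" if "i < q" "j < q" for i j
    using h[of "F i" "- F j"] that by auto
  let ?e = "E P" and ?f = "F Q"
  have hp: "h (?e + ?f) \<in> L" "h (?e + ?f) + h (?e + ?f) = ?e + ?f"
    using h[of ?e ?f] PQ by auto
  have hm: "h (?e - ?f) \<in> L" "h (?e - ?f) + h (?e - ?f) = ?e - ?f"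
    using h[of ?e "- ?f"] PQ by auto
  let ?A1 = "map (\<lambda>i. h (E i - E (P - i))) [0..<p div 2]"
  let ?A2 = "map (\<lambda>i. h (F i - F (Q - i))) [0..<q div 2]"
  let ?B1 = "map (\<lambda>i. h (E i - E (P - Suc i))) [0..<P div 2]"
  let ?B2 = "map (\<lambda>i. h (F i - F (Q - Suc i))) [0..<Q div 2]"
  let ?C = "[h (?e + ?f), h (?e - ?f)]"
  have val: "S (h x) (h y) = S x y div 4" if "h x + h x = x" "h y + h y = y" for x y
    using S_halves[of "h x" "h y"] that by simp
  have EE: "S (h (E i - E j)) (h (E k - E l)) = S (E i - E j) (E k - E l) div 4"
    if "i < p" "j < p" "k < p" "l < p" for i j k l
    using that by (intro val) (simp_all add: hE)
  have FF: "S (h (F i - F j)) (h (F k - F l)) = S (F i - F j) (F k - F l) div 4"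
    if "i < q" "j < q" "k < q" "l < q" for i j k l
    using that by (intro val) (simp_all add: hF)
  have EF0: "S (h (E i - E j)) (h (F k - F l)) = 0" "S (h (F k - F l)) (h (E i - E j)) = 0"
    if "i < p" "j < p" "k < q" "l < q" for i j k l
    using that by (subst val; simp add: hE hF bilin SEF)+
  have EC: "S (h (E i - E j)) (h (?e + ?f)) = S (E i - E j) ?e div 4"
    "S (h (?e + ?f)) (h (E i - E j)) = S ?e (E i - E j) div 4"
    "S (h (E i - E j)) (h (?e - ?f)) = S (E i - E j) ?e div 4"
    "S (h (?e - ?f)) (h (E i - E j)) = S ?e (E i - E j) div 4" if "i < p" "j < p" for i j
    using that PQ by (subst val; simp add: hE hp hm bilin SEF)+
  have FC: "S (h (F i - F j)) (h (?e + ?f)) = S (F i - F j) ?f div 4"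
    "S (h (?e + ?f)) (h (F i - F j)) = S ?f (F i - F j) div 4"
    "S (h (F i - F j)) (h (?e - ?f)) = - S (F i - F j) ?f div 4"
    "S (h (?e - ?f)) (h (F i - F j)) = - S ?f (F i - F j) div 4" if "i < q" "j < q" for i j
    using that PQ by (subst val; simp add: hF hp hm bilin SEF)+
  have E: "\<forall>i<p. \<forall>j<p. S (E i) (E j) = (if j \<le> i then 2 else - 2)"
    and F: "\<forall>i<q. \<forall>j<q. S (F i) (F j) = (if j \<le> i then 2 else - 2)"
    using EF by (simp_all add: cycle_pair_def)
  have onE: "S (h (E i - E (m - i))) (h (E j - E (m - j))) = (if i = j then 1 else 0)"
    if "m < p" "i < Suc m div 2" "j < Suc m div 2" for i j m
    using that S_reversal_same[OF E, of i "m - i" m j "m - j"] by (subst EE) auto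
  have onF: "S (h (F i - F (m - i))) (h (F j - F (m - j))) = (if i = j then 1 else 0)"
    if "m < q" "i < Suc m div 2" "j < Suc m div 2" for i j m
    using that S_reversal_same[OF F, of i "m - i" m j "m - j"] by (subst FF) auto
  have "orthonormal ?A1" "orthonormal ?A2"
    by (rule orthonormal_map_upt; simp add: onE onF PQ)+
  moreover have "orthonormal ?B1" "orthonormal ?B2"
    using onE[of "P - 1"] onF[of "Q - 1"] PQ by (auto intro!: orthonormal_map_upt)
  ultimately have on: "orthonormal ?A1" "orthonormal ?A2" "orthonormal ?B1" "orthonormal ?B2" .
  have onC: "orthonormal ?C"
    using PQ by (simp add: orthonormal_def val[OF hp(2) hp(2)] val[OF hm(2) hm(2)]
        val[OF hp(2) hm(2)] val[OF hm(2) hp(2)] bilin SE SF SEF)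
  have crossEF: "\<forall>x\<in>set ?A1. \<forall>y\<in>set ?A2. S x y = 0 \<and> S y x = 0"
    "\<forall>x\<in>set ?B1. \<forall>y\<in>set ?B2. S x y = 0 \<and> S y x = 0"
    "\<forall>x\<in>set ?A1. \<forall>y\<in>set ?B2. S y x = 0"
    "\<forall>x\<in>set ?A2. \<forall>y\<in>set ?B1. S y x = 0"
    using PQ by (auto simp: EF0)
  have last: "S (E i) (E P) = - 2" "S (E P) (E i) = 2" if "i < P" for i
    using that PQ by (simp_all add: SE)
  have lastF: "S (F i) (F Q) = - 2" "S (F Q) (F i) = 2" if "i < Q" for i
    using that PQ by (simp_all add: SF)
  have crossB: "\<forall>x\<in>set ?B1. \<forall>y\<in>set ?C. S x y = 0 \<and> S y x = 0"
    "\<forall>x\<in>set ?B2. \<forall>y\<in>set ?C. S x y = 0 \<and> S y x = 0"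
    using PQ by (auto simp: EC FC bilin last lastF)
  have "S (E P) (E i) = 2" if "i < Suc P" for i using that PQ by (simp add: SE)
  moreover have "S (F Q) (F i) = 2" if "i < Suc Q" for i using that PQ by (simp add: SF)
  ultimately have crossC: "\<forall>x\<in>set ?A1. \<forall>y\<in>set ?C. S y x = 0" "\<forall>x\<in>set ?A2. \<forall>y\<in>set ?C. S y x = 0"
    using PQ by (auto simp: EC FC bilin)
  have crossAB: "\<forall>x\<in>set ?A1. \<forall>y\<in>set ?B1. S y x = 0" "\<forall>x\<in>set ?A2. \<forall>y\<in>set ?B2. S y x = 0"
  proof -
    have "S (h (E j - E (P - Suc j))) (h (E i - E (P - i))) = 0" if "i < p div 2" "j < P div 2" for i j
      using that PQ S_reversal_shifted[OF E, of j "P - Suc j" "P - 1" i "P - i"] by (subst EE) auto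
    then show "\<forall>x\<in>set ?A1. \<forall>y\<in>set ?B1. S y x = 0" by auto
    have "S (h (F j - F (Q - Suc j))) (h (F i - F (Q - i))) = 0" if "i < q div 2" "j < Q div 2" for i j
      using that PQ S_reversal_shifted[OF F, of j "Q - Suc j" "Q - 1" i "Q - i"] by (subst FF) auto
    then show "\<forall>x\<in>set ?A2. \<forall>y\<in>set ?B2. S y x = 0" by auto
  qed
  let ?A = "?A1 @ ?A2" and ?B = "?B1 @ ?B2 @ ?C"
  have "bipartite_pair ?A ?B"
    by (rule bipartite_pair_append) (fact on onC crossEF crossB crossC crossAB)+
  moreover have "length ?A + length ?B = p + q" 
  proof -
    have "Suc n div 2 + n div 2 = n" for n :: nat by presburger
    from this[of P] this[of Q] show ?thesis using PQ by simp
  qed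
  moreover have "set (?A @ ?B) \<subseteq> L" using PQ hp hm by (auto simp: hE hF)
  moreover have "S x \<beta> = 0"
    if "\<forall>i<p. S (E i) \<beta> = 0" "\<forall>i<q. S (F i) \<beta> = 0" "x \<in> set (?A @ ?B)" for \<beta> x
  proof -
    have half: "S (h z) \<beta> = 0" if "h z + h z = z" "S z \<beta> = 0" for z
    proof -
      have "S (h z) \<beta> + S (h z) \<beta> = S z \<beta>" using that(1) by (metis add_left)
      then show ?thesis using that(2) by simp
    qed
    have E0: "S (E i) \<beta> = 0" if "i < Suc P" for i using that \<open>\<forall>i<p. S (E i) \<beta> = 0\<close> PQ by simp
    have F0: "S (F i) \<beta> = 0" if "i < Suc Q" for i using that \<open>\<forall>i<q. S (F i) \<beta> = 0\<close> PQ by simp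
    show ?thesis
      using that(3) PQ by (auto intro!: half simp: hE hF hp hm; simp add: bilin E0 F0)
  qed
  ultimately show ?thesis by blast
qed

text \<open>In coordinates \<open>\<beta>\<close> is \<open>e_v + e_w\<close>, a root of type D. Its
  reflection cuts the single cycle of type A into two negative cycles.\<close>

lemma chain_insert_edge:
  assumes s: "chain k s L" and L: "zmod.subspace L" "zmod.subspace L'" "L \<subseteq> L'" "\<beta> \<in> L'"
    and \<beta>: "\<forall>x\<in>L. S \<beta> x = 0" "S \<beta> \<beta> = 1"
    and vw: "v < w" "w \<le> k"
    and h: "\<forall>i\<le>k. S (partial_sum s k i) \<beta> =
      (if i \<in> {v, w} then 1 else 0) - (if k \<in> {v, w} then 1 else 0)"
  shows "\<exists>E F. cycle_pair (w - v) (Suc k - (w - v)) E F L'"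
proof -
  let ?t = "partial_sum s k"
  \<comment> \<open>This is twice the coordinate vector \<open>e_i\<close>:
    \<open>?t i - ?t v\<close> is \<open>e_i - e_v\<close>, and \<open>\<beta>\<close> is
    \<open>e_v + e_w\<close>.\<close>
  define e where "e i = \<beta> + (?t i - ?t v) + (?t i - ?t w)" for i
  have t: "S (?t i) (?t j) = (if j \<le> i \<and> i < k then 1 else 0)" if "i \<le> k" "j \<le> k" for i j
    using S_partial_sums[OF s that] .
  have \<beta>t: "S \<beta> (?t i) = 0" for i using \<beta>(1) partial_sum_in[OF s L(1)] by blast
  have t\<beta>: "S (?t i) \<beta> = (if i \<in> {v, w} then 1 else 0) - (if k \<in> {v, w} then 1 else 0)"
    if "i \<le> k" for i
    using h that by blast
  have ee: "S (e i) (e j) =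
      (if v < i \<and> i \<le> w then
         (if v < j \<and> j \<le> w then (if j \<le> i then 2 else - 2) else 0)
       else if v < j \<and> j \<le> w then 0
       else if j \<le> i \<longleftrightarrow> (j > w \<longleftrightarrow> i > w) then 2 else - 2)"
    if "i \<le> k" "j \<le> k" for i j
    using that vw unfolding e_def by (auto simp: bilin t \<beta>t t\<beta> \<beta>(2))
  \<comment> \<open>\<open>?E\<close> runs through the positions \<open>v + 1, ..., w\<close>;
    \<open>?F\<close> takes the others in cyclic order, from \<open>w + 1\<close> to
    \<open>k\<close> and then from 0 to \<open>v\<close>.\<close>
  let ?E = "\<lambda>i. e (Suc v + i)"
  let ?F = "\<lambda>i. e (if Suc w + i \<le> k then Suc w + i else w + i - k)"
  have "halvable (range e) L'"
  proof -
    have "\<exists>u\<in>L'. u + u = e i + e j" for i j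
      using L partial_sum_in[OF s L(1)]
      by (intro bexI[of _ "\<beta> + (?t i - ?t v) + (?t j - ?t w)"])
        (auto simp: e_def algebra_simps intro!: zmod.subspace_add zmod.subspace_diff)
    then show ?thesis unfolding halvable_def by blast
  qed
  then have half: "halvable (?E ` {..<w - v} \<union> ?F ` {..<Suc k - (w - v)}) L'"
    by (rule halvable_mono) auto
  have EE: "S (?E i) (?E j) = (if j \<le> i then 2 else - 2)" if "i < w - v" "j < w - v" for i j
    using that vw by (subst ee) auto
  have FF: "S (?F i) (?F j) = (if j \<le> i then 2 else - 2)"
    if "i < Suc k - (w - v)" "j < Suc k - (w - v)" for i j
    using that vw by (subst ee) auto
  have EF: "S (?E i) (?F j) = 0" "S (?F j) (?E i) = 0"
    if "i < w - v" "j < Suc k - (w - v)" for i j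
    using that vw by (subst ee; auto)+
  have "cycle_pair (w - v) (Suc k - (w - v)) ?E ?F L'"
    unfolding cycle_pair_def using EE FF EF half by (intro conjI allI impI) simp_all
  then show ?thesis by blast
qed

section \<open>Extending type A in rank at least 8\<close>

lemma S_add_zscale:
  "S (z + zscale c t) (z + zscale c t) = S z z + c * (S z t + S t z) + c * c * S t t"
  by (simp add: bilin algebra_simps)

text \<open>The combination has coordinate \<open>c u\<close> at \<open>e_u\<close> and minus the
  sum of all \<open>c u\<close> at \<open>e_k\<close>; the right-hand side is its sum of
  squares.\<close>

lemma double_S_chain_combination:
  assumes "chain k s L" "n \<le> k"
  shows "2 * S (\<Sum>u<n. zscale (c u) (partial_sum s k u)) (\<Sum>u<n. zscale (c u) (partial_sum s k u)) =
    (\<Sum>u<n. c u)\<^sup>2 + (\<Sum>u<n. (c u)\<^sup>2)"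
  using assms(2)
proof (induction n)
  case 0
  then show ?case by (simp add: bilin)
next
  case (Suc n)
  let ?t = "partial_sum s k"
  let ?z = "\<Sum>u<n. zscale (c u) (?t u)"
  have "S ?z (?t n) + S (?t n) ?z = (\<Sum>u<n. c u * (S (?t u) (?t n) + S (?t n) (?t u)))"
    by (simp add: sum_left sum_right zscale_left zscale_right sum.distrib distrib_left)
  also have "\<dots> = (\<Sum>u<n. c u)"
    using Suc.prems by (intro sum.cong) (auto simp: S_partial_sums[OF assms(1)])
  finally have cross: "S ?z (?t n) + S (?t n) ?z = (\<Sum>u<n. c u)" .
  have "S (?t n) (?t n) = 1" using Suc.prems by (simp add: S_partial_sums[OF assms(1)])
  moreover have "2 * S ?z ?z = (\<Sum>u<n. c u)\<^sup>2 + (\<Sum>u<n. (c u)\<^sup>2)" using Suc by simp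
  ultimately show ?case
    unfolding sum.lessThan_Suc S_add_zscale cross by (simp add: power2_eq_square algebra_simps)
qed

text \<open>A null vector of the affine diagram \<open>E\<^sub>7\<close> or \<open>E\<^sub>8\<close> rules out the configuration.\<close>

lemma chain_levels_bounded:
  assumes s: "chain k s L" and L: "zmod.subspace L"
    and \<beta>: "\<forall>x\<in>L. S \<beta> x = 0" "S \<beta> \<beta> = 1"
    and XY: "X \<subseteq> {..k}" "Y \<subseteq> {..k}" "X \<inter> Y = {}"
    and H: "\<forall>u\<in>X. S (partial_sum s k u) \<beta> = m + 1" "\<forall>u\<in>Y. S (partial_sum s k u) \<beta> = m"
    and ab: "a * int (card X) = n" "b * int (card Y) = n"
    and t: "0 < t" "a\<^sup>2 * int (card X) + b\<^sup>2 * int (card Y) \<le> 2 * t * t"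
  shows "n < 2 * t"
proof -
  let ?t = "partial_sum s k"
  \<comment> \<open>By \<open>ab\<close> these coefficients sum to zero over all
    \<open>k + 1\<close> vertices. So \<open>z\<close> below has coordinate \<open>c k\<close> at
    the last vertex although its sum stops before \<open>k\<close>, and the common level
    \<open>m\<close> drops out of \<open>S z \<beta>\<close>.\<close>
  define c where "c u = (if u \<in> X then a else if u \<in> Y then - b else 0)" for u
  define z where "z = (\<Sum>u<k. zscale (c u) (?t u))"
  have fin: "finite X" "finite Y" using XY(1,2) finite_subset by blast+
  have split: "(\<Sum>u\<le>k. g (c u) u) = (\<Sum>u\<in>X. g a u) + (\<Sum>u\<in>Y. g (- b) u)"
    if "\<And>u. g 0 u = 0" for g :: "int \<Rightarrow> nat \<Rightarrow> int"
  proof -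
    have "(\<Sum>u\<le>k. g (c u) u) = (\<Sum>u\<in>X \<union> Y. g (c u) u)"
      using XY that by (intro sum.mono_neutral_right) (auto simp: c_def)
    also have "\<dots> = (\<Sum>u\<in>X. g (c u) u) + (\<Sum>u\<in>Y. g (c u) u)"
      using XY(3) fin by (simp add: sum.union_disjoint)
    finally show ?thesis using XY(3) by (auto simp: c_def intro!: arg_cong2[of _ _ _ _ "(+)"] sum.cong)
  qed
  have sum0: "(\<Sum>u\<le>k. c u) = 0"
    using split[of "\<lambda>x _. x"] ab by (simp add: mult.commute)
  have "(\<Sum>u\<le>k. (c u)\<^sup>2) = a\<^sup>2 * int (card X) + b\<^sup>2 * int (card Y)"
    using split[of "\<lambda>x _. x\<^sup>2"] by (simp add: mult.commute)
  moreover have "(\<Sum>u<k. c u) = - c k" using sum0 by (simp add: lessThan_Suc_atMost[symmetric])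
  ultimately have "2 * S z z = a\<^sup>2 * int (card X) + b\<^sup>2 * int (card Y)"
    unfolding z_def double_S_chain_combination[OF s order_refl] by (simp add: lessThan_Suc_atMost[symmetric])
  then have zt: "S z z \<le> t * t" using t(2) by simp
  have "z \<in> L" unfolding z_def
    using L partial_sum_in[OF s L] by (intro zmod.subspace_sum zmod.subspace_scale)
  then have "\<bar>S z \<beta>\<bar> < 2 * t" using S_bound[OF _ \<beta>(2) t(1) zt] \<beta>(1) by blast
  moreover have "S z \<beta> = n"
  proof -
    have "S z \<beta> = (\<Sum>u\<le>k. c u * S (?t u) \<beta>)"
      by (simp add: z_def sum_left zscale_left lessThan_Suc_atMost[symmetric] zero_left)
    also have "\<dots> = (\<Sum>u\<in>X. a * (m + 1)) + (\<Sum>u\<in>Y. - b * m)"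
      using split[of "\<lambda>x u. x * S (?t u) \<beta>"] H by simp
    also have "\<dots> = n" using ab by (simp add: algebra_simps)
    finally show ?thesis .
  qed
  ultimately show ?thesis by simp
qed

definition classical :: "nat \<Rightarrow> 'k set \<Rightarrow> bool" where
  "classical k L \<longleftrightarrow> (\<exists>s. chain k s L) \<or>
     (\<exists>p q E F. 0 < p \<and> 0 < q \<and> p + q = k \<and> cycle_pair p q E F L)"

text \<open>One raised vertex keeps type A; two raised vertices make \<open>\<beta>\<close> a root
  \<open>e_v + e_w\<close> and lead to type D. The level \<open>m\<close> is fixed by the vertex
  \<open>k\<close>, where the partial sum is 0.\<close>

lemma chain_extend_few:
  assumes s: "chain k s L" and L: "zmod.subspace L" "zmod.subspace L'" "L \<subseteq> L'" "\<beta> \<in> L'"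
    and \<beta>: "\<forall>x\<in>L. S \<beta> x = 0" "S \<beta> \<beta> = 1"
    and k: "2 \<le> k"
    and K: "K \<subseteq> {..k}" "card K = 1 \<or> card K = 2"
    and H: "\<forall>i\<le>k. S (partial_sum s k i) \<beta> = m + (if i \<in> K then 1 else 0)"
  shows "classical (Suc k) L'"
proof -
  let ?t = "partial_sum s k"
  have m: "m = - (if k \<in> K then 1 else 0)" using H[rule_format, of k] by (simp add: zero_left)
  from K(2) show ?thesis
  proof
    assume "card K = 1"
    then obtain v where v: "K = {v}" by (metis card_1_singletonE)
    have "S (s i) \<beta> = (if i = v then 1 else if Suc i = v then - 1 else 0)" if "i < k" for i
    proof -
      have "S (s i) \<beta> = S (?t i) \<beta> - S (?t (Suc i)) \<beta>"
        using that by (simp add: partial_sum_rec[of i] bilin)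
      then show ?thesis using that H v by auto
    qed
    moreover have "\<forall>i<k. S \<beta> (s i) = 0" using s \<beta>(1) by (simp add: chain_def)
    ultimately have "\<exists>s'. chain (Suc k) s' L'"
      using chain_insert_vertex[OF s L(2-4) _ \<beta>(2), of v] K(1) v by simp
    then show ?thesis by (simp add: classical_def)
  next
    assume "card K = 2"
    then obtain v w where vw: "K = {v, w}" "v < w"
      by (metis card_2_iff insert_commute linorder_neqE_nat)
    then have "\<exists>E F. cycle_pair (w - v) (Suc k - (w - v)) E F L'"
      using K(1) H m by (intro chain_insert_edge[OF s L \<beta>]) auto
    then obtain E F where EF: "cycle_pair (w - v) (Suc k - (w - v)) E F L'" by blast
    have "0 < w - v" "0 < Suc k - (w - v)" "(w - v) + (Suc k - (w - v)) = Suc k"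
      using vw K(1) by auto
    then show ?thesis using EF unfolding classical_def by blast
  qed
qed

text \<open>The values of \<open>\<beta>\<close> at two vertices differ by at most one, as
  \<open>e_i - e_j\<close> has norm one. So the vertices split into a raised set \<open>K\<close>
  and a lower set \<open>C\<close>. If both have at least 3 elements, then having at least 9
  vertices forces subsets of sizes 4 and 4, or 3 and 6: affine E7 or affine E8.\<close>

lemma chain_extend:
  assumes s: "chain k s L" and L: "zmod.subspace L" "zmod.subspace L'" "L \<subseteq> L'" "\<beta> \<in> L'"
    and \<beta>: "\<forall>x\<in>L. S \<beta> x = 0" "S \<beta> \<beta> = 1" "\<exists>i<k. S (s i) \<beta> \<noteq> 0"
    and k: "8 \<le> k"
  shows "classical (Suc k) L'"
proof -
  let ?t = "partial_sum s k"
  let ?H = "\<lambda>i. S (?t i) \<beta>"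
  have close: "\<bar>?H i - ?H j\<bar> \<le> 1" if "i \<le> k" "j \<le> k" for i j
  proof (cases "i = j")
    case False
    have "S (?t i - ?t j) (?t i - ?t j) = 1"
      using that False by (simp add: bilin S_partial_sums[OF s])
    moreover have "S \<beta> (?t i - ?t j) = 0"
      using \<beta>(1) partial_sum_in[OF s L(1)] by (simp add: bilin)
    ultimately show ?thesis using S_bound[of \<beta> "?t i - ?t j" 1] \<beta>(2) by (simp add: bilin)
  qed simp
  define m where "m = Min (?H ` {..k})"
  have "m \<in> ?H ` {..k}" unfolding m_def by (rule Min_in) auto
  then obtain j where j: "j \<le> k" "?H j = m" by auto
  have H: "?H i = m \<or> ?H i = m + 1" if "i \<le> k" for i
  proof -
    have "m \<le> ?H i" unfolding m_def using that by (intro Min_le) auto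
    then show ?thesis using close[OF that j(1)] j(2) by auto
  qed
  define K where "K = {i. i \<le> k \<and> ?H i = m + 1}"
  define C where "C = {i. i \<le> k \<and> ?H i = m}"
  have KC: "K \<subseteq> {..k}" "C \<subseteq> {..k}" "K \<inter> C = {}" "K \<union> C = {..k}"
    using H by (auto simp: K_def C_def)
  then have fin: "finite K" "finite C" using finite_subset by blast+
  have card: "card K + card C = Suc k"
    using KC(3,4) fin card_Un_disjoint[of K C] by simp
  have "K \<noteq> {}"
  proof
    assume "K = {}"
    then have "?H i = m" if "i \<le> k" for i using H that by (auto simp: K_def)
    then have "S (s i) \<beta> = 0" if "i < k" for i
      using that partial_sum_rec[of i k s] by (metis Suc_leI add_cancel_left_left add_left less_imp_le_nat)
    then show False using \<beta>(3) by blast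
  qed
  moreover have "C \<noteq> {}" using j by (auto simp: C_def)
  ultimately have pos: "0 < card K" "0 < card C" using fin by (simp_all add: card_gt_0_iff)
  have few: ?thesis if "card K \<le> 2 \<or> card C \<le> 2"
    using that
  proof
    assume "card K \<le> 2"
    then have "card K = 1 \<or> card K = 2" using pos by linarith
    moreover have "\<forall>i\<le>k. ?H i = m + (if i \<in> K then 1 else 0)" using H by (auto simp: K_def)
    ultimately show ?thesis using k by (intro chain_extend_few[OF s L \<beta>(1,2) _ KC(1)]) auto
  next
    \<comment> \<open>Passing to \<open>- \<beta>\<close> exchanges raised and lower
      vertices.\<close>
    assume "card C \<le> 2"
    then have "card C = 1 \<or> card C = 2" using pos by linarith
    moreover have "S (?t i) (- \<beta>) = (- m - 1) + (if i \<in> C then 1 else 0)" if "i \<le> k" for i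
      using H[OF that] that by (auto simp: C_def bilin)
    moreover have "- \<beta> \<in> L'" "\<forall>x\<in>L. S (- \<beta>) x = 0" "S (- \<beta>) (- \<beta>) = 1"
      using L \<beta> by (auto simp: bilin zmod.subspace_neg)
    ultimately show ?thesis
      using k by (intro chain_extend_few[OF s L(1-3) _ _ _ _ KC(2), of "- \<beta>"]) auto
  qed
  have subs: "\<exists>X\<subseteq>K. card X = x" if "x \<le> card K" for x
    using that by (meson obtain_subset_with_card_n)
  have subs': "\<exists>Y\<subseteq>C. card Y = x" if "x \<le> card C" for x
    using that by (meson obtain_subset_with_card_n)
  have null: False
    if bnd: "x \<le> card K" "y \<le> card C" "a * int x = 2 * t" "b * int y = 2 * t"
      "0 < t" "a\<^sup>2 * int x + b\<^sup>2 * int y \<le> 2 * t * t" for x y a b t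
  proof -
    obtain X Y where XY: "X \<subseteq> K" "card X = x" "Y \<subseteq> C" "card Y = y"
      using subs[OF bnd(1)] subs'[OF bnd(2)] by blast
    have "2 * t < 2 * t"
    proof (rule chain_levels_bounded[OF s L(1) \<beta>(1,2)])
      show "X \<subseteq> {..k}" "Y \<subseteq> {..k}" "X \<inter> Y = {}" using XY KC by auto
      show "\<forall>u\<in>X. ?H u = m + 1" "\<forall>u\<in>Y. ?H u = m" using XY by (auto simp: K_def C_def)
    qed (use bnd XY in auto)
    then show False by simp
  qed
  show ?thesis
  proof (cases "card K \<le> 2 \<or> card C \<le> 2")
    case False
    then consider "4 \<le> card K" "4 \<le> card C" | "3 \<le> card K" "6 \<le> card C" | "6 \<le> card K" "3 \<le> card C"
      using card k by linarith
    then show ?thesis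
    proof cases
      case 1
      \<comment> \<open>The arguments follow the order of occurrence \<open>x y a t b\<close>. The
        norm bound holds with equality: this is a null vector of affine E7, and in the other two
        cases of affine E8.\<close>
      then show ?thesis using null[of 4 4 1 2 1] by simp
    next
      case 2
      then show ?thesis using null[of 3 6 2 3 1] by simp
    next
      case 3
      then show ?thesis using null[of 6 3 1 3 2] by simp
    qed
  qed (rule few)
qed

section \<open>Extending type D in rank at least 8\<close>

lemma halvable_insert:
  assumes "halvable \<Gamma> L" "z \<in> L" "\<And>x. x \<in> \<Gamma> \<Longrightarrow> \<exists>u\<in>L. u + u = x + z"
  shows "halvable (insert z \<Gamma>) L"
  unfolding halvable_def
proof (intro ballI)
  fix x y
  assume "x \<in> insert z \<Gamma>" "y \<in> insert z \<Gamma>"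
  then consider "x = z" "y = z" | "x = z" "y \<in> \<Gamma>" | "x \<in> \<Gamma>" "y = z" | "x \<in> \<Gamma>" "y \<in> \<Gamma>"
    by blast
  then show "\<exists>u\<in>L. u + u = x + y"
  proof cases
    case 1
    then show ?thesis using assms(2) by blast
  next
    case 2
    then show ?thesis using assms(3)[of y] by (simp add: add.commute)
  next
    case 3
    then show ?thesis using assms(3)[of x] by simp
  next
    case 4
    then show ?thesis using halvableD[OF assms(1)] by blast
  qed
qed

lemma cycle_pair_swap: "cycle_pair p q E F L \<Longrightarrow> cycle_pair q p F E L"
  unfolding cycle_pair_def by (simp add: Un_commute)

text \<open>Here \<open>\<beta>\<close> is a new coordinate vector minus \<open>e_n\<close>, so
  \<open>E n + \<beta> + \<beta>\<close> is twice the new coordinate vector.\<close>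

lemma cycle_pair_extend_last:
  assumes EF: "cycle_pair (Suc n) q E F L" and L: "zmod.subspace L'" "L \<subseteq> L'" "\<beta> \<in> L'"
    and \<beta>: "\<forall>x\<in>L. S \<beta> x = 0" "S \<beta> \<beta> = 1"
    and E\<beta>: "S (E n) \<beta> = - 2" "\<forall>i<n. S (E i) \<beta> = 0" and F\<beta>: "\<forall>i<q. S (F i) \<beta> = 0"
  shows "\<exists>E. cycle_pair (Suc (Suc n)) q E F L'"
proof -
  let ?E = "E(Suc n := E n + \<beta> + \<beta>)"
  have half: "halvable (E ` {..<Suc n} \<union> F ` {..<q}) L" using EF by (simp add: cycle_pair_def)
  have \<beta>0: "S \<beta> (E i) = 0" if "i \<le> n" for i
    using halvable_in[OF half] \<beta>(1) that by simp
  have \<beta>F: "S \<beta> (F i) = 0" if "i < q" for i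
    using halvable_in[OF half] \<beta>(1) that by simp
  have SE: "S (E i) (E j) = (if j \<le> i then 2 else - 2)" if "i \<le> n" "j \<le> n" for i j
    using EF that by (simp add: cycle_pair_def)
  have SEF: "S (E i) (F j) = 0" "S (F j) (E i) = 0" if "i \<le> n" "j < q" for i j
    using EF that by (simp_all add: cycle_pair_def)
  have "S (?E i) (?E j) = (if j \<le> i then 2 else - 2)" if "i < Suc (Suc n)" "j < Suc (Suc n)" for i j
  proof -
    have "i \<le> n \<or> i = Suc n" "j \<le> n \<or> j = Suc n" "i = n \<or> i < n \<or> i = Suc n" using that by auto
    then show ?thesis
      by (elim disjE) (simp_all add: bilin SE \<beta>0 E\<beta> \<beta>(2))
  qed
  moreover have "S (?E i) (F j) = 0 \<and> S (F j) (?E i) = 0" if "i < Suc (Suc n)" "j < q" for i j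
    using that F\<beta> by (cases "i = Suc n") (simp_all add: bilin SEF \<beta>F)
  moreover have "halvable (?E ` {..<Suc (Suc n)} \<union> F ` {..<q}) L'"
  proof -
    let ?\<Gamma> = "E ` {..<Suc n} \<union> F ` {..<q}"
    have "\<exists>u\<in>L'. u + u = x + (E n + \<beta> + \<beta>)" if x: "x \<in> ?\<Gamma>" for x
    proof -
      obtain u where "u \<in> L" "u + u = x + E n" using halvableD[OF half x, of "E n"] by auto
      then show ?thesis using L
        by (intro bexI[of _ "u + \<beta>"]) (auto simp: algebra_simps intro: zmod.subspace_add)
    qed
    moreover have "E n \<in> L" using halvable_in[OF half] by simp
    then have "E n + \<beta> + \<beta> \<in> L'" using L by (auto intro!: zmod.subspace_add)
    ultimately have "halvable (insert (E n + \<beta> + \<beta>) ?\<Gamma>) L'"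
      using halvable_mono[OF half order_refl L(2)] by (intro halvable_insert)
    then show ?thesis by (rule halvable_mono) (auto simp: less_Suc_eq)
  qed
  ultimately show ?thesis using EF unfolding cycle_pair_def by blast
qed

text \<open>A negative cycle may start at any index if the coordinates that wrap around change sign.
  With this shift \<open>i\<close> becomes the last index, carrying \<open>- E i\<close>.\<close>

lemma cycle_pair_rotate:
  assumes EF: "cycle_pair p q E F L" and L: "zmod.subspace L" and i: "i < p"
  shows "cycle_pair p q (\<lambda>j. if Suc (i + j) < p then E (Suc (i + j)) else - E (Suc (i + j) - p)) F L"
    (is "cycle_pair p q ?E F L")
proof -
  have "halvable (E ` {..<p} \<union> F ` {..<q} \<union> uminus ` (E ` {..<p} \<union> F ` {..<q})) L"
    using EF halvable_signs[OF _ L] by (simp add: cycle_pair_def)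
  then have "halvable (?E ` {..<p} \<union> F ` {..<q}) L"
    by (rule halvable_mono) (use i in auto)
  moreover have "S (?E a) (?E b) = (if b \<le> a then 2 else - 2)" if "a < p" "b < p" for a b
  proof -
    have SE: "S (E i) (E j) = (if j \<le> i then 2 else - 2)" if "i < p" "j < p" for i j
      using EF that by (simp add: cycle_pair_def)
    show ?thesis using that i by (auto simp: bilin SE)
  qed
  ultimately show ?thesis using EF i unfolding cycle_pair_def by (auto simp: bilin)
qed

lemma cycle_pair_extend_vector:
  assumes EF: "cycle_pair p q E F L" and L: "zmod.subspace L" "zmod.subspace L'" "L \<subseteq> L'" "\<beta> \<in> L'"
    and \<beta>: "\<forall>x\<in>L. S \<beta> x = 0" "S \<beta> \<beta> = 1"
    and i: "i < p" "\<bar>S (E i) \<beta>\<bar> = 2"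
    and E\<beta>: "\<forall>j<p. j \<noteq> i \<longrightarrow> S (E j) \<beta> = 0" and F\<beta>: "\<forall>j<q. S (F j) \<beta> = 0"
  shows "\<exists>E. cycle_pair (Suc p) q E F L'"
proof -
  obtain n where p: "p = Suc n" using i(1) by (cases p) auto
  let ?E = "\<lambda>j. if Suc (i + j) < p then E (Suc (i + j)) else - E (Suc (i + j) - p)"
  have EF': "cycle_pair (Suc n) q ?E F L" using cycle_pair_rotate[OF EF L(1) i(1)] by (simp add: p)
  define \<gamma> where "\<gamma> = (if S (E i) \<beta> = 2 then \<beta> else - \<beta>)"
  have "\<exists>E. cycle_pair (Suc (Suc n)) q E F L'"
  proof (rule cycle_pair_extend_last[OF EF' L(2,3)])
    show "\<gamma> \<in> L'" using L(2,4) by (simp add: \<gamma>_def zmod.subspace_neg)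
    show "\<forall>x\<in>L. S \<gamma> x = 0" "S \<gamma> \<gamma> = 1" using \<beta> by (auto simp: \<gamma>_def bilin)
    show "S (?E n) \<gamma> = - 2" using i by (auto simp: \<gamma>_def bilin p)
    show "\<forall>j<n. S (?E j) \<gamma> = 0" using E\<beta> i(1) by (auto simp: \<gamma>_def bilin p)
    show "\<forall>j<q. S (F j) \<gamma> = 0" using F\<beta> by (auto simp: \<gamma>_def bilin)
  qed
  then show ?thesis by (simp add: p)
qed

lemma frame_norm:
  assumes "\<forall>i<n. \<forall>j<n. S (G i) (G j) + S (G j) (G i) = (if i = j then 4 else 0)"
    and "\<forall>i<n. (c i)\<^sup>2 = 1"
  shows "S (\<Sum>i<n. zscale (c i) (G i)) (\<Sum>i<n. zscale (c i) (G i)) = 2 * int n"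
  using assms
proof (induction n)
  case 0
  then show ?case by (simp add: bilin)
next
  case (Suc n)
  let ?z = "\<Sum>i<n. zscale (c i) (G i)"
  have "S ?z (G n) + S (G n) ?z = (\<Sum>i<n. c i * (S (G i) (G n) + S (G n) (G i)))"
    by (simp add: sum_left sum_right zscale_left zscale_right sum.distrib distrib_left)
  also have "\<dots> = 0" using Suc.prems by (intro sum.neutral) auto
  finally have cross: "S ?z (G n) + S (G n) ?z = 0" .
  have norm: "S (G n) (G n) = 2" using Suc.prems(1)[rule_format, of n n] by simp
  moreover have "c n * c n = 1" using Suc.prems(2) by (simp add: power2_eq_square)
  ultimately show ?case using Suc unfolding sum.lessThan_Suc S_add_zscale cross by simp
qed

text \<open>\<open>x i\<close> pairs \<open>\<beta>\<close> with twice the \<open>i\<close>-th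
  coordinate vector. The roots \<open>e_i + e_j\<close> and \<open>e_i - e_j\<close> bound these
  numbers in pairs and give them equal parity. Either all are odd, a spin weight, or a single one is
  nonzero and equals 2 or -2, a vector weight; the latter lengthens one of the cycles.\<close>

lemma cycle_pair_extend:
  assumes EF: "cycle_pair p q E F L" and L: "zmod.subspace L" "zmod.subspace L'" "L \<subseteq> L'" "\<beta> \<in> L'"
    and \<beta>: "\<forall>x\<in>L. S \<beta> x = 0" "S \<beta> \<beta> = 1"
    and nz: "(\<exists>i<p. S (E i) \<beta> \<noteq> 0) \<or> (\<exists>i<q. S (F i) \<beta> \<noteq> 0)"
    and pq: "0 < p" "0 < q" "8 \<le> p + q"
  shows "classical (Suc (p + q)) L'"
proof -
  define G where "G i = (if i < p then E i else F (i - p))" for i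
  have \<Gamma>: "halvable (G ` {..<p + q}) L"
    using EF by (auto simp: cycle_pair_def G_def elim!: halvable_mono)
  have SG: "S (G i) (G j) + S (G j) (G i) = (if i = j then 4 else 0)" if "i < p + q" "j < p + q" for i j
    using EF that by (auto simp: cycle_pair_def G_def)
  have norm: "S (G i) (G i) = 2" if "i < p + q" for i using SG[OF that that] by simp
  define x where "x i = S (G i) \<beta>" for i
  have pair: "\<bar>x i\<bar> + \<bar>x j\<bar> \<le> 2 \<and> even (x i + x j)" if "i < p + q" "j < p + q" "i \<noteq> j" for i j
  proof -
    obtain u where u: "u \<in> L" "u + u = G i + G j"
      using halvableD[OF \<Gamma> imageI imageI, of i j] \<open>i < p + q\<close> \<open>j < p + q\<close> by auto
    have "4 * S u u = 4"
      using S_halves[of u u] SG[OF that(1,2)] that norm by (simp add: u(2) bilin)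
    then have 1: "S u u = 1" by simp
    have Gj: "G j \<in> L" using halvable_in[OF \<Gamma>] that by simp
    have d: "(u - G j) + (u - G j) = G i - G j" using u(2) by (simp add: algebra_simps)
    have "4 * S (u - G j) (u - G j) = 4"
      using S_halves[of "u - G j" "u - G j"] SG[OF that(1,2)] that norm by (simp add: d bilin)
    then have 2: "S (u - G j) (u - G j) = 1" by simp
    have "\<bar>S u \<beta>\<bar> \<le> 1" using S_bound[of \<beta> u 1] \<beta> u(1) 1 by simp
    moreover have "\<bar>S (u - G j) \<beta>\<bar> \<le> 1"
      using S_bound[of \<beta> "u - G j" 1] \<beta> u(1) 2 Gj by (simp add: bilin)
    moreover have eq: "x i + x j = 2 * S u \<beta>"
      using arg_cong[OF u(2), of "\<lambda>z. S z \<beta>"] by (simp add: x_def bilin)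
    moreover have "S (u - G j) \<beta> = S u \<beta> - x j" by (simp add: x_def bilin)
    ultimately have "\<bar>x i\<bar> + \<bar>x j\<bar> \<le> 2" by linarith
    then show ?thesis by (simp add: eq)
  qed
  \<comment> \<open>Eight odd coordinates produce \<open>w\<close> with \<open>S w w = 4\<close> and
    \<open>S w \<beta> = 4\<close>, against \<open>S_bound\<close> with \<open>t = 2\<close>. In
    diagrams: a node attached to a spin end of D8 gives affine E8.\<close>
  have not_spin: "\<exists>i<p + q. even (x i)"
  proof (rule ccontr)
    assume odd: "\<not> ?thesis"
    have sgn: "x i * x i = 1" if "i < 8" for i
    proof -
      define j where "j = (if i = 0 then 1 else 0 :: nat)"
      have "i < p + q" "j < p + q" "i \<noteq> j" using that pq(3) by (auto simp: j_def)
      moreover have "odd (x i)" "odd (x j)" using odd calculation by auto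
      ultimately have "x i = 1 \<or> x i = - 1" using pair[of i j] by auto presburger
      then show ?thesis by auto
    qed
    have half: "\<exists>u\<in>L. u + u = zscale (x i) (G i) + zscale (x j) (G j)" if "i < 8" "j < 8" for i j
    proof -
      have mem: "zscale (x i) (G i) \<in> G ` {..<p + q} \<union> uminus ` (G ` {..<p + q})" if "i < 8" for i
      proof -
        have "x i = 1 \<or> x i = - 1" using sgn[OF that] by (metis zmult_eq_1_iff)
        then show ?thesis using that pq(3) by auto
      qed
      show ?thesis
        by (rule halvableD[OF halvable_signs[OF \<Gamma> L(1)] mem[OF that(1)] mem[OF that(2)]])
    qed
    obtain u0 u1 u2 u3 where u: "u0 \<in> L" "u1 \<in> L" "u2 \<in> L" "u3 \<in> L"
      "u0 + u0 = zscale (x 0) (G 0) + zscale (x 1) (G 1)"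
      "u1 + u1 = zscale (x 2) (G 2) + zscale (x 3) (G 3)"
      "u2 + u2 = zscale (x 4) (G 4) + zscale (x 5) (G 5)"
      "u3 + u3 = zscale (x 6) (G 6) + zscale (x 7) (G 7)"
      using half[of 0 1] half[of 2 3] half[of 4 5] half[of 6 7] by auto
    define w where "w = u0 + u1 + u2 + u3"
    have "w + w = (u0 + u0) + (u1 + u1) + (u2 + u2) + (u3 + u3)" by (simp add: w_def algebra_simps)
    also have "\<dots> = (\<Sum>i<8. zscale (x i) (G i))"
      unfolding u(5-8) by (simp add: eval_nat_numeral add.assoc)
    finally have w: "w + w = (\<Sum>i<8. zscale (x i) (G i))" .
    have "S (w + w) (w + w) = 16"
      unfolding w using SG sgn pq(3) by (subst frame_norm) (auto simp: power2_eq_square)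
    then have "S w w = 4" using S_halves[of w w] by simp
    moreover have "w \<in> L" using u(1-4) L(1) by (auto simp: w_def intro!: zmod.subspace_add)
    ultimately have "\<bar>S w \<beta>\<bar> < 4" using S_bound[of \<beta> w 2] \<beta> by simp
    moreover have "S (w + w) \<beta> = 8"
      unfolding w sum_left zscale_left using sgn by (simp flip: x_def)
    ultimately show False by (simp add: bilin)
  qed
  obtain i where i: "i < p + q" "x i \<noteq> 0"
  proof -
    have "\<exists>i<p + q. x i \<noteq> 0"
      using nz
    proof
      assume "\<exists>i<p. S (E i) \<beta> \<noteq> 0"
      then show ?thesis by (force simp: x_def G_def)
    next
      assume "\<exists>i<q. S (F i) \<beta> \<noteq> 0"
      then obtain i where "i < q" "S (F i) \<beta> \<noteq> 0" by blast
      then show ?thesis by (intro exI[of _ "p + i"]) (simp add: x_def G_def)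
    qed
    then show ?thesis using that by blast
  qed
  have even: "even (x j)" if "j < p + q" for j
    using not_spin pair[of j] that by (metis even_add)
  have "\<exists>j<p + q. j \<noteq> i" using pq by (intro exI[of _ "if i = 0 then 1 else 0"]) auto
  then have "\<bar>x i\<bar> \<le> 2" using pair[of i] i(1) by fastforce
  then have x2: "\<bar>x i\<bar> = 2" using even[OF i(1)] i(2) by (auto elim!: evenE)
  then have x0: "x j = 0" if "j < p + q" "j \<noteq> i" for j using pair[of i j] i(1) that by auto
  show ?thesis
  proof (cases "i < p")
    case True
    have "S (E j) \<beta> = 0" if "j < p" "j \<noteq> i" for j
      using x0[of j] that by (simp add: x_def G_def)
    moreover have "S (F j) \<beta> = 0" if "j < q" for j
      using x0[of "p + j"] that True by (simp add: x_def G_def)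
    ultimately have "\<exists>E. cycle_pair (Suc p) q E F L'"
      using x2 True by (intro cycle_pair_extend_vector[OF EF L \<beta>, of i]) (auto simp: x_def G_def)
    then show ?thesis using pq unfolding classical_def by (metis add_Suc zero_less_Suc)
  next
    case False
    have "S (E j) \<beta> = 0" if "j < p" for j
      using x0[of j] that False by (simp add: x_def G_def)
    moreover have "S (F j) \<beta> = 0" if "j < q" "j \<noteq> i - p" for j
      using x0[of "p + j"] that False by (simp add: x_def G_def)
    ultimately have "\<exists>F. cycle_pair (Suc q) p F E L'"
      using x2 False i(1)
      by (intro cycle_pair_extend_vector[OF cycle_pair_swap[OF EF] L \<beta>, of "i - p"]) (auto simp: x_def G_def)
    then show ?thesis using pq unfolding classical_def by (metis add.commute add_Suc zero_less_Suc)
  qed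
qed

end

section \<open>Normal forms in rank at most eight\<close>

definition A_matrix :: "nat \<Rightarrow> int list list" where
  "A_matrix k = map (\<lambda>i. map (\<lambda>j. if i = j then 1 else if j = Suc i then - 1 else 0) [0..<k]) [0..<k]"

text \<open>A chain of rank \<open>k - 1\<close> extended by an edge between the vertices
  \<open>v\<close> and \<open>k - 1\<close>. The cycle lengths are \<open>v + 1\<close> and
  \<open>k - 1 - v\<close>, so the range \<open>v < k div 2\<close> in \<open>forms\<close> meets
  each splitting once.\<close>

definition D_matrix :: "nat \<Rightarrow> nat \<Rightarrow> int list list" where
  "D_matrix k v = extend_matrix (A_matrix (k - 1))
     (map (\<lambda>i. (if i \<in> {v, k - 1} then 1 else 0) - (if Suc i \<in> {v, k - 1} then 1 else 0)) [0..<k - 1])"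

definition block_matrix :: "int list list \<Rightarrow> int list list" where
  "block_matrix B =
     map2 (\<lambda>i r. map (\<lambda>j. if i = j then 1 else 0) [0..<length B] @ r) [0..<length B] B @
     map (\<lambda>i. replicate (length B) 0 @ map (\<lambda>j. if i = j then 1 else 0) [0..<length (hd B)]) [0..<length (hd B)]"

text \<open>The forms of type E are stored in the bipartite shape that is wanted in the end, so they
  need no further change of basis.\<close>

definition E6_matrices :: "int list list list" where
  "E6_matrices =
    map block_matrix
     [[[0,0,1], [0,1,1], [-1,0,1]],
      [[0,0,-1], [-1,1,1], [1,0,1]],
      [[-1,1,1], [1,1,0], [0,-1,1]]]"

definition E7_matrices :: "int list list list" where
  "E7_matrices =
    map block_matrix
     [[[1,0,0,0], [0,1,1,0], [-1,0,1,1]],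
      [[0,0,-1,1], [0,1,1,0], [-1,0,1,1]],
      [[0,0,-1,0], [-1,1,1,0], [1,0,1,1]],
      [[-1,1,0,0], [1,1,0,1], [0,-1,1,1]],
      [[-1,-1,0,1], [1,-1,1,0], [0,1,1,1]]]"

definition E8_matrices :: "int list list list" where
  "E8_matrices =
    map block_matrix
     [[[0,0,0,1], [0,1,1,0], [0,0,1,1], [-1,0,0,1]],
      [[0,0,0,-1], [0,1,1,0], [-1,0,1,1], [1,0,0,1]],
      [[0,0,-1,0], [0,1,0,0], [-1,1,1,0], [1,0,1,1]],
      [[-1,1,0,1], [1,1,0,0], [0,0,1,1], [0,-1,0,1]],
      [[1,-1,0,1], [0,1,1,0], [0,0,1,1], [-1,0,0,1]],
      [[1,0,0,1], [1,0,0,0], [-1,0,1,0], [0,-1,1,1]],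
      [[-1,1,0,1], [1,1,0,0], [0,-1,-1,1], [0,0,1,1]],
      [[1,0,-1,1], [1,0,0,0], [1,-1,1,0], [0,1,1,1]],
      [[-1,-1,1,0], [-1,1,0,1], [0,1,1,-1], [1,0,1,1]]]"

text \<open>D begins in rank 4 because D3 is A3. The lists are chosen so that extending a form of
  rank \<open>k\<close> with \<open>k \<le> 7\<close> leads into the list of rank
  \<open>k + 1\<close>.\<close>

definition forms :: "nat \<Rightarrow> int list list list" where
  "forms k = A_matrix k # (if k < 4 then [] else map (D_matrix k) [0..<k div 2]) @
     (if k = 6 then E6_matrices else if k = 7 then E7_matrices else if k = 8 then E8_matrices else [])"

definition extensible :: "int list list \<Rightarrow> int list list list \<Rightarrow> bool" where
  "extensible M Ns \<longleftrightarrow> (\<exists>Zs g tab n. extension_check M Ns Zs g tab n)"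

lemma extensibleI: "extension_check M Ns Zs g tab n \<Longrightarrow> extensible M Ns"
  unfolding extensible_def by blast

text \<open>The tables were found by computer search.\<close>

lemma extensible_A1: "extensible (A_matrix 1) (forms 2)"
  by (rule extensibleI[where n = 1
      and g = "[[-1]]"
      and Zs = "[[]]"
      and tab = "[([-1], [[1,0], [0,1]])]"])
    code_simp

text \<open>In this and the following certificates \<open>g\<close> is the Coxeter transformation of
  the form, which is an isometry of \<open>S\<close>, and \<open>n\<close> is its order, or half of
  it if the half power is -1. Bounds with \<open>t = 1\<close> come from vectors of norm one. A
  missing bound could only make the check fail.\<close>

lemma extensible_A2: "extensible (A_matrix 2) (forms 3)"
  by (rule extensibleI[where n = 3
      and g = "[[0,1], [-1,-1]]"
      and Zs = "[[(1,[1,1])], []]"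
      and tab = "[([-1,0], [[0,1,0], [-1,-1,0], [0,0,-1]])]"])
    code_simp

lemma extensible_A3: "extensible (A_matrix 3) (forms 4)"
  by (rule extensibleI[where n = 4
      and g = "[[0,1,0], [0,0,1], [-1,-1,-1]]"
      and Zs = "[[(1,[0,1,1]), (1,[1,1,1])], [(1,[1,1])], []]"
      and tab = "[([-1,0,0], [[0,1,0,0], [0,0,1,0], [-1,-1,-1,0], [0,0,0,-1]]), ([0,-1,0], [[1,0,0,0],
        [0,1,1,0], [0,0,0,1], [0,-1,0,-1]]), ([-1,1,-1], [[1,0,0,0], [0,1,0,0], [0,0,1,0],
        [0,0,0,1]])]"])
    code_simp

lemma extensible_A4: "extensible (A_matrix 4) (forms 5)"
  by (rule extensibleI[where n = 5
      and g = "[[0,1,0,0], [0,0,1,0], [0,0,0,1], [-1,-1,-1,-1]]"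
      and Zs = "[[(1,[0,0,1,1]), (1,[0,1,1,1]), (1,[1,1,1,1])], [(1,[0,1,1]), (1,[1,1,1])], [(1,[1,1])],
        []]"
      and tab = "[([-1,0,0,0], [[0,1,0,0,0], [0,0,1,0,0], [0,0,0,1,0], [-1,-1,-1,-1,0], [0,0,0,0,-1]]),
        ([0,-1,0,0], [[1,0,0,0,0], [0,1,0,0,1], [0,0,1,0,0], [0,0,0,1,0], [0,-1,-1,-1,0]]),
        ([-1,0,1,-1], [[0,0,0,1,1], [0,0,0,-1,0], [-1,0,0,0,-1], [0,-1,0,0,0], [0,0,-1,-1,0]])]"])
    code_simp

lemma extensible_D4_0: "extensible (D_matrix 4 0) (forms 5)"
  by (rule extensibleI[where n = 3
      and g = "[[0,0,-1,-1], [0,0,1,0], [-1,0,0,1], [0,-1,-1,-1]]"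
      and Zs = "[[(1,[1,0,-1,-1]), (1,[0,0,1,1]), (1,[0,1,1,1]), (1,[1,0,0,-1]), (1,[1,1,0,-1])],
        [(1,[0,1,1]), (1,[1,1,1])], [(1,[1,1])], []]"
      and tab = "[([-1,0,0,0], [[0,1,0,0,0], [0,0,1,1,0], [-1,-1,-1,0,0], [0,0,0,0,-1], [1,1,0,0,1]]),
        ([0,-1,0,0], [[1,0,0,0,0], [0,0,0,-1,0], [0,1,1,1,0], [0,0,0,0,1], [0,-1,0,0,-1]]),
        ([-1,0,0,-1], [[0,0,0,0,1], [0,0,0,-1,-1], [-1,0,0,1,0], [0,-1,0,0,0], [0,0,-1,-1,-1]]),
        ([-1,1,0,0], [[1,0,0,0,0], [0,0,0,0,1], [0,1,0,0,-1], [0,0,1,0,0], [0,0,0,1,0]]),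
        ([-1,1,-1,0], [[0,0,0,0,1], [0,1,0,0,-1], [-1,-1,0,0,0], [0,0,0,1,0], [0,0,-1,-1,-1]]),
        ([0,-1,1,-1], [[0,0,0,0,1], [0,0,1,0,-1], [-1,-1,-1,0,0], [1,0,0,0,0], [0,0,0,-1,-1]])]"])
    code_simp

lemma extensible_D4_1: "extensible (D_matrix 4 1) (forms 5)"
  by (rule extensibleI[where n = 2
      and g = "[[1,1,1,1], [-1,0,0,-1], [0,-1,0,1], [-1,0,-1,-1]]"
      and Zs = "[[(1,[1,0,1,1]), (1,[0,0,1,1]), (1,[0,1,0,-1]), (1,[1,0,0,1]), (1,[1,1,1,1])],
        [(1,[0,1,1]), (1,[1,1,1])], [(1,[1,1])], []]"
      and tab = "[([-1,0,0,0], [[0,0,1,0,0], [0,0,0,1,0], [-1,-1,-1,-1,0], [0,0,0,0,-1], [1,0,0,1,1]]),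
        ([0,-1,0,0], [[0,0,0,1,0], [0,1,0,-1,0], [0,0,0,0,1], [-1,-1,0,0,-1], [0,0,-1,-1,0]]),
        ([0,0,-1,0], [[0,1,0,0,0], [0,0,1,0,0], [0,0,0,0,1], [-1,-1,-1,0,-1], [0,0,0,-1,0]]),
        ([0,0,0,-1], [[1,1,0,0,0], [0,0,1,0,0], [0,0,0,1,0], [0,0,0,0,1], [-1,0,0,-1,-1]]),
        ([-1,1,0,0], [[0,0,1,1,0], [0,0,-1,0,0], [-1,0,0,-1,0], [0,0,0,0,-1], [0,-1,-1,0,1]]),
        ([0,-1,1,0], [[1,0,0,0,0], [0,1,0,0,0], [0,0,0,0,1], [0,0,1,0,-1], [0,0,0,1,0]])]"])
    code_simp

lemma extensible_A5: "extensible (A_matrix 5) (forms 6)"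
  by (rule extensibleI[where n = 6
      and g = "[[0,1,0,0,0], [0,0,1,0,0], [0,0,0,1,0], [0,0,0,0,1], [-1,-1,-1,-1,-1]]"
      and Zs = "[[(1,[0,0,0,1,1]), (1,[0,0,1,1,1]), (1,[0,1,1,1,1]), (1,[1,1,1,1,1])], [(1,[0,0,1,1]),
        (1,[0,1,1,1]), (1,[1,1,1,1])], [(1,[0,1,1]), (1,[1,1,1])], [(1,[1,1])], []]"
      and tab = "[([-1,0,0,0,0], [[0,1,0,0,0,0], [0,0,1,0,0,0], [0,0,0,1,0,0], [0,0,0,0,1,0],
        [-1,-1,-1,-1,-1,0], [0,0,0,0,0,-1]]), ([0,-1,0,0,0], [[1,0,0,0,0,0], [0,1,0,0,0,1],
        [0,0,1,0,0,0], [0,0,0,1,0,0], [0,0,0,0,1,0], [0,-1,-1,-1,-1,0]]), ([0,0,-1,0,0],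
        [[0,0,0,0,0,1], [0,0,0,1,1,0], [-1,-1,0,0,0,0], [1,0,0,0,0,0], [0,0,0,1,0,0],
        [0,0,1,1,1,1]]), ([-1,0,0,1,-1], [[0,0,0,0,1,1], [0,0,0,0,-1,0], [-1,0,0,0,0,-1],
        [0,-1,0,0,0,0], [0,0,-1,0,0,0], [0,0,0,-1,-1,0]]), ([-1,0,1,-1,0], [[0,1,0,0,0,0],
        [0,0,1,0,0,0], [0,0,0,1,0,0], [0,0,0,0,1,0], [-1,-1,-1,-1,-1,0], [0,0,0,0,0,-1]]),
        ([-1,0,1,0,-1], [[0,1,0,0,0,0], [0,0,0,1,1,0], [-1,-1,-1,-1,-1,-1], [-1,-1,-1,-1,-1,0],
        [0,0,0,1,0,0], [-1,-1,0,0,0,-1]]), ([-1,1,-1,1,-1], [[0,0,0,0,0,1], [0,1,1,0,0,0],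
        [-1,-1,-1,-1,0,0], [0,1,0,0,0,-1], [1,1,1,0,0,1], [0,0,0,0,1,1]])]"])
    code_simp

lemma extensible_D5_0: "extensible (D_matrix 5 0) (forms 6)"
  by (rule extensibleI[where n = 8
      and g = "[[0,0,-1,-1,-1], [0,0,1,0,0], [0,0,0,1,0], [-1,0,0,0,1], [0,-1,-1,-1,-1]]"
      and Zs = "[[(1,[1,0,-1,-1,-1]), (1,[0,0,0,1,1]), (1,[1,1,1,0,-1]), (1,[0,0,1,1,1]), (1,[0,1,1,1,1]),
        (1,[1,0,0,-1,-1]), (1,[1,0,0,0,-1]), (1,[1,1,0,-1,-1]), (1,[1,1,0,0,-1])], [(1,[0,0,1,1]),
        (1,[0,1,1,1]), (1,[1,1,1,1])], [(1,[0,1,1]), (1,[1,1,1])], [(1,[1,1])], []]"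
      and tab = "[([-1,0,0,0,0], [[0,0,0,0,1,0], [0,-1,-1,0,0,0], [-1,-1,-1,-1,0,-1], [1,1,1,1,0,0],
        [0,-1,0,0,0,0], [-1,-1,-1,0,1,-1]]), ([-1,0,0,0,-1], [[0,0,0,0,0,1], [0,0,0,0,-1,-1],
        [-1,0,0,0,1,0], [0,-1,0,0,0,0], [0,0,-1,0,0,0], [0,0,0,-1,-1,-1]]), ([-1,1,0,0,0],
        [[1,0,0,0,0,0], [0,0,0,0,0,1], [0,1,0,0,0,-1], [0,0,1,0,0,0], [0,0,0,1,0,0],
        [0,0,0,0,1,0]]), ([-1,0,1,-1,0], [[0,1,0,0,0,0], [-1,-1,-1,0,1,0], [0,0,0,0,0,-1],
        [0,0,0,-1,-1,-1], [-1,-1,-1,0,0,0], [-1,-1,0,0,1,-1]])]"])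
    code_simp

lemma extensible_D5_1: "extensible (D_matrix 5 1) (forms 6)"
  by (rule extensibleI[where n = 12
      and g = "[[1,1,1,1,1], [-1,0,0,-1,-1], [0,0,0,1,0], [0,-1,0,0,1], [-1,0,-1,-1,-1]]"
      and Zs = "[[(1,[0,1,0,-1,-1]), (1,[1,0,0,0,1]), (1,[1,1,1,1,1]), (1,[0,0,0,1,1]), (1,[0,0,1,1,1]),
        (1,[0,1,0,0,-1]), (1,[0,1,1,0,-1]), (1,[1,0,0,1,1]), (1,[1,0,1,1,1])], [(1,[0,0,1,1]),
        (1,[0,1,1,1]), (1,[1,1,1,1])], [(1,[0,1,1]), (1,[1,1,1])], [(1,[1,1])], []]"
      and tab = "[([-1,0,0,0,0], [[0,0,1,0,0,0], [0,0,0,1,0,0], [0,0,0,0,1,0], [-1,-1,-1,-1,-1,0],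
        [0,0,0,0,0,-1], [1,0,0,0,1,1]]), ([0,-1,0,0,0], [[0,0,1,0,0,0], [0,-1,-1,-1,0,-1],
        [0,0,0,0,1,0], [1,1,1,1,1,1], [0,-1,-1,-1,0,0], [0,-1,-1,0,1,-1]]), ([0,-1,1,0,0],
        [[1,0,0,0,0,0], [0,1,0,0,0,0], [0,0,0,0,0,1], [0,0,1,0,0,-1], [0,0,0,1,0,0],
        [0,0,0,0,1,0]]), ([0,-1,1,-1,0], [[1,1,0,0,0,0], [0,0,0,0,-1,0], [0,0,-1,0,0,1],
        [-1,0,0,0,-1,0], [0,0,0,-1,-1,-1], [0,0,-1,0,0,0]])]"])
    code_simp

lemma extensible_A6: "extensible (A_matrix 6) (forms 7)"
  by (rule extensibleI[where n = 7
      and g = "[[0,1,0,0,0,0], [0,0,1,0,0,0], [0,0,0,1,0,0], [0,0,0,0,1,0], [0,0,0,0,0,1],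
        [-1,-1,-1,-1,-1,-1]]"
      and Zs = "[[(1,[0,0,0,0,1,1]), (1,[0,0,0,1,1,1]), (1,[0,0,1,1,1,1]), (1,[0,1,1,1,1,1]),
        (1,[1,1,1,1,1,1])], [(1,[0,0,0,1,1]), (1,[0,0,1,1,1]), (1,[0,1,1,1,1]), (1,[1,1,1,1,1])],
        [(1,[0,0,1,1]), (1,[0,1,1,1]), (1,[1,1,1,1])], [(1,[0,1,1]), (1,[1,1,1])], [(1,[1,1])],
        []]"
      and tab = "[([-1,0,0,0,0,0], [[0,1,0,0,0,0,0], [0,0,1,0,0,0,0], [0,0,0,1,0,0,0], [0,0,0,0,1,0,0],
        [0,0,0,0,0,1,0], [-1,-1,-1,-1,-1,-1,0], [0,0,0,0,0,0,-1]]), ([0,-1,0,0,0,0],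
        [[1,0,0,0,0,0,0], [0,1,0,0,0,0,1], [0,0,1,0,0,0,0], [0,0,0,1,0,0,0], [0,0,0,0,1,0,0],
        [0,0,0,0,0,1,0], [0,-1,-1,-1,-1,-1,0]]), ([0,0,-1,0,0,0], [[1,0,0,0,0,0,0],
        [0,0,0,1,1,0,0], [0,0,1,1,1,1,1], [0,-1,-1,-1,-1,-1,-1], [0,0,0,1,0,0,0], [0,0,1,1,1,0,1],
        [0,0,1,1,1,1,0]]), ([-1,0,0,0,1,-1], [[0,0,0,0,0,1,1], [0,0,0,0,0,-1,0],
        [-1,0,0,0,0,0,-1], [0,-1,0,0,0,0,0], [0,0,-1,0,0,0,0], [0,0,0,-1,0,0,0],
        [0,0,0,0,-1,-1,0]]), ([-1,0,0,1,-1,0], [[0,0,0,0,0,1,0], [-1,-1,-1,-1,-1,-1,0],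
        [1,0,0,0,0,0,0], [0,1,0,0,0,0,0], [0,0,1,0,0,0,0], [0,0,0,1,0,0,0], [0,0,0,0,0,0,-1]]),
        ([-1,0,0,1,0,-1], [[1,0,0,0,0,0,0], [0,0,1,1,0,0,0], [0,1,1,1,0,-1,-1], [0,0,0,0,0,1,0],
        [0,0,1,0,0,0,0], [0,1,1,1,0,0,0], [0,0,0,0,-1,-1,-1]]), ([-1,0,1,0,-1,0],
        [[0,0,0,1,0,0,0], [1,1,0,0,0,0,1], [-1,-1,-1,-1,-1,0,0], [-1,-1,0,0,0,0,0],
        [1,0,0,0,0,0,1], [0,0,-1,-1,0,0,1], [0,0,0,0,0,1,0]]), ([-1,0,1,0,0,-1], [[0,0,0,0,0,1,1],
        [0,0,1,1,0,0,-1], [-1,0,1,1,1,0,-1], [0,0,-1,-1,-1,0,0], [0,0,1,0,0,0,-1],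
        [-1,0,1,1,0,-1,-2], [0,1,1,1,1,1,0]]), ([-1,0,1,-1,1,-1], [[0,0,0,0,0,1,0],
        [1,1,1,1,0,0,0], [0,1,1,0,0,0,0], [0,0,0,0,-1,-1,0], [0,0,0,0,0,0,-1], [0,1,0,0,0,0,0],
        [1,1,1,0,0,0,0]])]"])
    code_simp

lemma extensible_D6_0: "extensible (D_matrix 6 0) (forms 7)"
  by (rule extensibleI[where n = 5
      and g = "[[0,0,-1,-1,-1,-1], [0,0,1,0,0,0], [0,0,0,1,0,0], [0,0,0,0,1,0], [-1,0,0,0,0,1],
        [0,-1,-1,-1,-1,-1]]"
      and Zs = "[[(1,[1,0,-1,-1,-1,-1]), (1,[1,1,1,0,-1,-1]), (1,[0,0,0,0,1,1]), (1,[0,0,0,1,1,1]),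
        (1,[1,0,0,0,0,-1]), (1,[1,1,0,0,0,-1]), (1,[0,0,1,1,1,1]), (1,[0,1,1,1,1,1]),
        (1,[1,0,0,-1,-1,-1]), (1,[1,0,0,0,-1,-1]), (1,[1,1,0,-1,-1,-1]), (1,[1,1,0,0,-1,-1]),
        (1,[1,1,1,0,0,-1]), (1,[1,1,1,1,0,-1])], [(1,[0,0,0,1,1]), (1,[0,0,1,1,1]),
        (1,[0,1,1,1,1]), (1,[1,1,1,1,1])], [(1,[0,0,1,1]), (1,[0,1,1,1]), (1,[1,1,1,1])],
        [(1,[0,1,1]), (1,[1,1,1])], [(1,[1,1])], []]"
      and tab = "[([-1,0,0,0,0,0], [[0,0,0,0,0,0,1], [0,0,-1,-1,0,0,0], [0,-1,-1,-1,-1,0,0],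
        [1,1,1,1,1,0,1], [0,0,-1,0,0,0,0], [0,-1,-1,-1,0,0,0], [0,0,0,0,0,1,0]]), ([0,-1,0,0,0,0],
        [[0,0,0,0,0,1,0], [0,1,1,0,0,0,1], [1,2,2,2,1,0,1], [-1,-1,-1,-1,0,1,-1], [0,1,0,0,0,0,1],
        [1,2,2,1,1,0,1], [0,1,1,1,0,0,0]]), ([-1,0,0,0,0,-1], [[0,0,0,0,0,0,1], [0,0,0,0,0,-1,-1],
        [-1,0,0,0,0,1,0], [0,-1,0,0,0,0,0], [0,0,-1,0,0,0,0], [0,0,0,-1,0,0,0],
        [0,0,0,0,-1,-1,-1]]), ([-1,1,0,0,0,0], [[1,0,0,0,0,0,0], [0,0,0,0,0,0,1],
        [0,1,0,0,0,0,-1], [0,0,1,0,0,0,0], [0,0,0,1,0,0,0], [0,0,0,0,1,0,0], [0,0,0,0,0,1,0]]),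
        ([-1,0,0,1,-1,0], [[0,0,0,0,0,0,1], [0,-1,-1,0,0,0,0], [-1,-1,-1,-1,0,1,0],
        [1,1,1,1,0,0,0], [0,-1,0,0,0,0,0], [-1,-1,-1,0,0,1,-1], [0,0,0,0,1,1,1]]),
        ([-1,0,1,-1,0,0], [[0,0,0,0,0,1,0], [0,1,1,0,0,0,0], [1,1,1,2,1,0,1], [0,0,0,1,0,0,0],
        [0,1,0,0,0,0,0], [1,1,1,1,0,-1,1], [1,1,1,1,1,0,0]]), ([-1,0,1,0,-1,0], [[1,0,0,0,0,0,1],
        [0,0,1,1,0,0,-1], [-1,0,1,1,1,1,0], [0,0,0,0,1,0,1], [0,0,1,0,0,0,-1], [-1,0,1,1,0,0,-1],
        [0,1,1,1,1,1,0]]), ([0,-1,0,0,1,-1], [[0,0,0,0,0,0,1], [0,0,-1,-1,0,0,0],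
        [0,-1,-1,-1,-1,0,0], [1,1,1,1,1,0,0], [0,0,-1,0,0,0,0], [0,-1,-1,-1,0,0,-1],
        [0,0,0,0,0,1,1]]), ([-1,1,-1,1,-1,0], [[0,1,1,0,0,0,0], [0,0,0,0,0,0,1],
        [-1,-1,-1,-1,0,1,0], [0,-1,0,0,0,0,1], [1,1,1,0,0,-1,1], [-1,-1,-1,-1,0,0,0],
        [0,0,0,0,1,1,1]]), ([0,-1,1,-1,1,-1], [[0,1,1,0,0,0,0], [0,0,0,0,0,0,-1],
        [-1,-1,-1,-1,0,1,0], [0,-1,0,0,0,0,-1], [1,1,1,0,0,-1,-1], [0,0,0,0,1,1,0],
        [-1,-1,-1,-1,0,0,-1]])]"])
    code_simp

lemma extensible_D6_1: "extensible (D_matrix 6 1) (forms 7)"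
  by (rule extensibleI[where n = 8
      and g = "[[1,1,1,1,1,1], [-1,0,0,-1,-1,-1], [0,0,0,1,0,0], [0,0,0,0,1,0], [0,-1,0,0,0,1],
        [-1,0,-1,-1,-1,-1]]"
      and Zs = "[[(1,[0,1,0,-1,-1,-1]), (1,[1,0,0,0,1,1]), (1,[0,0,0,0,1,1]), (1,[0,1,0,0,0,-1]),
        (1,[0,1,1,0,0,-1]), (1,[1,1,1,1,1,1]), (1,[0,0,0,1,1,1]), (1,[0,0,1,1,1,1]),
        (1,[0,1,0,0,-1,-1]), (1,[0,1,1,0,-1,-1]), (1,[0,1,1,1,0,-1]), (1,[1,0,0,0,0,1]),
        (1,[1,0,0,1,1,1]), (1,[1,0,1,1,1,1])], [(1,[0,0,0,1,1]), (1,[0,0,1,1,1]), (1,[0,1,1,1,1]),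
        (1,[1,1,1,1,1])], [(1,[0,0,1,1]), (1,[0,1,1,1]), (1,[1,1,1,1])], [(1,[0,1,1]),
        (1,[1,1,1])], [(1,[1,1])], []]"
      and tab = "[([-1,0,0,0,0,0], [[0,0,0,0,0,0,1], [-1,0,0,0,0,0,-1], [0,0,0,0,0,-1,0], [0,-1,0,0,0,1,0],
        [0,0,-1,0,0,0,0], [0,0,0,-1,0,0,0], [0,0,0,0,-1,-1,0]]), ([0,-1,0,0,0,0],
        [[0,0,0,0,0,1,0], [0,0,1,1,0,0,0], [0,1,1,1,1,0,1], [0,-1,-1,-1,-1,0,0], [0,0,1,0,0,0,0],
        [0,1,1,1,0,-1,1], [1,1,1,1,1,1,1]]), ([0,0,-1,0,0,0], [[0,1,0,0,0,0,0], [0,0,0,1,1,0,0],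
        [0,0,1,1,1,1,1], [0,0,-1,-1,-1,-1,0], [0,0,0,1,0,0,0], [0,0,1,1,1,0,1], [1,1,1,1,1,1,1]]),
        ([0,-1,1,0,0,0], [[1,0,0,0,0,0,0], [0,1,0,0,0,0,0], [0,0,0,0,0,0,1], [0,0,1,0,0,0,-1],
        [0,0,0,1,0,0,0], [0,0,0,0,1,0,0], [0,0,0,0,0,1,0]]), ([0,-1,0,1,-1,0], [[0,1,0,0,0,0,0],
        [0,0,0,0,1,1,1], [-1,-1,0,1,0,0,-1], [0,0,0,0,1,0,1], [1,1,0,0,1,1,1], [0,0,0,1,0,0,0],
        [0,0,1,1,1,1,0]]), ([0,-1,1,0,-1,0], [[0,0,0,0,0,1,0], [-1,-1,0,0,0,0,0],
        [0,0,1,1,0,0,-1], [-1,0,0,0,0,-1,0], [0,0,0,0,1,1,1], [0,0,1,0,0,0,-1], [0,0,1,1,0,0,0]])]"])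
    code_simp

lemma extensible_D6_2: "extensible (D_matrix 6 2) (forms 7)"
  by (rule extensibleI[where n = 3
      and g = "[[0,1,0,0,0,0], [1,1,1,1,1,1], [-1,-1,0,0,-1,-1], [0,0,0,0,1,0], [0,0,-1,0,0,1],
        [-1,-1,0,-1,-1,-1]]"
      and Zs = "[[(1,[0,0,1,0,-1,-1]), (1,[1,2,1,1,1,1]), (1,[0,0,0,0,1,1]), (1,[0,0,0,1,1,1]),
        (1,[0,0,1,0,0,-1]), (1,[0,0,1,1,0,-1]), (1,[0,1,0,0,0,1]), (1,[0,1,0,0,1,1]),
        (1,[0,1,0,1,1,1]), (1,[0,1,1,1,1,1]), (1,[1,1,0,0,0,1]), (1,[1,1,0,0,1,1]),
        (1,[1,1,0,1,1,1]), (1,[1,1,1,1,1,1])], [(1,[0,0,0,1,1]), (1,[0,0,1,1,1]), (1,[0,1,1,1,1]),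
        (1,[1,1,1,1,1])], [(1,[0,0,1,1]), (1,[0,1,1,1]), (1,[1,1,1,1])], [(1,[0,1,1]),
        (1,[1,1,1])], [(1,[1,1])], []]"
      and tab = "[([-1,0,0,0,0,0], [[0,0,0,1,0,0,0], [0,0,0,0,1,0,0], [0,0,0,0,0,1,0],
        [-1,-1,-1,-1,-1,-1,0], [0,0,0,0,0,0,-1], [1,0,0,0,0,0,1], [0,1,0,0,0,1,0]]),
        ([0,0,-1,0,0,0], [[0,0,0,0,0,0,1], [1,1,0,0,0,0,0], [0,0,0,-1,-1,0,0], [0,0,0,0,0,1,0],
        [1,0,0,0,0,0,0], [0,0,-1,-1,-1,0,-1], [0,0,0,-1,0,0,0]]), ([0,0,0,-1,0,0],
        [[0,0,0,0,0,0,1], [1,1,0,0,0,0,0], [0,0,1,0,-1,-1,0], [0,0,1,0,0,0,0], [1,0,0,0,0,0,0],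
        [0,0,0,-1,-1,-1,-1], [0,0,0,0,-1,0,0]]), ([0,0,0,0,-1,0], [[0,0,0,0,0,0,1],
        [1,1,0,0,0,0,0], [0,0,1,1,0,-1,0], [0,0,1,1,0,0,0], [1,0,0,0,0,0,0], [0,0,0,0,-1,-1,-1],
        [0,0,1,0,0,-1,0]]), ([0,0,0,0,0,-1], [[0,0,0,0,0,1,0], [0,0,1,1,0,-1,-1],
        [0,-1,-1,-1,-1,-1,-1], [0,-1,-1,-1,0,0,0], [0,0,1,0,0,-1,-1], [0,-1,0,0,-1,-2,-1],
        [-1,-1,-1,-1,-1,-1,-1]]), ([-1,0,1,0,0,0], [[0,0,0,0,0,0,1], [0,0,0,1,1,0,0],
        [-1,-2,-1,-1,-1,-1,0], [-1,-1,-1,-1,-1,0,0], [0,0,0,1,0,0,0], [-1,-1,0,0,0,-1,-1],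
        [0,-1,0,0,0,0,0]]), ([0,-1,1,0,0,0], [[0,0,0,0,0,0,1], [0,0,0,1,1,0,0],
        [0,-1,-1,-1,-1,-1,0], [0,-1,-1,-1,-1,0,0], [0,0,0,1,0,0,0], [0,-1,0,0,0,-1,-1],
        [-1,-1,-1,-1,-1,-1,0]]), ([0,0,-1,1,0,0], [[1,0,0,0,0,0,0], [0,1,0,0,0,0,0],
        [0,0,1,0,0,0,0], [0,0,0,0,0,0,1], [0,0,0,1,0,0,-1], [0,0,0,0,1,0,0], [0,0,0,0,0,1,0]]),
        ([-1,1,-1,0,0,0], [[0,0,0,0,0,0,1], [-1,-1,0,0,0,0,0], [0,0,0,-1,-1,0,0],
        [-1,0,0,0,0,0,-1], [0,0,1,1,1,0,1], [0,0,0,-1,0,0,0], [0,0,0,0,0,1,0]]), ([-1,1,0,-1,0,0],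
        [[0,0,0,0,0,0,1], [-1,-1,0,0,0,0,0], [0,0,1,0,-1,-1,0], [-1,0,0,0,0,0,-1],
        [0,0,0,1,1,1,1], [0,0,0,0,-1,0,0], [0,0,1,0,0,0,0]]), ([0,0,-1,1,-1,0], [[0,0,0,0,0,0,1],
        [0,0,0,1,1,0,0], [1,1,0,0,0,0,0], [0,0,0,1,0,0,-1], [0,0,1,1,1,0,1], [1,0,0,0,0,0,0],
        [0,0,0,0,0,-1,0]]), ([0,0,0,-1,1,-1], [[0,0,0,0,0,0,1], [0,0,0,-1,-1,0,0],
        [1,1,0,0,0,0,0], [0,0,0,-1,0,0,-1], [0,0,0,0,0,1,1], [1,0,0,0,0,0,0],
        [0,0,-1,-1,-1,0,0]]), ([-1,1,-1,1,-1,0], [[0,0,1,0,0,0,0], [0,0,0,0,1,1,1],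
        [1,0,0,-1,0,0,1], [0,0,0,0,1,0,1], [0,-1,-1,-1,-1,-1,0], [1,0,0,0,1,1,1],
        [0,0,0,-1,0,0,0]]), ([-1,1,0,-1,1,-1], [[0,0,0,0,0,1,0], [0,-1,-1,0,0,0,0],
        [0,0,0,-1,-1,-1,-1], [0,-1,0,0,0,-1,0], [0,0,0,-1,-1,-1,0], [-1,-1,-1,-1,-1,-1,-1],
        [0,0,0,-1,0,0,-1]])]"])
    code_simp

lemma extensible_E6_0: "extensible (E6_matrices ! 0) (forms 7)"
  by (rule extensibleI[where n = 12
      and g = "[[0,1,1,0,0,-1], [1,1,1,0,-1,-1], [1,1,1,1,0,-1], [0,0,-1,-1,0,0], [0,1,0,0,-1,0],
        [1,1,1,0,0,-1]]"
      and Zs = "[[(1,[2,2,2,1,-1,-3]), (1,[1,2,2,1,-1,-3]), (1,[0,0,1,0,0,-1]), (1,[0,0,1,1,0,-1]),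
        (1,[0,1,0,0,-1,-1]), (1,[0,1,0,0,0,-1]), (1,[0,1,1,0,-1,-1]), (1,[0,1,1,0,0,-1]),
        (1,[0,1,1,1,-1,-1]), (1,[0,1,1,1,0,-1]), (1,[1,0,0,0,0,-1]), (1,[1,0,1,0,0,-1]),
        (1,[1,0,1,1,0,-1]), (1,[1,1,0,0,-1,-1]), (1,[1,1,0,0,0,-1]), (1,[1,1,1,0,-1,-2]),
        (1,[1,1,1,0,-1,-1]), (1,[1,1,1,0,0,-2]), (1,[1,1,1,0,0,-1]), (1,[1,1,1,1,-1,-2]),
        (1,[1,1,1,1,-1,-1]), (1,[1,1,1,1,0,-2]), (1,[1,1,1,1,0,-1]), (1,[1,1,2,1,-1,-2]),
        (1,[1,1,2,1,0,-2]), (1,[1,2,1,0,-1,-2]), (1,[1,2,1,1,-1,-2]), (1,[1,2,2,1,-1,-2])],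
        [(1,[0,1,0,0,-1])], [(1,[0,0,1,1])], [], [], []]"
      and tab = "[([0,0,0,-1,0,0], [[0,0,0,0,1,0,0], [0,0,0,1,0,0,1], [0,0,0,0,0,-1,0], [0,-1,0,0,1,1,0],
        [0,0,0,1,0,0,0], [0,0,1,1,0,-1,1], [1,0,0,0,0,-1,0]]), ([-1,0,0,0,-1,0],
        [[1,0,0,0,0,-1,0], [0,0,-1,-1,0,1,0], [0,-1,0,0,1,1,0], [0,1,0,0,0,-1,0],
        [0,0,-1,0,0,1,0], [-1,-1,-1,-1,1,2,0], [0,0,0,0,0,0,-1]]), ([0,-1,1,0,0,0],
        [[1,0,0,0,0,0,0], [0,0,-1,0,0,0,0], [0,-1,0,0,0,0,0], [0,0,0,0,0,0,1], [0,0,0,1,0,0,0],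
        [0,0,0,0,0,-1,0], [0,0,0,0,-1,0,0]])]"])
    code_simp

lemma extensible_E6_1: "extensible (E6_matrices ! 1) (forms 7)"
  by (rule extensibleI[where n = 9
      and g = "[[0,-1,-1,0,0,1], [-1,2,0,1,-1,-1], [-1,0,1,-1,0,-1], [0,-1,1,-1,0,0], [0,1,0,0,-1,0],
        [-1,1,1,0,0,-1]]"
      and Zs = "[[(1,[1,-2,-1,-1,1,2]), (1,[1,-2,-1,0,1,2]), (1,[1,0,0,0,0,1]), (1,[0,0,1,-1,0,-1]),
        (1,[0,0,1,0,0,-1]), (1,[0,1,0,0,-1,-1]), (1,[0,1,0,0,0,-1]), (1,[0,1,0,1,-1,-1]),
        (1,[0,1,0,1,0,-1]), (1,[0,1,1,0,-1,-1]), (1,[0,1,1,0,0,-1]), (1,[0,2,0,1,-1,-1]),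
        (1,[1,-2,0,-1,1,1]), (1,[1,-2,0,-1,1,2]), (1,[1,-1,-1,0,0,1]), (1,[1,-1,-1,0,0,2]),
        (1,[1,-1,-1,0,1,1]), (1,[1,-1,-1,0,1,2]), (1,[1,-1,0,-1,0,1]), (1,[1,-1,0,-1,1,1]),
        (1,[1,-1,0,0,0,1]), (1,[1,-1,0,0,1,1]), (1,[1,0,-1,0,0,1]), (1,[1,0,-1,1,0,1])],
        [(1,[0,1,-1,1,-1]), (1,[0,1,0,0,-1]), (1,[0,1,0,1,-1])], [(1,[0,1,-1,1]), (1,[0,0,1,-1]),
        (1,[0,1,0,1])], [], [], []]"
      and tab = "[([-1,0,0,0,0,0], [[0,0,1,0,0,0,0], [1,0,0,0,0,0,0], [0,-1,0,0,0,0,0], [0,0,0,0,1,0,0],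
        [0,0,0,0,0,0,-1], [0,0,0,0,0,-1,0], [0,0,0,1,0,0,0]]), ([0,0,-1,0,0,0], [[1,0,0,0,0,0,0],
        [0,1,0,0,0,0,0], [0,0,1,0,0,0,0], [0,0,0,1,0,0,0], [0,0,0,0,1,0,0], [0,0,0,0,0,1,0],
        [0,0,0,0,0,0,-1]]), ([-1,0,-1,0,0,0], [[1,0,0,0,0,0,0], [0,0,-1,0,0,0,0], [0,1,0,0,0,0,0],
        [0,0,0,0,0,0,1], [0,0,0,0,0,-1,0], [0,0,0,0,1,0,0], [0,0,0,-1,0,0,0]])]"])
    code_simp

lemma extensible_E6_2: "extensible (E6_matrices ! 2) (forms 7)"
  by (rule extensibleI[where n = 6
      and g = "[[2,0,0,1,-1,-1], [0,1,-1,-1,-1,0], [0,-1,1,0,1,-1], [-1,1,0,-1,0,0], [1,1,-1,0,-1,0],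
        [1,0,1,0,0,-1]]"
      and Zs = "[[(1,[1,-1,1,1,0,-1]), (1,[0,0,1,0,1,-1]), (1,[2,0,0,1,-1,-1]), (1,[0,0,1,0,0,-1]),
        (1,[0,1,-1,-1,-1,1]), (1,[0,1,-1,0,-1,1]), (1,[1,-1,0,1,0,-1]), (1,[1,-1,1,1,1,-1]),
        (1,[1,0,0,0,-1,-1]), (1,[1,0,0,0,0,-1]), (1,[1,0,0,1,-1,-1]), (1,[1,0,0,1,0,-1]),
        (1,[1,0,1,0,0,-1]), (1,[1,0,1,1,0,-1]), (1,[1,1,0,0,-1,-1])], [(1,[1,1,-1,0,-2]),
        (1,[0,0,1,0,1]), (1,[0,1,-1,-1,-1]), (1,[0,1,-1,0,-1]), (1,[0,1,0,-1,-1]),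
        (1,[0,1,0,0,-1]), (1,[1,0,-1,0,-1]), (1,[1,0,-1,1,-1]), (1,[1,0,0,0,-1]),
        (1,[1,0,0,1,-1]), (1,[1,1,-1,0,-1]), (1,[1,1,0,0,-1])], [(1,[1,-1,0,1]), (1,[0,1,0,-1]),
        (1,[1,0,0,1])], [], [], []]"
      and tab = "[([0,-1,0,0,0,0], [[0,0,1,0,0,0,0], [-1,0,0,0,0,0,0], [0,1,0,0,0,0,0], [0,0,0,0,0,-1,0],
        [0,0,0,0,-1,0,0], [0,0,0,0,0,0,-1], [0,0,0,1,0,0,0]]), ([0,0,0,-1,0,0], [[0,0,0,0,0,1,0],
        [0,0,0,0,1,0,0], [0,0,0,1,0,0,1], [0,0,1,0,1,-1,0], [-1,0,0,-1,1,1,-1], [0,0,0,1,0,0,0],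
        [0,-1,0,1,1,0,1]]), ([-1,0,0,0,0,-1], [[0,1,0,-1,0,0,0], [1,0,0,1,0,-1,0],
        [0,0,1,0,0,-1,0], [1,-1,0,1,0,-1,0], [0,0,0,0,1,0,0], [0,0,0,0,0,0,1], [1,0,1,1,0,-1,0]]),
        ([0,-1,-1,0,0,0], [[1,0,0,0,0,0,0], [0,1,0,0,0,0,0], [0,0,1,0,0,0,0], [0,0,0,1,0,0,0],
        [0,0,0,0,-1,0,0], [0,0,0,0,0,0,-1], [0,0,0,0,0,1,0]]), ([0,-1,0,-1,0,0],
        [[1,0,0,0,0,-1,0], [1,0,0,0,-1,0,0], [-1,0,0,-1,0,0,0], [0,0,-1,0,-1,1,0],
        [1,0,0,0,0,0,0], [0,0,0,0,0,0,1], [0,1,0,-1,-1,0,0]])]"])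
    code_simp

text \<open>Bounds from roots do not exclude columns with four raised and four lower vertices. The
  bounds with \<open>t = 2\<close> do: in vertex coordinates their vectors are 1 at four vertices
  and -1 at the other four, the null vectors of affine E7.\<close>

lemma extensible_A7: "extensible (A_matrix 7) (forms 8)"
  by (rule extensibleI[where n = 8
      and g = "[[0,1,0,0,0,0,0], [0,0,1,0,0,0,0], [0,0,0,1,0,0,0], [0,0,0,0,1,0,0], [0,0,0,0,0,1,0],
        [0,0,0,0,0,0,1], [-1,-1,-1,-1,-1,-1,-1]]"
      and Zs = "[[(1,[0,0,0,0,0,1,1]), (1,[0,0,0,0,1,1,1]), (1,[0,0,0,1,1,1,1]), (1,[0,0,1,1,1,1,1]),
        (1,[0,1,1,1,1,1,1]), (1,[1,1,1,1,1,1,1]), (2,[1,2,3,4,3,2,1]), (2,[1,2,3,2,3,2,1]),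
        (2,[1,2,3,2,1,2,1]), (2,[1,2,3,2,1,0,1]), (2,[1,2,3,2,1,0,-1]), (2,[1,2,1,2,3,2,1]),
        (2,[1,2,1,2,1,2,1]), (2,[1,2,1,2,1,0,1]), (2,[1,2,1,2,1,0,-1]), (2,[1,2,1,0,1,2,1]),
        (2,[1,2,1,0,1,0,1]), (2,[1,2,1,0,1,0,-1]), (2,[1,2,1,0,-1,0,1]), (2,[1,2,1,0,-1,0,-1]),
        (2,[1,2,1,0,-1,-2,-1]), (2,[1,0,1,2,3,2,1]), (2,[1,0,1,2,1,2,1]), (2,[1,0,1,2,1,0,1]),
        (2,[1,0,1,2,1,0,-1]), (2,[1,0,1,0,1,2,1]), (2,[1,0,1,0,1,0,1]), (2,[1,0,1,0,1,0,-1]),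
        (2,[1,0,1,0,-1,0,1]), (2,[1,0,1,0,-1,0,-1]), (2,[1,0,1,0,-1,-2,-1]), (2,[1,0,-1,0,1,2,1]),
        (2,[1,0,-1,0,1,0,1]), (2,[1,0,-1,0,1,0,-1]), (2,[1,0,-1,0,-1,0,1]),
        (2,[1,0,-1,0,-1,0,-1]), (2,[1,0,-1,0,-1,-2,-1]), (2,[1,0,-1,-2,-1,0,1]),
        (2,[1,0,-1,-2,-1,0,-1]), (2,[1,0,-1,-2,-1,-2,-1]), (2,[1,0,-1,-2,-3,-2,-1])],
        [(1,[0,0,0,0,1,1]), (1,[0,0,0,1,1,1]), (1,[0,0,1,1,1,1]), (1,[0,1,1,1,1,1]),
        (1,[1,1,1,1,1,1])], [(1,[0,0,0,1,1]), (1,[0,0,1,1,1]), (1,[0,1,1,1,1]), (1,[1,1,1,1,1])],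
        [(1,[0,0,1,1]), (1,[0,1,1,1]), (1,[1,1,1,1])], [(1,[0,1,1]), (1,[1,1,1])], [(1,[1,1])],
        []]"
      and tab = "[([-1,0,0,0,0,0,0], [[0,1,0,0,0,0,0,0], [0,0,1,0,0,0,0,0], [0,0,0,1,0,0,0,0],
        [0,0,0,0,1,0,0,0], [0,0,0,0,0,1,0,0], [0,0,0,0,0,0,1,0], [-1,-1,-1,-1,-1,-1,-1,0],
        [0,0,0,0,0,0,0,-1]]), ([0,-1,0,0,0,0,0], [[1,0,0,0,0,0,0,0], [0,1,0,0,0,0,0,1],
        [0,0,1,0,0,0,0,0], [0,0,0,1,0,0,0,0], [0,0,0,0,1,0,0,0], [0,0,0,0,0,1,0,0],
        [0,0,0,0,0,0,1,0], [0,-1,-1,-1,-1,-1,-1,0]]), ([0,0,-1,0,0,0,0], [[0,0,0,0,0,0,0,1],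
        [0,0,0,0,1,1,0,0], [0,0,0,1,1,1,1,0], [-1,-1,0,0,0,0,0,0], [1,0,0,0,0,0,0,0],
        [0,0,0,0,1,0,0,0], [0,0,0,1,1,1,0,0], [0,0,1,1,1,1,1,1]]), ([-1,0,0,0,0,1,-1],
        [[0,0,0,0,0,0,1,1], [0,0,0,0,0,0,-1,0], [-1,0,0,0,0,0,0,-1], [0,-1,0,0,0,0,0,0],
        [0,0,-1,0,0,0,0,0], [0,0,0,-1,0,0,0,0], [0,0,0,0,-1,0,0,0], [0,0,0,0,0,-1,-1,0]]),
        ([-1,0,0,0,1,-1,0], [[0,0,0,0,0,0,1,0], [-1,-1,-1,-1,-1,-1,-1,0], [1,0,0,0,0,0,0,0],
        [0,1,0,0,0,0,0,0], [0,0,1,0,0,0,0,0], [0,0,0,1,0,0,0,0], [0,0,0,0,1,0,0,0],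
        [0,0,0,0,0,0,0,-1]]), ([-1,0,0,0,1,0,-1], [[0,0,0,0,0,1,0,0], [0,1,1,0,0,0,0,0],
        [1,1,1,1,0,0,0,1], [-1,-1,-1,-1,-1,-1,-1,0], [-1,-1,-1,-1,0,0,0,0], [0,1,0,0,0,0,0,0],
        [1,1,1,0,0,0,0,1], [0,0,0,0,-1,-1,0,1]]), ([-1,0,0,1,-1,0,0], [[0,1,0,0,0,0,0,0],
        [0,0,1,0,0,0,0,0], [0,0,0,1,0,0,0,0], [0,0,0,0,1,0,0,0], [0,0,0,0,0,1,0,0],
        [0,0,0,0,0,0,1,0], [-1,-1,-1,-1,-1,-1,-1,0], [0,0,0,0,0,0,0,-1]]), ([-1,0,0,1,0,-1,0],
        [[0,0,0,0,1,0,0,0], [0,1,0,0,0,0,0,0], [1,1,1,0,0,0,0,1], [-1,-1,-1,-1,-1,-1,0,0],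
        [-1,-1,-1,0,0,0,0,0], [1,1,0,0,0,0,0,1], [0,0,0,-1,-1,0,0,1], [0,0,0,0,0,0,1,0]]),
        ([-1,0,1,0,-1,0,0], [[0,0,0,1,0,0,0,0], [0,0,0,0,0,0,1,0], [-1,-1,-1,-1,-1,0,0,0],
        [1,1,0,0,0,0,0,1], [1,1,0,0,0,0,0,0], [0,0,0,0,0,1,1,0], [0,0,-1,-1,0,0,0,1],
        [1,0,0,0,0,0,0,1]]), ([-1,0,1,0,0,0,-1], [[0,1,0,0,0,0,0,0], [0,0,0,0,1,1,0,0],
        [0,0,0,1,1,1,1,0], [-1,-1,-1,-1,-1,-1,-1,-1], [-1,-1,-1,-1,-1,-1,-1,0], [0,0,0,0,1,0,0,0],
        [0,0,0,1,1,1,0,0], [-1,-1,0,0,0,0,0,-1]]), ([-1,0,0,1,-1,1,-1], [[0,0,0,0,0,0,0,1],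
        [0,0,0,0,0,1,1,0], [0,1,1,0,0,0,0,0], [1,1,1,1,0,0,0,0], [0,0,0,0,0,1,0,-1],
        [0,0,0,0,1,1,1,1], [0,1,0,0,0,0,0,0], [1,1,1,0,0,0,0,1]]), ([-1,0,1,-1,0,1,-1],
        [[0,0,0,0,0,0,0,1], [0,0,1,1,0,0,0,0], [0,1,1,1,1,0,0,0], [1,1,1,1,1,1,0,0],
        [0,0,0,0,0,0,1,1], [0,0,1,0,0,0,0,-1], [0,1,1,1,0,0,0,0], [1,1,1,1,1,0,0,1]])]"])
    code_simp

lemma extensible_D7_0: "extensible (D_matrix 7 0) (forms 8)"
  by (rule extensibleI[where n = 12
      and g = "[[0,0,-1,-1,-1,-1,-1], [0,0,1,0,0,0,0], [0,0,0,1,0,0,0], [0,0,0,0,1,0,0], [0,0,0,0,0,1,0],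
        [-1,0,0,0,0,0,1], [0,-1,-1,-1,-1,-1,-1]]"
      and Zs = "[[(1,[1,0,-1,-1,-1,-1,-1]), (1,[1,1,1,0,-1,-1,-1]), (1,[0,0,0,0,0,1,1]),
        (1,[1,1,1,1,1,0,-1]), (1,[1,0,0,-1,-1,-1,-1]), (1,[1,0,0,0,-1,-1,-1]),
        (1,[1,1,0,-1,-1,-1,-1]), (1,[1,1,0,0,-1,-1,-1]), (1,[0,0,0,0,1,1,1]), (1,[0,0,0,1,1,1,1]),
        (1,[0,0,1,1,1,1,1]), (1,[0,1,1,1,1,1,1]), (1,[1,0,0,0,0,-1,-1]), (1,[1,0,0,0,0,0,-1]),
        (1,[1,1,0,0,0,-1,-1]), (1,[1,1,0,0,0,0,-1]), (1,[1,1,1,0,0,-1,-1]), (1,[1,1,1,0,0,0,-1]),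
        (1,[1,1,1,1,0,-1,-1]), (1,[1,1,1,1,0,0,-1])], [(1,[0,0,0,0,1,1]), (1,[0,0,0,1,1,1]),
        (1,[0,0,1,1,1,1]), (1,[0,1,1,1,1,1]), (1,[1,1,1,1,1,1])], [(1,[0,0,0,1,1]),
        (1,[0,0,1,1,1]), (1,[0,1,1,1,1]), (1,[1,1,1,1,1])], [(1,[0,0,1,1]), (1,[0,1,1,1]),
        (1,[1,1,1,1])], [(1,[0,1,1]), (1,[1,1,1])], [(1,[1,1])], []]"
      and tab = "[([-1,0,0,0,0,0,0], [[0,0,0,0,0,0,1,0], [0,0,-1,-1,0,0,0,0], [0,-1,-1,-1,-1,0,0,0],
        [-1,-1,-1,-1,-1,-1,0,-1], [1,1,1,1,1,1,0,0], [0,0,-1,0,0,0,0,0], [0,-1,-1,-1,0,0,0,0],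
        [-1,-1,-1,-1,-1,0,1,-1]]), ([-1,0,0,0,0,0,-1], [[0,0,0,0,0,0,0,1], [0,0,0,0,0,0,-1,-1],
        [-1,0,0,0,0,0,1,0], [0,-1,0,0,0,0,0,0], [0,0,-1,0,0,0,0,0], [0,0,0,-1,0,0,0,0],
        [0,0,0,0,-1,0,0,0], [0,0,0,0,0,-1,-1,-1]]), ([-1,1,0,0,0,0,0], [[1,0,0,0,0,0,0,0],
        [0,0,0,0,0,0,0,1], [0,1,0,0,0,0,0,-1], [0,0,1,0,0,0,0,0], [0,0,0,1,0,0,0,0],
        [0,0,0,0,1,0,0,0], [0,0,0,0,0,1,0,0], [0,0,0,0,0,0,1,0]]), ([-1,0,0,0,1,-1,0],
        [[0,0,0,0,0,0,1,0], [0,0,1,1,0,0,0,0], [0,1,1,1,1,0,0,0], [1,1,1,1,1,1,0,0],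
        [0,0,0,0,0,0,0,-1], [0,0,1,0,0,0,0,0], [0,1,1,1,0,0,0,0], [1,1,1,1,1,0,-1,0]]),
        ([-1,0,0,1,-1,0,0], [[0,0,0,0,0,0,1,0], [0,0,1,0,0,0,0,0], [0,1,1,1,0,0,0,0],
        [1,1,1,1,2,1,0,1], [0,0,0,0,1,0,0,0], [0,1,1,0,0,0,0,0], [1,1,1,1,1,0,-1,1],
        [1,1,1,1,1,1,0,0]]), ([-1,0,0,1,0,-1,0], [[0,0,0,0,0,1,1,0], [0,0,1,0,0,0,0,0],
        [0,1,1,1,0,0,0,0], [1,1,1,1,0,-1,-1,-1], [0,0,0,0,0,-1,0,-1], [0,1,1,0,0,0,0,0],
        [1,1,1,1,0,-1,-1,0], [0,0,0,0,-1,-1,-1,-1]]), ([-1,0,1,0,-1,0,0], [[1,0,0,0,0,0,0,0],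
        [0,0,0,0,0,-1,0,0], [0,0,0,0,1,1,1,1], [0,-1,-2,-1,0,0,0,1], [0,0,0,0,-1,-1,0,-1],
        [0,1,1,0,0,0,0,-1], [0,0,-1,0,1,1,1,1], [0,-1,-1,-1,0,0,0,0]]), ([-1,0,1,-1,1,-1,0],
        [[1,0,-1,0,-1,0,0,1], [-1,0,0,0,0,0,1,0], [0,-1,-1,-1,-1,0,0,1], [0,0,-1,-1,0,0,0,0],
        [0,0,0,0,-1,0,0,0], [-1,0,0,0,0,0,0,0], [0,0,0,0,0,1,1,1], [0,-1,-2,-1,-1,0,0,1]])]"])
    code_simp

lemma extensible_D7_1: "extensible (D_matrix 7 1) (forms 8)"
  by (rule extensibleI[where n = 20
      and g = "[[1,1,1,1,1,1,1], [-1,0,0,-1,-1,-1,-1], [0,0,0,1,0,0,0], [0,0,0,0,1,0,0], [0,0,0,0,0,1,0],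
        [0,-1,0,0,0,0,1], [-1,0,-1,-1,-1,-1,-1]]"
      and Zs = "[[(1,[0,1,0,-1,-1,-1,-1]), (1,[0,1,1,1,0,-1,-1]), (1,[1,0,0,0,0,0,1]),
        (1,[1,1,1,1,1,1,1]), (1,[0,1,0,0,-1,-1,-1]), (1,[0,1,0,0,0,-1,-1]),
        (1,[0,1,1,0,-1,-1,-1]), (1,[0,1,1,0,0,-1,-1]), (1,[0,0,0,0,0,1,1]), (1,[0,0,0,0,1,1,1]),
        (1,[0,0,0,1,1,1,1]), (1,[0,0,1,1,1,1,1]), (1,[0,1,0,0,0,0,-1]), (1,[0,1,1,0,0,0,-1]),
        (1,[0,1,1,1,0,0,-1]), (1,[0,1,1,1,1,0,-1]), (1,[1,0,0,0,0,1,1]), (1,[1,0,0,0,1,1,1]),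
        (1,[1,0,0,1,1,1,1]), (1,[1,0,1,1,1,1,1])], [(1,[0,0,0,0,1,1]), (1,[0,0,0,1,1,1]),
        (1,[0,0,1,1,1,1]), (1,[0,1,1,1,1,1]), (1,[1,1,1,1,1,1])], [(1,[0,0,0,1,1]),
        (1,[0,0,1,1,1]), (1,[0,1,1,1,1]), (1,[1,1,1,1,1])], [(1,[0,0,1,1]), (1,[0,1,1,1]),
        (1,[1,1,1,1])], [(1,[0,1,1]), (1,[1,1,1])], [(1,[1,1])], []]"
      and tab = "[([-1,0,0,0,0,0,0], [[0,0,0,0,0,0,0,1], [-1,0,0,0,0,0,0,-1], [0,0,0,0,0,0,-1,0],
        [0,-1,0,0,0,0,1,0], [0,0,-1,0,0,0,0,0], [0,0,0,-1,0,0,0,0], [0,0,0,0,-1,0,0,0],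
        [0,0,0,0,0,-1,-1,0]]), ([0,-1,0,0,0,0,0], [[0,0,0,0,0,0,0,1], [0,0,0,-1,-1,0,0,0],
        [0,0,-1,-1,-1,-1,0,0], [1,0,0,0,0,0,0,0], [0,0,0,0,0,0,-1,0], [0,0,0,-1,0,0,0,0],
        [0,0,-1,-1,-1,0,0,0], [0,-1,-1,-1,-1,-1,0,-1]]), ([0,-1,1,0,0,0,0], [[1,0,0,0,0,0,0,0],
        [0,1,0,0,0,0,0,0], [0,0,0,0,0,0,0,1], [0,0,1,0,0,0,0,-1], [0,0,0,1,0,0,0,0],
        [0,0,0,0,1,0,0,0], [0,0,0,0,0,1,0,0], [0,0,0,0,0,0,1,0]]), ([0,-1,0,0,1,-1,0],
        [[1,1,0,0,0,0,0,0], [0,0,0,0,0,0,-1,0], [0,0,0,-1,-1,0,0,0], [0,0,-1,-1,-1,0,0,1],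
        [-1,0,0,0,0,0,-1,0], [0,0,0,0,0,-1,-1,-1], [0,0,0,-1,0,0,0,0], [0,0,-1,-1,-1,0,0,0]]),
        ([0,-1,0,1,-1,0,0], [[1,1,0,0,0,0,0,0], [0,0,0,0,-1,0,0,0], [0,0,0,-1,-1,-1,0,0],
        [-1,0,-1,-1,-1,-1,-1,0], [1,0,0,0,0,0,0,0], [0,0,0,0,0,0,0,1], [0,0,0,-1,-1,0,0,0],
        [0,0,-1,-1,-1,-1,0,0]]), ([0,-1,1,-1,1,-1,0], [[0,0,0,0,0,0,0,1], [0,0,1,1,0,0,0,0],
        [0,-1,-1,-1,-1,0,1,0], [-1,0,0,0,0,0,0,0], [0,0,1,0,0,0,0,-1], [0,1,1,1,0,0,-1,1],
        [0,1,1,1,1,0,0,0], [0,0,0,0,0,1,1,1]])]"])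
    code_simp

lemma extensible_D7_2: "extensible (D_matrix 7 2) (forms 8)"
  by (rule extensibleI[where n = 24
      and g = "[[0,1,0,0,0,0,0], [1,1,1,1,1,1,1], [-1,-1,0,0,-1,-1,-1], [0,0,0,0,1,0,0], [0,0,0,0,0,1,0],
        [0,0,-1,0,0,0,1], [-1,-1,0,-1,-1,-1,-1]]"
      and Zs = "[[(1,[0,0,1,0,-1,-1,-1]), (1,[0,1,0,0,0,1,1]), (1,[1,1,0,0,0,0,1]), (1,[1,1,1,1,1,1,1]),
        (1,[0,0,1,0,0,-1,-1]), (1,[0,0,1,1,0,-1,-1]), (1,[0,1,0,0,1,1,1]), (1,[0,1,0,1,1,1,1]),
        (1,[0,0,0,0,0,1,1]), (1,[0,0,0,0,1,1,1]), (1,[0,0,0,1,1,1,1]), (1,[0,0,1,0,0,0,-1]),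
        (1,[0,0,1,1,0,0,-1]), (1,[0,0,1,1,1,0,-1]), (1,[0,1,0,0,0,0,1]), (1,[0,1,1,1,1,1,1]),
        (1,[1,1,0,0,0,1,1]), (1,[1,1,0,0,1,1,1]), (1,[1,1,0,1,1,1,1]), (1,[1,2,1,1,1,1,1])],
        [(1,[0,0,0,0,1,1]), (1,[0,0,0,1,1,1]), (1,[0,0,1,1,1,1]), (1,[0,1,1,1,1,1]),
        (1,[1,1,1,1,1,1])], [(1,[0,0,0,1,1]), (1,[0,0,1,1,1]), (1,[0,1,1,1,1]), (1,[1,1,1,1,1])],
        [(1,[0,0,1,1]), (1,[0,1,1,1]), (1,[1,1,1,1])], [(1,[0,1,1]), (1,[1,1,1])], [(1,[1,1])],
        []]"
      and tab = "[([-1,0,0,0,0,0,0], [[0,1,0,0,0,0,0,0], [1,1,1,1,1,1,1,0], [0,0,0,0,0,0,0,1],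
        [-1,-1,0,0,0,0,-1,-1], [0,0,-1,0,0,0,1,0], [0,0,0,-1,0,0,0,0], [0,0,0,0,-1,0,0,0],
        [-1,-1,0,0,0,-1,-1,-1]]), ([0,0,-1,0,0,0,0], [[0,0,0,0,0,0,0,1], [0,0,0,0,-1,0,0,0],
        [0,0,0,-1,-1,-1,0,0], [1,1,0,0,0,0,0,0], [0,0,0,0,0,0,-1,0], [0,0,0,-1,-1,0,0,0],
        [0,0,-1,-1,-1,-1,0,-1], [1,0,0,0,0,0,0,0]]), ([0,0,-1,1,0,0,0], [[1,0,0,0,0,0,0,0],
        [0,1,0,0,0,0,0,0], [0,0,1,0,0,0,0,0], [0,0,0,0,0,0,0,1], [0,0,0,1,0,0,0,-1],
        [0,0,0,0,1,0,0,0], [0,0,0,0,0,1,0,0], [0,0,0,0,0,0,1,0]]), ([-1,1,-1,0,0,0,0],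
        [[0,0,1,0,0,0,0,0], [-1,0,0,0,0,0,0,0], [0,0,0,0,-1,-1,0,0], [0,0,0,-1,-1,-1,-1,0],
        [0,0,0,0,0,0,0,1], [0,1,1,1,1,1,1,0], [0,0,0,0,-1,0,0,0], [0,0,0,-1,-1,-1,0,0]]),
        ([0,0,-1,0,1,-1,0], [[1,1,1,0,0,0,0,0], [0,0,0,0,1,1,1,0], [0,1,0,0,0,1,1,0],
        [1,1,0,0,0,1,1,1], [0,0,0,0,0,-1,0,-1], [0,0,0,1,1,1,1,0], [0,1,0,0,1,1,1,0],
        [1,1,0,0,0,1,1,0]]), ([-1,1,-1,0,1,-1,0], [[0,0,1,0,0,0,0,0], [0,0,0,0,-1,0,0,0],
        [1,0,0,-1,-1,0,0,1], [0,0,0,0,0,-1,-1,-1], [0,0,0,-1,-1,0,0,0], [-1,0,0,0,0,-1,-1,-1],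
        [0,-1,-1,-1,-1,-1,-1,0], [0,0,0,0,0,-1,0,-1]])]"])
    code_simp

lemma extensible_E7_0: "extensible (E7_matrices ! 0) (forms 8)"
  by (rule extensibleI[where n = 9
      and g = "[[0,0,-1,-1,0,0,0], [0,1,1,0,-1,-1,0], [-1,1,2,1,0,-1,-1], [1,0,-1,-1,0,0,0],
        [0,1,0,0,-1,0,0], [0,1,1,0,0,-1,0], [0,0,1,0,0,0,-1]]"
      and Zs = "[[(1,[1,-2,-4,-3,1,3,2]), (1,[1,-2,-4,-2,1,3,2]), (1,[2,-2,-4,-3,1,3,2]),
        (1,[0,0,1,0,0,-1,-1]), (1,[0,0,1,0,0,0,-1]), (1,[0,0,1,1,0,-1,-1]), (1,[0,0,1,1,0,0,-1]),
        (1,[0,0,2,1,0,-1,-1]), (1,[0,1,1,0,-1,-1,-1]), (1,[0,1,1,0,0,-1,-1]),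
        (1,[0,1,1,1,-1,-1,-1]), (1,[0,1,1,1,0,-1,-1]), (1,[0,1,2,1,-1,-2,-1]),
        (1,[0,1,2,1,-1,-1,-1]), (1,[0,1,2,1,0,-2,-1]), (1,[0,1,2,1,0,-1,-1]),
        (1,[0,2,2,1,-1,-2,-1]), (1,[1,-2,-3,-2,1,2,1]), (1,[1,-2,-3,-2,1,2,2]),
        (1,[1,-2,-3,-2,1,3,1]), (1,[1,-2,-3,-2,1,3,2]), (1,[1,-2,-2,-2,1,2,1]),
        (1,[1,-2,-2,-1,1,2,1]), (1,[1,-1,-3,-2,0,2,1]), (1,[1,-1,-3,-2,0,2,2]),
        (1,[1,-1,-3,-2,1,2,1]), (1,[1,-1,-3,-2,1,2,2]), (1,[1,-1,-2,-2,0,1,1]),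
        (1,[1,-1,-2,-2,0,2,1]), (1,[1,-1,-2,-2,1,1,1]), (1,[1,-1,-2,-2,1,2,1]),
        (1,[1,-1,-2,-1,0,1,1]), (1,[1,-1,-2,-1,0,2,1]), (1,[1,-1,-2,-1,1,1,1]),
        (1,[1,-1,-2,-1,1,2,1]), (1,[1,-1,-1,-1,0,1,1]), (1,[1,-1,-1,-1,1,1,1]),
        (1,[1,0,-2,-2,0,1,1]), (1,[1,0,-2,-1,0,1,1]), (1,[1,0,-1,-1,0,0,1]),
        (1,[1,0,-1,-1,0,1,1])], [(1,[0,1,1,0,-1,-1]), (1,[0,1,1,1,0,-1]), (1,[1,-1,-1,-1,0,1]),
        (1,[0,0,1,1,0,-1]), (1,[0,1,0,0,-1,-1]), (1,[0,0,1,0,0,-1]), (1,[1,-1,-1,-1,1,1]),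
        (1,[0,1,0,0,0,-1]), (1,[0,1,1,0,0,-1]), (1,[0,1,1,1,-1,-1]), (1,[1,0,-1,-1,0,1])],
        [(1,[0,1,0,0,-1])], [(1,[1,0,-1,-1]), (1,[0,0,1,1]), (1,[1,0,0,-1])], [], [], []]"
      and tab = "[([0,0,0,0,-1,0,0], [[0,0,0,0,0,0,1,0], [0,0,0,0,1,0,0,1], [0,0,0,0,0,1,0,0],
        [0,0,0,-1,0,0,0,0], [-1,0,0,1,0,0,0,0], [0,0,0,0,1,0,0,0], [0,-1,0,0,1,1,0,1],
        [0,0,-1,-1,0,1,1,0]]), ([-1,0,0,0,0,0,1], [[0,0,0,0,0,0,1,0], [0,1,0,0,-1,-1,0,0],
        [0,0,1,1,0,-1,-1,1], [1,0,0,0,0,0,0,0], [0,0,-1,0,0,1,1,-1], [0,1,0,0,0,-1,0,0],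
        [0,1,1,1,-1,-1,-1,1], [0,0,1,1,0,-1,-1,0]]), ([-1,0,0,0,1,0,0], [[0,0,0,0,0,0,1,0],
        [0,0,0,0,-1,0,0,0], [1,1,0,0,-1,-1,0,1], [-1,-1,0,1,1,0,0,-1], [-1,-1,0,0,1,0,0,-1],
        [0,1,0,0,-1,-1,0,0], [0,0,1,1,0,-1,-1,0], [-1,0,0,1,0,0,0,0]]), ([0,0,0,0,-1,1,-1],
        [[0,0,0,0,0,1,0,0], [0,0,0,0,-1,0,0,0], [0,0,0,-1,0,0,0,0], [0,0,0,0,0,0,1,0],
        [0,1,0,0,-1,-1,0,0], [0,0,0,0,0,0,0,1], [1,0,0,-1,0,0,0,0], [0,0,-1,-1,0,1,1,0]])]"])
    code_simp

lemma extensible_E7_1: "extensible (E7_matrices ! 1) (forms 8)"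
  by (rule extensibleI[where n = 7
      and g = "[[1,-1,0,0,0,1,-1], [-1,1,1,0,-1,-1,0], [0,1,2,1,0,-1,-1], [0,0,-1,-1,0,0,0],
        [0,1,0,0,-1,0,0], [-1,1,1,0,0,-1,0], [1,0,1,0,0,0,-1]]"
      and Zs = "[[(1,[0,0,2,1,0,-1,-1]), (1,[0,2,2,1,-1,-2,-1]), (1,[0,0,1,0,0,-1,-1]),
        (1,[0,0,1,0,0,0,-1]), (1,[0,0,1,1,0,-1,-1]), (1,[0,0,1,1,0,0,-1]), (1,[0,1,1,0,-1,-1,-1]),
        (1,[0,1,1,0,0,-1,-1]), (1,[0,1,1,1,-1,-1,-1]), (1,[0,1,1,1,0,-1,-1]),
        (1,[0,1,2,1,-1,-2,-1]), (1,[0,1,2,1,-1,-1,-1]), (1,[0,1,2,1,0,-2,-1]),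
        (1,[0,1,2,1,0,-1,-1]), (1,[1,-2,-3,-2,1,3,1]), (1,[1,-2,-3,-1,1,3,1]),
        (1,[1,-2,-2,-1,1,2,1]), (1,[1,-2,-2,-1,1,3,1]), (1,[1,-1,-2,-1,0,2,1]),
        (1,[1,-1,-2,-1,1,2,1]), (1,[1,-1,0,0,0,1,-1]), (1,[1,-1,0,0,1,1,-1]),
        (1,[1,0,0,0,0,0,-1]), (1,[1,0,0,0,0,1,-1]), (1,[1,0,1,0,0,0,-1]), (1,[1,0,1,1,0,0,-1])],
        [(1,[2,-2,-2,-1,1,3]), (1,[1,-2,-2,-1,1,3]), (1,[0,0,1,0,0,-1]), (1,[0,0,1,1,0,-1]),
        (1,[0,1,0,0,-1,-1]), (1,[0,1,0,0,0,-1]), (1,[0,1,1,0,-1,-1]), (1,[0,1,1,0,0,-1]),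
        (1,[0,1,1,1,-1,-1]), (1,[0,1,1,1,0,-1]), (1,[1,-2,-2,-1,1,2]), (1,[1,-2,-1,-1,1,2]),
        (1,[1,-2,-1,0,1,2]), (1,[1,-1,-2,-1,0,2]), (1,[1,-1,-2,-1,1,2]), (1,[1,-1,-1,-1,0,1]),
        (1,[1,-1,-1,-1,0,2]), (1,[1,-1,-1,-1,1,1]), (1,[1,-1,-1,-1,1,2]), (1,[1,-1,-1,0,0,1]),
        (1,[1,-1,-1,0,0,2]), (1,[1,-1,-1,0,1,1]), (1,[1,-1,-1,0,1,2]), (1,[1,-1,0,0,0,1]),
        (1,[1,-1,0,0,1,1]), (1,[1,0,-1,-1,0,1]), (1,[1,0,-1,0,0,1]), (1,[1,0,0,0,0,1])],
        [(1,[0,1,0,0,-1])], [(1,[0,0,1,1])], [], [], []]"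
      and tab = "[([0,0,0,0,-1,0,0], [[0,0,0,1,0,0,0,0], [0,0,0,0,1,0,0,1], [0,0,0,0,0,1,0,0],
        [0,0,0,0,0,0,1,0], [-1,0,0,0,0,-1,1,0], [0,0,0,0,1,0,0,0], [0,-1,0,0,1,1,0,1],
        [0,0,-1,-1,0,1,1,0]]), ([0,0,0,0,0,0,-1], [[0,0,0,1,0,0,0,0], [0,0,0,0,1,0,0,0],
        [0,0,0,0,0,1,0,0], [0,0,0,0,0,0,1,1], [-1,0,0,0,0,-1,1,1], [0,-1,0,0,1,1,0,0],
        [0,0,-1,-1,0,1,1,1], [0,0,0,0,0,0,1,0]]), ([-1,0,0,0,1,0,0], [[0,0,0,0,0,1,0,0],
        [-1,0,-1,0,0,0,1,-1], [-1,0,-1,-1,1,0,1,-1], [-1,-1,0,0,1,0,1,-1], [1,0,0,0,0,1,-1,0],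
        [-1,0,0,0,0,-1,0,-1], [-1,0,-1,0,1,0,1,-1], [-1,-1,-1,-1,1,1,1,-1]]), ([0,0,0,-1,0,0,-1],
        [[0,0,1,0,0,0,0,0], [0,0,0,0,0,0,0,1], [0,1,0,0,0,0,0,0], [-1,0,0,0,0,0,0,0],
        [0,0,0,1,0,0,0,1], [0,0,0,0,0,0,1,1], [0,0,0,0,1,0,0,0], [0,0,0,0,0,1,0,0]])]"])
    code_simp

lemma extensible_E7_2: "extensible (E7_matrices ! 2) (forms 8)"
  by (rule extensibleI[where n = 12
      and g = "[[0,-1,-1,0,0,1,0], [-1,2,0,1,-1,-1,0], [-1,0,2,-1,0,-1,-1], [0,-1,1,-1,0,0,0],
        [0,1,0,0,-1,0,0], [-1,1,1,0,0,-1,0], [0,0,1,0,0,0,-1]]"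
      and Zs = "[[(1,[0,0,2,-1,0,-1,-1]), (1,[2,-2,-2,0,1,3,1]), (1,[0,0,1,-1,0,-1,-1]),
        (1,[0,0,1,-1,0,0,-1]), (1,[0,0,1,0,0,-1,-1]), (1,[0,0,1,0,0,0,-1]), (1,[0,1,-1,1,-1,0,1]),
        (1,[0,1,-1,1,0,0,1]), (1,[0,1,1,0,-1,-1,-1]), (1,[0,1,1,0,0,-1,-1]),
        (1,[1,-2,-2,0,1,2,1]), (1,[1,-2,-2,0,1,3,1]), (1,[1,-2,-1,-1,1,2,1]),
        (1,[1,-2,-1,0,1,2,1]), (1,[1,-1,-2,0,0,2,1]), (1,[1,-1,-2,0,1,2,1]),
        (1,[1,-1,-2,1,0,2,1]), (1,[1,-1,-2,1,1,2,1]), (1,[1,-1,-1,0,0,1,1]),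
        (1,[1,-1,-1,0,0,2,1]), (1,[1,-1,-1,0,1,1,1]), (1,[1,-1,-1,0,1,2,1]), (1,[1,0,-2,1,0,1,1]),
        (1,[1,0,-2,1,0,2,1]), (1,[1,0,-1,0,0,1,1]), (1,[1,0,-1,1,0,1,1])], [(1,[1,-2,-1,-1,1,2]),
        (1,[1,-2,-1,0,1,2]), (1,[1,0,0,0,0,1]), (1,[0,0,1,-1,0,-1]), (1,[0,0,1,0,0,-1]),
        (1,[0,1,0,0,-1,-1]), (1,[0,1,0,0,0,-1]), (1,[0,1,0,1,-1,-1]), (1,[0,1,0,1,0,-1]),
        (1,[0,1,1,0,-1,-1]), (1,[0,1,1,0,0,-1]), (1,[0,2,0,1,-1,-1]), (1,[1,-2,0,-1,1,1]),
        (1,[1,-2,0,-1,1,2]), (1,[1,-1,-1,0,0,1]), (1,[1,-1,-1,0,0,2]), (1,[1,-1,-1,0,1,1]),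
        (1,[1,-1,-1,0,1,2]), (1,[1,-1,0,-1,0,1]), (1,[1,-1,0,-1,1,1]), (1,[1,-1,0,0,0,1]),
        (1,[1,-1,0,0,1,1]), (1,[1,0,-1,0,0,1]), (1,[1,0,-1,1,0,1])], [(1,[0,1,-1,1,-1]),
        (1,[0,1,0,0,-1]), (1,[0,1,0,1,-1])], [(1,[0,1,-1,1]), (1,[0,0,1,-1]), (1,[0,1,0,1])], [],
        [], []]"
      and tab = "[([0,0,0,-1,0,0,0], [[0,1,0,1,0,0,0,0], [-1,0,0,0,0,0,0,0], [0,0,-1,1,0,0,0,0],
        [0,2,-2,2,-1,0,1,1], [0,0,0,0,0,1,0,0], [0,-1,1,-1,0,0,0,-1], [0,1,-1,1,-1,0,0,0],
        [0,1,-1,1,0,0,1,0]]), ([0,0,0,0,-1,0,0], [[1,0,0,0,0,0,0,0], [0,0,0,0,0,0,0,1],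
        [0,1,0,0,0,0,0,0], [0,0,1,0,0,0,0,0], [0,0,0,1,0,0,0,0], [0,0,0,0,1,0,0,1],
        [0,0,0,0,0,1,0,0], [0,0,0,0,0,0,1,0]]), ([-1,0,0,0,0,0,1], [[0,0,0,0,0,1,0,0],
        [0,1,-1,1,-1,0,0,0], [0,1,-1,1,0,0,1,0], [-1,0,-1,0,0,0,1,-1], [1,0,0,0,0,1,0,0],
        [0,1,0,0,-1,-1,0,0], [0,1,-1,1,0,0,0,0], [0,0,-1,0,0,1,1,0]]), ([0,0,0,-1,-1,0,1],
        [[0,1,0,0,0,0,0,0], [-1,0,0,0,0,0,0,0], [0,0,1,0,0,0,0,0], [0,0,0,0,0,0,0,1],
        [0,0,0,0,0,1,0,0], [0,0,0,0,0,0,-1,1], [0,0,0,1,0,0,0,1], [0,0,0,0,1,0,0,1]])]"])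
    code_simp

lemma extensible_E7_3: "extensible (E7_matrices ! 3) (forms 8)"
  by (rule extensibleI[where n = 15
      and g = "[[1,0,-1,1,-1,0,0], [0,2,0,-1,-1,0,-1], [-1,0,2,0,1,-1,-1], [-1,1,0,-1,0,0,0],
        [1,1,-1,0,-1,0,0], [0,0,1,0,0,-1,0], [0,1,1,0,0,0,-1]]"
      and Zs = "[[(1,[1,-1,-2,1,-1,1,2]), (1,[0,0,1,0,0,-1,-1]), (1,[0,0,1,0,0,0,-1]),
        (1,[0,0,1,0,1,-1,-1]), (1,[0,0,1,0,1,0,-1]), (1,[0,0,2,0,1,-1,-1]),
        (1,[0,1,0,-1,-1,0,-1]), (1,[0,1,0,-1,0,0,-1]), (1,[0,1,0,0,-1,0,-1]),
        (1,[0,1,0,0,0,0,-1]), (1,[0,1,1,-1,0,-1,-1]), (1,[0,1,1,-1,0,0,-1]),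
        (1,[0,1,1,0,0,-1,-1]), (1,[0,1,1,0,0,0,-1]), (1,[0,2,0,-1,-1,0,-1]),
        (1,[1,-1,-2,1,-1,1,1]), (1,[1,-1,-1,1,-1,0,1]), (1,[1,-1,-1,1,-1,1,1]),
        (1,[1,-1,-1,1,0,0,1]), (1,[1,-1,-1,1,0,1,1]), (1,[1,-1,0,1,0,0,1]), (1,[1,0,-2,0,-2,1,1]),
        (1,[1,0,-2,0,-1,1,1]), (1,[1,0,-2,1,-2,1,1]), (1,[1,0,-2,1,-1,1,1]),
        (1,[1,0,-1,0,-1,0,1]), (1,[1,0,-1,0,-1,1,1]), (1,[1,0,-1,1,-1,0,1]),
        (1,[1,0,-1,1,-1,1,1]), (1,[1,1,-2,0,-2,1,1]), (1,[1,1,0,0,-1,0,-1]),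
        (1,[2,0,-2,1,-2,1,1])], [(1,[1,1,-2,0,-2,1]), (1,[0,0,1,0,0,-1]), (1,[0,0,1,0,1,-1]),
        (1,[0,1,-1,-1,-1,1]), (1,[0,1,-1,0,-1,1]), (1,[1,0,-1,0,-1,1]), (1,[1,0,-1,1,-1,1]),
        (1,[1,1,-1,0,-2,1]), (1,[1,1,-1,0,-1,1])], [(1,[1,1,-1,0,-2]), (1,[0,0,1,0,1]),
        (1,[0,1,-1,-1,-1]), (1,[0,1,-1,0,-1]), (1,[0,1,0,-1,-1]), (1,[0,1,0,0,-1]),
        (1,[1,0,-1,0,-1]), (1,[1,0,-1,1,-1]), (1,[1,0,0,0,-1]), (1,[1,0,0,1,-1]),
        (1,[1,1,-1,0,-1]), (1,[1,1,0,0,-1])], [(1,[1,-1,0,1]), (1,[0,1,0,-1]), (1,[1,0,0,1])], [],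
        [], []]"
      and tab = "[([0,0,0,-1,0,0,0], [[0,1,0,0,-1,0,0,0], [0,-1,1,1,1,-1,0,0], [0,-1,1,1,1,0,0,1],
        [-1,-1,0,0,1,0,1,0], [1,1,0,0,-1,0,0,0], [0,-1,1,0,1,-1,0,0], [0,-1,1,1,1,0,0,0],
        [0,-1,0,1,0,0,1,1]]), ([0,0,0,0,0,-1,0], [[0,0,0,0,1,0,0,0], [0,0,0,1,0,0,0,0],
        [0,0,0,0,0,-1,0,-1], [0,0,0,0,0,0,-1,0], [1,0,0,1,-1,0,0,0], [0,-1,0,1,1,0,1,0],
        [0,0,0,0,0,-1,0,0], [0,0,1,0,1,-1,-1,-1]]), ([-1,0,0,0,0,1,0], [[1,0,0,0,0,0,0,0],
        [0,0,0,0,0,-1,0,0], [0,0,1,0,1,-1,-1,1], [0,-1,0,0,0,0,0,0], [0,0,1,0,1,-1,-1,0],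
        [0,0,-1,0,-1,1,0,-1], [0,0,1,0,0,-1,-1,1], [0,0,0,-1,0,0,0,0]]), ([0,0,0,0,0,-1,1],
        [[0,1,0,0,0,0,0,0], [1,0,0,0,0,0,0,0], [0,0,1,0,0,0,0,0], [0,0,0,0,0,0,0,-1],
        [0,0,0,-1,0,0,0,0], [0,0,0,0,1,0,0,0], [0,0,0,0,0,-1,0,-1], [0,0,0,0,0,0,1,-1]])]"])
    code_simp

lemma extensible_E7_4: "extensible (E7_matrices ! 4) (forms 8)"
  by (rule extensibleI[where n = 3
      and g = "[[2,0,0,1,1,0,-1], [0,2,0,-1,1,-1,0], [0,0,2,0,-1,-1,-1], [-1,1,0,-1,0,0,0],
        [-1,-1,1,0,-1,0,0], [0,1,1,0,0,-1,0], [1,0,1,0,0,0,-1]]"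
      and Zs = "[[(1,[0,0,2,0,-1,-1,-1]), (1,[2,0,0,1,1,0,-1]), (1,[0,0,1,0,-1,-1,-1]),
        (1,[0,0,1,0,-1,0,-1]), (1,[0,0,1,0,0,-1,-1]), (1,[0,0,1,0,0,0,-1]), (1,[0,1,-1,-1,1,0,1]),
        (1,[0,1,-1,0,1,0,1]), (1,[0,1,1,-1,0,-1,-1]), (1,[0,1,1,0,0,-1,-1]),
        (1,[1,-1,0,1,0,0,-1]), (1,[1,-1,0,1,0,1,-1]), (1,[1,-1,1,1,-1,0,-1]),
        (1,[1,-1,1,1,0,0,-1]), (1,[1,0,0,0,0,0,-1]), (1,[1,0,0,0,1,0,-1]), (1,[1,0,0,1,0,0,-1]),
        (1,[1,0,0,1,1,0,-1]), (1,[1,0,1,0,0,-1,-1]), (1,[1,0,1,0,0,0,-1]), (1,[1,0,1,1,0,-1,-1]),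
        (1,[1,0,1,1,0,0,-1]), (1,[1,1,0,0,1,-1,-1]), (1,[1,1,0,0,1,0,-1]), (1,[1,1,1,0,0,-1,-1]),
        (1,[1,1,1,0,1,-1,-1])], [(1,[0,1,1,-1,0,-1]), (1,[0,1,0,0,0,-1]), (1,[1,-1,-1,1,0,1]),
        (1,[0,0,1,0,-1,-1]), (1,[0,0,1,0,0,-1]), (1,[0,1,0,-1,0,-1]), (1,[0,1,0,-1,1,-1]),
        (1,[0,1,0,0,1,-1]), (1,[0,1,1,0,0,-1]), (1,[0,2,0,-1,1,-1]), (1,[1,-1,-1,1,1,1]),
        (1,[1,-1,0,1,0,1]), (1,[1,0,-1,0,1,1]), (1,[1,0,-1,1,1,1]), (1,[1,1,0,0,1,-1])],
        [(1,[1,1,-1,0,2]), (1,[0,0,1,0,-1]), (1,[0,1,-1,-1,1]), (1,[0,1,-1,0,1]),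
        (1,[0,1,0,-1,1]), (1,[0,1,0,0,1]), (1,[1,0,-1,0,1]), (1,[1,0,-1,1,1]), (1,[1,0,0,0,1]),
        (1,[1,0,0,1,1]), (1,[1,1,-1,0,1]), (1,[1,1,0,0,1])], [(1,[1,-1,0,1]), (1,[0,1,0,-1]),
        (1,[1,0,0,1])], [], [], []]"
      and tab = "[([0,0,0,-1,0,0,0], [[1,0,0,0,0,0,0,0], [0,0,0,0,0,0,0,-1], [0,-1,0,0,0,0,0,0],
        [0,0,1,0,0,0,0,0], [0,0,0,-1,0,0,0,-1], [0,0,0,0,0,1,0,0], [0,0,0,0,1,0,0,0],
        [0,0,0,0,0,0,1,0]]), ([0,0,0,0,0,-1,0], [[0,1,0,0,0,0,0,0], [0,0,0,0,0,0,0,1],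
        [0,0,1,0,0,0,0,0], [-1,0,0,0,0,0,0,0], [0,0,0,0,0,1,0,1], [0,0,0,0,0,0,-1,0],
        [0,0,0,0,1,0,0,0], [0,0,0,1,0,0,0,0]]), ([0,0,0,0,0,0,-1], [[1,0,0,0,0,0,0,0],
        [0,0,0,0,0,0,0,1], [0,0,1,0,0,0,0,0], [0,-1,0,0,0,0,0,0], [0,0,0,0,0,0,1,1],
        [0,0,0,0,0,-1,0,0], [0,0,0,0,1,0,0,0], [0,0,0,-1,0,0,0,0]]), ([-1,0,0,0,0,0,-1],
        [[1,0,0,0,0,0,0,0], [0,0,-1,0,0,0,1,1], [0,0,-2,0,1,1,1,0], [0,-1,0,0,0,0,0,0],
        [0,0,-1,0,0,0,1,0], [0,0,1,0,0,-1,0,0], [0,0,-1,0,1,0,0,0], [0,0,0,-1,0,0,0,0]]),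
        ([-1,0,0,1,0,0,0], [[1,0,0,0,0,0,0,0], [0,1,0,-1,0,0,0,1], [0,2,0,-1,1,-1,0,0],
        [0,0,1,0,0,0,0,0], [0,1,0,-1,0,0,0,0], [0,-1,0,0,0,1,0,0], [0,1,0,0,1,0,0,0],
        [0,0,0,0,0,0,1,0]]), ([0,-1,0,-1,0,0,0], [[1,0,0,0,0,0,0,0], [0,0,0,0,0,0,0,-1],
        [0,-1,0,1,-1,1,0,0], [0,0,1,0,0,0,0,0], [0,-1,0,0,-1,1,0,-1], [0,1,0,-1,1,0,0,0],
        [0,-1,0,1,0,1,0,0], [0,0,0,0,0,0,1,0]]), ([0,-1,0,0,0,-1,0], [[0,1,0,0,0,0,0,0],
        [0,0,-1,0,0,1,0,1], [0,0,-2,0,1,1,1,0], [-1,0,0,0,0,0,0,0], [0,0,-1,0,0,1,0,0],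
        [0,0,1,0,0,0,-1,0], [0,0,-1,0,1,0,0,0], [0,0,0,1,0,0,0,0]]), ([0,0,-1,0,0,-1,0],
        [[0,1,0,0,0,0,0,0], [0,0,0,0,0,0,0,1], [0,0,1,0,-1,-1,-1,0], [-1,0,0,0,0,0,0,0],
        [0,0,1,0,-1,0,-1,1], [0,0,-1,0,1,1,0,0], [0,0,1,0,0,-1,-1,0], [0,0,0,1,0,0,0,0]]),
        ([0,0,-1,0,0,0,-1], [[1,0,0,0,0,0,0,0], [0,0,0,0,0,0,0,1], [0,0,1,0,-1,-1,-1,0],
        [0,-1,0,0,0,0,0,0], [0,0,1,0,-1,-1,0,1], [0,0,-1,0,1,0,1,0], [0,0,1,0,0,-1,-1,0],
        [0,0,0,-1,0,0,0,0]]), ([0,0,0,-1,0,1,-1], [[1,0,0,0,0,0,0,0], [0,1,0,0,0,0,0,0],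
        [0,0,0,0,0,0,0,1], [0,0,1,0,0,0,0,0], [0,0,0,0,1,0,0,0], [0,0,0,1,0,0,0,1],
        [0,0,0,0,0,0,1,1], [0,0,0,0,0,1,0,-1]])]"])
    code_simp

text \<open>Inverses of \<open>M + M^T\<close> for the matrices of \<open>E8_matrices\<close>, in
  the same order; they are integral because the E8 lattice is unimodular.\<close>

definition E8_inverses :: "int list list list" where
  "E8_inverses =
    [[[8,6,12,10,5,-3,-9,-15], [6,6,10,8,4,-3,-8,-12], [12,10,20,16,8,-5,-15,-24],
      [10,8,16,14,7,-4,-12,-20], [5,4,8,7,4,-2,-6,-10], [-3,-3,-5,-4,-2,2,4,6],
      [-9,-8,-15,-12,-6,4,12,18], [-15,-12,-24,-20,-10,6,18,30]],
     [[4,-4,-8,-2,-3,2,6,7], [-4,6,10,2,4,-3,-8,-8], [-8,10,20,4,8,-5,-15,-16],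
      [-2,2,4,2,1,-1,-3,-4], [-3,4,8,1,4,-2,-6,-6], [2,-3,-5,-1,-2,2,4,4],
      [6,-8,-15,-3,-6,4,12,12], [7,-8,-16,-4,-6,4,12,14]],
     [[4,-2,-6,-4,-1,4,7,2], [-2,2,4,2,1,-3,-4,-1], [-6,4,12,6,3,-8,-12,-3],
      [-4,2,6,6,0,-4,-8,-3], [-1,1,3,0,2,-2,-2,0], [4,-3,-8,-4,-2,6,8,2], [7,-4,-12,-8,-2,8,14,4],
      [2,-1,-3,-3,0,2,4,2]],
     [[8,-2,6,4,5,-1,-3,-9], [-2,2,-2,-2,-2,-1,1,3], [6,-2,6,4,4,0,-3,-8], [4,-2,4,4,3,1,-2,-6],
      [5,-2,4,3,4,0,-2,-6], [-1,-1,0,1,0,2,0,0], [-3,1,-3,-2,-2,0,2,4], [-9,3,-8,-6,-6,0,4,12]],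
     [[8,-2,4,2,-3,5,-1,-7], [-2,2,0,0,1,-2,-1,1], [4,0,4,2,-1,2,-2,-5], [2,0,2,2,0,1,-1,-3],
      [-3,1,-1,0,2,-2,0,2], [5,-2,2,1,-2,4,0,-4], [-1,-1,-2,-1,0,0,2,2], [-7,1,-5,-3,2,-4,2,8]],
     [[4,2,-2,2,-4,1,0,-3], [2,2,-2,0,-3,0,1,-1], [-2,-2,4,2,4,1,-3,0], [2,0,2,6,0,3,-4,-4],
      [-4,-3,4,0,6,0,-2,2], [1,0,1,3,0,2,-2,-2], [0,1,-3,-4,-2,-2,4,2], [-3,-1,0,-4,2,-2,2,4]],
     [[4,0,0,2,2,-2,-1,-3], [0,2,-2,0,-1,-2,-1,1], [0,-2,4,0,1,3,2,-2], [2,0,0,2,1,-1,-1,-2],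
      [2,-1,1,1,2,0,0,-2], [-2,-2,3,-1,0,4,2,0], [-1,-1,2,-1,0,2,2,0], [-3,1,-2,-2,-2,0,0,4]],
     [[4,2,2,0,-4,1,1,-2], [2,2,2,0,-3,1,0,-1], [2,2,4,0,-4,2,-1,-1], [0,0,0,2,0,-1,-1,-1],
      [-4,-3,-4,0,6,-2,0,2], [1,1,2,-1,-2,2,0,0], [1,0,-1,-1,0,0,2,0], [-2,-1,-1,-1,2,0,0,2]],
     [[2,0,0,0,1,1,-1,0], [0,2,0,0,1,-1,0,-1], [0,0,2,0,0,-1,-1,1], [0,0,0,2,-1,0,-1,-1],
      [1,1,0,-1,2,0,0,0], [1,-1,-1,0,0,2,0,0], [-1,0,-1,-1,0,0,2,0], [0,-1,1,-1,0,0,0,2]]]"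

lemma forms_extensible:
  assumes "1 \<le> k" "k \<le> 7" "M \<in> set (forms k)"
  shows "extensible M (forms (Suc k))"
proof -
  have E6: "M \<in> {E6_matrices ! 0, E6_matrices ! 1, E6_matrices ! 2}" if "M \<in> set E6_matrices"
    using that by (simp add: E6_matrices_def)
  have E7: "M \<in> {E7_matrices ! 0, E7_matrices ! 1, E7_matrices ! 2, E7_matrices ! 3, E7_matrices ! 4}"
    if "M \<in> set E7_matrices"
    using that by (simp add: E7_matrices_def)
  have upt: "[0..<2] = [0, 1]" "[0..<3] = [0, 1, 2]" by code_simp+
  consider "k = 1" | "k = 2" | "k = 3" | "k = 4" | "k = 5" | "k = 6" | "k = 7"
    using assms(1,2) by linarith
  then show ?thesis
  proof cases
    case 1
    then have "M = A_matrix 1" using assms(3) by (simp add: forms_def)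
    then show ?thesis using 1 extensible_A1 by (simp add: numeral_2_eq_2)
  next
    case 2
    then have "M = A_matrix 2" using assms(3) by (simp add: forms_def)
    then show ?thesis using 2 extensible_A2 by simp
  next
    case 3
    then have "M = A_matrix 3" using assms(3) by (simp add: forms_def)
    then show ?thesis using 3 extensible_A3 by simp
  next
    case 4
    then have "M \<in> {A_matrix 4, D_matrix 4 0, D_matrix 4 1}"
      using assms(3) by (simp add: forms_def upt)
    then show ?thesis using 4 extensible_A4 extensible_D4_0 extensible_D4_1 by auto
  next
    case 5
    then have "M \<in> {A_matrix 5, D_matrix 5 0, D_matrix 5 1}"
      using assms(3) by (simp add: forms_def upt)
    then show ?thesis using 5 extensible_A5 extensible_D5_0 extensible_D5_1 by auto
  next
    case 6
    then have "M \<in> {A_matrix 6, D_matrix 6 0, D_matrix 6 1, D_matrix 6 2} \<union> set E6_matrices"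
      using assms(3) by (simp add: forms_def upt)
    then show ?thesis
      using 6 extensible_A6 extensible_D6_0 extensible_D6_1 extensible_D6_2
        extensible_E6_0 extensible_E6_1 extensible_E6_2 E6 by auto
  next
    case 7
    then have "M \<in> {A_matrix 7, D_matrix 7 0, D_matrix 7 1, D_matrix 7 2} \<union> set E7_matrices"
      using assms(3) by (simp add: forms_def upt)
    then show ?thesis
      using 7 extensible_A7 extensible_D7_0 extensible_D7_1 extensible_D7_2 extensible_E7_0
        extensible_E7_1 extensible_E7_2 extensible_E7_3 extensible_E7_4 E7 by auto
  qed
qed

definition unitriangular :: "int list list \<Rightarrow> bool" where
  "unitriangular M \<longleftrightarrow>
     list_all (\<lambda>i. M ! i ! i = 1 \<and> list_all (\<lambda>j. M ! i ! j = 0) [0..<i]) [0..<length M]"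

lemma forms_unitriangular: "1 \<le> k \<Longrightarrow> k \<le> 8 \<Longrightarrow> M \<in> set (forms k) \<Longrightarrow> unitriangular M \<and> length M = k"
proof -
  have "list_all (\<lambda>k. list_all (\<lambda>M. unitriangular M \<and> length M = k) (forms k)) [1..<9]"
    by code_simp
  then show "1 \<le> k \<Longrightarrow> k \<le> 8 \<Longrightarrow> M \<in> set (forms k) \<Longrightarrow> unitriangular M \<and> length M = k"
    by (auto simp: list_all_iff)
qed

definition bipartite_matrix :: "nat \<Rightarrow> int list list \<Rightarrow> bool" where
  "bipartite_matrix a M \<longleftrightarrow> list_all (\<lambda>i. list_all (\<lambda>j.
     i < a \<and> a \<le> j \<or> M ! i ! j = (if i = j then 1 else 0)) [0..<length M]) [0..<length M]"

lemma E_bipartite: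
  "M \<in> set (if k = 6 then E6_matrices else if k = 7 then E7_matrices else if k = 8 then E8_matrices else []) \<Longrightarrow>
    bipartite_matrix (k div 2) M \<and> length M = k"
proof -
  have "list_all (\<lambda>M. bipartite_matrix 3 M \<and> length M = 6) E6_matrices"
    "list_all (\<lambda>M. bipartite_matrix 3 M \<and> length M = 7) E7_matrices"
    "list_all (\<lambda>M. bipartite_matrix 4 M \<and> length M = 8) E8_matrices"
    by code_simp+
  then show "M \<in> set (if k = 6 then E6_matrices else if k = 7 then E7_matrices else if k = 8 then E8_matrices else []) \<Longrightarrow>
    bipartite_matrix (k div 2) M \<and> length M = k"
    by (auto simp: list_all_iff split: if_splits)
qed

text \<open>This says \<open>N (M + M^T) = 1\<close>, so the rows of \<open>N\<close> are the dual
  basis in lattice coordinates.\<close>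

definition gram_inverse :: "int list list \<Rightarrow> int list list \<Rightarrow> bool" where
  "gram_inverse M N \<longleftrightarrow> length N = length M \<and> list_all (\<lambda>i. list_all (\<lambda>j.
     dot (M ! j) (N ! i) + dot (N ! i) (map (\<lambda>r. r ! j) M) = (if i = j then 1 else 0))
     [0..<length M]) [0..<length M]"

lemma E8_unimodular:
  assumes "M \<in> set E8_matrices"
  shows "\<exists>N. gram_inverse M N"
proof -
  have "list_all2 gram_inverse E8_matrices E8_inverses" by code_simp
  then show ?thesis using assms by (metis in_set_conv_nth list_all2_conv_all_nth)
qed

section \<open>From tabulated matrices back to lattices\<close>

context integral_form
begin

lemma S_matrix_nth: "i < length xs \<Longrightarrow> j < length xs \<Longrightarrow> S_matrix xs ! i ! j = S (xs ! i) (xs ! j)"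
  by (simp add: S_matrix_def)

lemma length_S_matrix [simp]: "length (S_matrix xs) = length xs"
  by (simp add: S_matrix_def)

lemma unitriangular_exceptional:
  assumes "unitriangular (S_matrix xs)"
  shows "exceptional xs"
  using assms
  by (auto simp: unitriangular_def list_all_iff S_matrix_nth exceptional_def sorted_wrt_iff_nth_less
      in_set_conv_nth)

lemma A_matrix_chain:
  assumes "S_matrix xs = A_matrix k" "set xs \<subseteq> L"
  shows "chain k (nth xs) L"
proof -
  have k: "length xs = k" using arg_cong[OF assms(1), of length] by (simp add: A_matrix_def)
  have "S (xs ! i) (xs ! j) = (if i = j then 1 else if j = Suc i then - 1 else 0)"
    if "i < k" "j < k" for i j
    using that by (subst S_matrix_nth[symmetric]) (simp_all add: k assms(1) A_matrix_def)
  then show ?thesis using assms(2) k unfolding chain_def by auto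
qed

lemma S_partial_sum_telescope:
  assumes "\<And>i. i < k \<Longrightarrow> S (s i) \<beta> = h i - h (Suc i)" "i \<le> k"
  shows "S (partial_sum s k i) \<beta> = h i - h k"
  using assms(2) by (induction i rule: inc_induct) (simp_all add: partial_sum_rec bilin assms(1))

text \<open>The last vector of \<open>xs\<close> acts as the root \<open>e_v + e_k\<close> over the
  chain formed by the others, so \<open>chain_insert_edge\<close> applies with the last vertex as
  \<open>w\<close>.\<close>

lemma D_matrix_classical:
  assumes xs: "S_matrix xs = D_matrix (Suc k) v" "set xs \<subseteq> L" and L: "zmod.subspace L" and v: "v < k"
  shows "classical (Suc k) L"
proof -
  define h where "h i = (if i \<in> {v, k} then 1 else 0 :: int)" for i
  have D: "D_matrix (Suc k) v = extend_matrix (A_matrix k) (map (\<lambda>i. h i - h (Suc i)) [0..<k])"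
    by (simp add: D_matrix_def h_def)
  have len: "length xs = Suc k" using arg_cong[OF xs(1), of length]
    by (simp add: D extend_matrix_def A_matrix_def)
  have entry: "S (xs ! i) (xs ! j) = extend_matrix (A_matrix k) (map (\<lambda>i. h i - h (Suc i)) [0..<k]) ! i ! j"
    if "i \<le> k" "j \<le> k" for i j
    using that by (subst S_matrix_nth[symmetric]) (simp_all add: len xs(1) D)
  have A: "S (xs ! i) (xs ! j) = (if i = j then 1 else if j = Suc i then - 1 else 0)"
    if "i < k" "j < k" for i j
    using that by (subst entry) (simp_all add: extend_matrix_def A_matrix_def nth_append)
  let ?\<beta> = "xs ! k"
  let ?K = "zmod.span ((!) xs ` {..<k})"
  have col: "S (xs ! i) ?\<beta> = h i - h (Suc i)" if "i < k" for i
    using that by (subst entry) (simp_all add: extend_matrix_def A_matrix_def nth_append)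
  have row: "S ?\<beta> (xs ! i) = 0" if "i < k" for i
    using that by (subst entry) (simp_all add: extend_matrix_def A_matrix_def nth_append)
  have one: "S ?\<beta> ?\<beta> = 1"
    by (subst entry) (simp_all add: extend_matrix_def A_matrix_def nth_append)
  have "chain k ((!) xs) ?K" using A by (auto simp: chain_def intro: zmod.span_base)
  moreover have "?K \<subseteq> L"
    using xs(2) L len by (intro zmod.span_minimal) auto
  moreover have "\<forall>x\<in>?K. S ?\<beta> x = 0" using vanish_right_on_span[of "(!) xs ` {..<k}"] row by blast
  moreover have "\<forall>i\<le>k. S (partial_sum ((!) xs) k i) ?\<beta> =
      (if i \<in> {v, k} then 1 else 0) - (if k \<in> {v, k} then 1 else 0)"
    using S_partial_sum_telescope[of k "(!) xs" ?\<beta> h] col by (simp add: h_def)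
  moreover have "?\<beta> \<in> L" using xs(2) len by auto
  ultimately have "\<exists>E F. cycle_pair (k - v) (Suc k - (k - v)) E F L"
    using chain_insert_edge[OF _ zmod.subspace_span L _ _ _ one v order_refl] by blast
  then obtain E F where EF: "cycle_pair (k - v) (Suc k - (k - v)) E F L" by blast
  have "0 < k - v" "0 < Suc k - (k - v)" "(k - v) + (Suc k - (k - v)) = Suc k" using v by auto
  then show ?thesis using EF unfolding classical_def by blast
qed

lemma classical_has_bipartite:
  assumes "classical k L" "zmod.subspace L"
  shows "has_bipartite k L"
  using assms chain_has_bipartite cycle_pair_has_bipartite
  unfolding classical_def has_bipartite_def by metis

lemma bipartite_matrix_has_bipartite:
  assumes M: "bipartite_matrix a (S_matrix xs)" and a: "a \<le> length xs" and L: "set xs \<subseteq> L"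
  shows "has_bipartite (length xs) L"
proof -
  have M: "S (xs ! i) (xs ! j) = (if i = j then 1 else 0)"
    if "i < length xs" "j < length xs" "\<not> (i < a \<and> a \<le> j)" for i j
  proof -
    have "\<forall>i\<in>{0..<length xs}. \<forall>j\<in>{0..<length xs}.
        i < a \<and> a \<le> j \<or> S_matrix xs ! i ! j = (if i = j then 1 else 0)"
      using M by (simp add: bipartite_matrix_def list_all_iff)
    from bspec[OF bspec[OF this, of i], of j] show ?thesis using that by (auto simp: S_matrix_nth)
  qed
  have "orthonormal (take a xs)" "orthonormal (drop a xs)"
    using a by (auto simp: orthonormal_def sorted_wrt_iff_nth_less in_set_conv_nth M)
  moreover have "\<forall>x\<in>set (take a xs). \<forall>y\<in>set (drop a xs). S y x = 0"
    using a by (auto simp: in_set_conv_nth M)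
  ultimately have "bipartite_pair (take a xs) (drop a xs)" by (simp add: bipartite_pair_def)
  then show ?thesis
    using a L unfolding has_bipartite_def
    by (intro exI[of _ "take a xs"] exI[of _ "drop a xs"]) simp
qed

lemma forms_cases:
  assumes "1 \<le> k" "k \<le> 8" "S_matrix xs \<in> set (forms k)" "set xs \<subseteq> L" "zmod.subspace L"
  shows "classical k L \<or> S_matrix xs \<in> set (if k = 6 then E6_matrices else if k = 7 then E7_matrices
    else if k = 8 then E8_matrices else [])"
proof -
  consider "S_matrix xs = A_matrix k" | v where "S_matrix xs = D_matrix k v" "v < k div 2" "4 \<le> k"
    | "S_matrix xs \<in> set (if k = 6 then E6_matrices else if k = 7 then E7_matrices
        else if k = 8 then E8_matrices else [])"
    using assms(3) unfolding forms_def by (auto split: if_splits)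
  then show ?thesis
  proof cases
    case 1
    then show ?thesis using A_matrix_chain[OF _ assms(4)] unfolding classical_def by blast
  next
    case 2
    then show ?thesis using D_matrix_classical[of xs "k - 1" v] assms(4,5) by simp
  qed blast
qed

text \<open>Unimodularity makes the orthogonal projection \<open>z\<close> of \<open>\<beta>\<close>
  under the Cartan form a lattice vector, and \<open>S z z + S r r = 1\<close> is a sum of
  nonnegative integers. As \<open>S \<beta> z = 0\<close>, the residue \<open>r\<close> is not 0, so
  \<open>z\<close> vanishes.\<close>

lemma E8_no_extension:
  assumes M: "S_matrix xs \<in> set E8_matrices"
    and \<beta>: "\<forall>x\<in>set xs. S \<beta> x = 0" "S \<beta> \<beta> = 1"
  shows "\<forall>x\<in>set xs. S x \<beta> = 0"
proof -
  obtain N where N: "gram_inverse (S_matrix xs) N" using E8_unimodular[OF M] by blast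
  define y where "y i = combination xs (N ! i)" for i
  have y: "S (xs ! j) (y i) + S (y i) (xs ! j) = (if i = j then 1 else 0)"
    if "i < length xs" "j < length xs" for i j
  proof -
    have "map (\<lambda>r. r ! j) (S_matrix xs) = map (\<lambda>x. S x (xs ! j)) xs"
      using that by (simp add: S_matrix_def)
    moreover have "S_matrix xs ! j = map (S (xs ! j)) xs" using that by (simp add: S_matrix_def)
    moreover have "\<forall>i\<in>{0..<length xs}. \<forall>j\<in>{0..<length xs}.
        dot (S_matrix xs ! j) (N ! i) + dot (N ! i) (map (\<lambda>r. r ! j) (S_matrix xs)) = (if i = j then 1 else 0)"
      using N by (simp add: gram_inverse_def list_all_iff)
    note bspec[OF bspec[OF this, of i], of j]
    ultimately show ?thesis
      using that by (simp add: y_def S_combination_left S_combination_right)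
  qed
  define z where "z = (\<Sum>i<length xs. zscale (S (xs ! i) \<beta>) (y i))"
  define r where "r = \<beta> - z"
  have z: "z \<in> zmod.span (set xs)"
    unfolding z_def y_def by (intro zmod.span_sum zmod.span_scale combination_span)
  have zx: "S (xs ! j) z + S z (xs ! j) = S (xs ! j) \<beta>" if "j < length xs" for j
  proof -
    have "S (xs ! j) z + S z (xs ! j) =
        (\<Sum>i<length xs. S (xs ! i) \<beta> * (S (xs ! j) (y i) + S (y i) (xs ! j)))"
      by (simp add: z_def sum_left sum_right zscale_left zscale_right sum.distrib distrib_left)
    also have "\<dots> = (\<Sum>i<length xs. if i = j then S (xs ! i) \<beta> else 0)"
      using that by (intro sum.cong) (simp_all add: y)
    finally show ?thesis using that by simp
  qed
  have zero: "S x r + S r x = 0" if x: "x \<in> set xs" for x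
  proof -
    obtain j where "j < length xs" "x = xs ! j" using x by (auto simp: in_set_conv_nth)
    then have "S x z + S z x = S x \<beta>" using zx by simp
    then show ?thesis using \<beta>(1) x by (simp add: r_def bilin)
  qed
  have "S w r + S r w = 0" if "w \<in> zmod.span (set xs)" for w
    using that
  proof (induction rule: zmod.span_induct_alt)
    case (step c x w)
    then have "S (zscale c x + w) r + S r (zscale c x + w) = c * (S x r + S r x) + (S w r + S r w)"
      by (simp add: bilin algebra_simps)
    then show ?case using step zero by simp
  qed (simp add: bilin)
  then have "S z r + S r z = 0" using z by blast
  then have norm: "S z z + S r r = 1"
    using \<beta>(2) unfolding r_def by (simp add: bilin algebra_simps)
  have "S \<beta> z = 0" using vanish_right_on_span[OF _ z] \<beta>(1) by blast
  then have "r \<noteq> 0" using \<beta>(2) by (auto simp: r_def)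
  then have "S z z \<le> 0" using pos[of r] norm by linarith
  then have "z = 0" by (rule eq_0_if_nonpos)
  then show ?thesis using zx by (auto simp: in_set_conv_nth bilin)
qed

text \<open>Only containment in \<open>L\<close> is recorded. When \<open>L\<close> is spanned by
  \<open>k\<close> vectors, \<open>exceptional_spans\<close> recovers that the normal form spans it
  too.\<close>

definition has_form :: "nat \<Rightarrow> 'k set \<Rightarrow> bool" where
  "has_form k L \<longleftrightarrow>
     (if k \<le> 8 then \<exists>xs. set xs \<subseteq> L \<and> S_matrix xs \<in> set (forms k) else classical k L)"

section \<open>The induction on the rank\<close>

lemma chain_mono: "chain k s L \<Longrightarrow> L \<subseteq> L' \<Longrightarrow> chain k s L'"
  unfolding chain_def by blast

lemma cycle_pair_mono: "cycle_pair p q E F L \<Longrightarrow> L \<subseteq> L' \<Longrightarrow> cycle_pair p q E F L'"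
  unfolding cycle_pair_def
  by (elim conjE) (intro conjI; (assumption | rule halvable_mono[OF _ order_refl]; assumption))

lemma classical_mono: "classical k L \<Longrightarrow> L \<subseteq> L' \<Longrightarrow> classical k L'"
  unfolding classical_def
  by (elim disjE exE conjE; (drule (1) chain_mono | drule (1) cycle_pair_mono); simp; fast)

lemma has_form_mono: "has_form k L \<Longrightarrow> L \<subseteq> L' \<Longrightarrow> has_form k L'"
  unfolding has_form_def using classical_mono[of k L L'] by (cases "k \<le> 8") auto

lemma has_form_has_bipartite:
  assumes "has_form k L" "zmod.subspace L" "1 \<le> k"
  shows "has_bipartite k L"
proof (cases "k \<le> 8")
  case True
  then obtain xs where xs: "set xs \<subseteq> L" "S_matrix xs \<in> set (forms k)"
    using assms(1) by (auto simp: has_form_def)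
  show ?thesis
    using forms_cases[OF assms(3) True xs(2,1) assms(2)]
  proof
    assume "S_matrix xs \<in> set (if k = 6 then E6_matrices else if k = 7 then E7_matrices
      else if k = 8 then E8_matrices else [])"
    from E_bipartite[OF this] show ?thesis
      using bipartite_matrix_has_bipartite[of "k div 2" xs L] xs(1) by auto
  qed (rule classical_has_bipartite[OF _ assms(2)])
next
  case False
  then show ?thesis using assms classical_has_bipartite by (simp add: has_form_def)
qed

text \<open>Whether the column of \<open>\<beta>\<close> vanishes depends only on the span. This
  carries the connection of \<open>\<beta>\<close> from the given vectors over to their normal
  form.\<close>

lemma exceptional_adjacent:
  assumes "exceptional ys" "set ys \<subseteq> zmod.span X" "finite X" "card X \<le> length ys"
    and "\<exists>x\<in>X. S x \<beta> \<noteq> 0"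
  shows "\<exists>y\<in>set ys. S y \<beta> \<noteq> 0"
proof (rule ccontr)
  assume "\<not> ?thesis"
  then have "\<forall>w\<in>zmod.span (set ys). S w \<beta> = 0"
    using vanish_left_on_span[of "set ys" \<beta>] by blast
  then show False
    using exceptional_spans[OF assms(1-4)] assms(5) zmod.span_base by blast
qed

lemma classical_extend:
  assumes X: "finite X" "card X = k" "8 \<le> k" "classical k (zmod.span X)"
    and \<beta>: "\<forall>x\<in>zmod.span X. S \<beta> x = 0" "S \<beta> \<beta> = 1" "\<exists>x\<in>X. S x \<beta> \<noteq> 0"
  shows "classical (Suc k) (zmod.span (insert \<beta> X))"
proof -
  have L: "zmod.subspace (zmod.span X)" "zmod.subspace (zmod.span (insert \<beta> X))"
    "zmod.span X \<subseteq> zmod.span (insert \<beta> X)" "\<beta> \<in> zmod.span (insert \<beta> X)"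
    by (auto intro: zmod.subspace_span zmod.span_base subsetD[OF zmod.span_mono, rotated])
  from X(4) consider s where "chain k s (zmod.span X)"
    | p q E F where "0 < p" "0 < q" "p + q = k" "cycle_pair p q E F (zmod.span X)"
    unfolding classical_def by blast
  then show ?thesis
  proof cases
    case 1
    have "\<exists>y\<in>set (map s [0..<k]). S y \<beta> \<noteq> 0"
      using 1 X \<beta>(3) by (intro exceptional_adjacent[OF chain_exceptional[OF 1]]) (auto simp: chain_def)
    then have "\<exists>i<k. S (s i) \<beta> \<noteq> 0" by auto
    then show ?thesis using chain_extend[OF 1 L \<beta>(1,2) _ X(3)] by blast
  next
    case 2
    obtain A B where AB: "bipartite_pair A B" "length A + length B = k" "set (A @ B) \<subseteq> zmod.span X"
      "(\<forall>i<p. S (E i) \<beta> = 0) \<longrightarrow> (\<forall>i<q. S (F i) \<beta> = 0) \<longrightarrow> (\<forall>x\<in>set (A @ B). S x \<beta> = 0)"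
      using cycle_pair_has_bipartite[OF 2(4) L(1) 2(1,2)] 2(3) by blast
    have "\<exists>y\<in>set (A @ B). S y \<beta> \<noteq> 0"
      using AB X \<beta>(3) by (intro exceptional_adjacent[OF bipartite_pair_exceptional]) auto
    then have "(\<exists>i<p. S (E i) \<beta> \<noteq> 0) \<or> (\<exists>i<q. S (F i) \<beta> \<noteq> 0)" using AB(4) by blast
    then show ?thesis using cycle_pair_extend[OF 2(4) L \<beta>(1,2) _ 2(1,2)] 2(3) X(3) by simp
  qed
qed

lemma has_form_extend:
  assumes X: "finite X" "card X = k" "1 \<le> k" "has_form k (zmod.span X)"
    and \<beta>: "\<forall>x\<in>zmod.span X. S \<beta> x = 0" "S \<beta> \<beta> = 1" "\<exists>x\<in>X. S x \<beta> \<noteq> 0"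
  shows "has_form (Suc k) (zmod.span (insert \<beta> X))"
proof (cases "k \<le> 8")
  case True
  then obtain xs where xs: "set xs \<subseteq> zmod.span X" "S_matrix xs \<in> set (forms k)"
    using X(4) by (auto simp: has_form_def)
  have exc: "exceptional xs" and len: "length xs = k"
    using forms_unitriangular[OF X(3) True xs(2)] unitriangular_exceptional by auto
  have adj: "\<exists>x\<in>set xs. S x \<beta> \<noteq> 0"
    using exceptional_adjacent[OF exc xs(1) X(1)] X(2) len \<beta>(3) by simp
  have \<beta>xs: "\<forall>x\<in>set xs. S \<beta> x = 0" using xs(1) \<beta>(1) by blast
  show ?thesis
  proof (cases "k = 8")
    case True
    have "S_matrix xs \<notin> set E8_matrices"
      using E8_no_extension[OF _ \<beta>xs \<beta>(2)] adj by blast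
    then have "classical 8 (zmod.span X)"
      using forms_cases[of 8 xs "zmod.span X"] xs True by (simp add: zmod.subspace_span)
    then show ?thesis using classical_extend[OF X(1,2) _ _ \<beta>] True by (simp add: has_form_def)
  next
    case False
    then have k: "k \<le> 7" using True by simp
    obtain Zs g tab n where "extension_check (S_matrix xs) (forms (Suc k)) Zs g tab n"
      using forms_extensible[OF X(3) k xs(2)] unfolding extensible_def by blast
    from extension_check_sound[OF this \<beta>xs \<beta>(2) adj]
    obtain ys where ys: "set ys \<subseteq> zmod.span (insert \<beta> (set xs))" "S_matrix ys \<in> set (forms (Suc k))"
      using exc by (auto simp: exceptional_def)
    have "zmod.span (insert \<beta> (set xs)) \<subseteq> zmod.span (insert \<beta> X)"
      using xs(1) by (intro zmod.span_minimal zmod.subspace_span)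
        (auto intro: zmod.span_base subsetD[OF zmod.span_mono, rotated])
    then show ?thesis using ys k by (auto simp: has_form_def)
  qed
next
  case False
  then show ?thesis using classical_extend[OF X(1,2) _ _ \<beta>] X(4) by (simp add: has_form_def)
qed

text \<open>A subset \<open>X\<close> grows by one connected root at a time. The new root
  \<open>a\<close> may stand anywhere in the ordered list, so it is first mutated past the later
  members of \<open>X\<close>.\<close>

theorem indecomposable_has_bipartite:
  assumes exc: "exceptional bs" and ne: "bs \<noteq> []"
    and ind: "\<And>X. X \<noteq> {} \<Longrightarrow> X \<subset> set bs \<Longrightarrow> \<exists>x\<in>X. \<exists>a\<in>set bs - X. S x a \<noteq> 0 \<or> S a x \<noteq> 0"
  shows "has_bipartite (length bs) (zmod.span (set bs))"
proof -
  have card: "card (set bs) = length bs"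
    using exceptional_distinct[OF exc] by (rule distinct_card)
  have "\<exists>X\<subseteq>set bs. card X = Suc k \<and> has_form (Suc k) (zmod.span X)" if "Suc k \<le> length bs" for k
    using that
  proof (induction k)
    case 0
    obtain a where a: "a \<in> set bs" using ne by (cases bs) auto
    have "S_matrix [a] = A_matrix 1" using exc a by (simp add: S_matrix_def A_matrix_def exceptional_def)
    then have "has_form 1 (zmod.span {a})"
      by (auto simp: has_form_def forms_def zmod.span_base intro!: exI[of _ "[a]"])
    then show ?case using a by (intro exI[of _ "{a}"]) simp
  next
    case (Suc k)
    then obtain X where X: "X \<subseteq> set bs" "card X = Suc k" "has_form (Suc k) (zmod.span X)" by auto
    then have fin: "finite X" using finite_subset by blast
    have "X \<noteq> {}" "X \<noteq> set bs" using X(2) Suc.prems card by auto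
    then obtain x a where xa: "x \<in> X" "a \<in> set bs" "a \<notin> X" "S x a \<noteq> 0 \<or> S a x \<noteq> 0"
      using ind[of X] X(1) by blast
    obtain l1 l2 where l: "bs = l1 @ a # l2" using split_list[OF xa(2)] by blast
    \<comment> \<open>Only the members of \<open>X\<close> after \<open>a\<close> have to be passed:
      for those before it \<open>S a y = 0\<close> holds already, and it persists because
      \<open>d\<close> lies in the span of later ones.\<close>
    define ys where "ys = filter (\<lambda>y. y \<in> X) l2"
    have "exceptional (a # l2)" "\<forall>x\<in>set l1. \<forall>y\<in>set (a # l2). S y x = 0"
      using exc unfolding l by (simp_all add: exceptional_append)
    then have "exceptional (a # ys)" "\<forall>x\<in>set l1. \<forall>y\<in>set (a # ys). S y x = 0"
      unfolding ys_def by (auto simp: exceptional_Cons exceptional_filter)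
    then obtain d where d: "d \<in> zmod.span (set ys)" "\<forall>w\<in>zmod.span (set ys). S (a - d) w = 0"
      "S (a - d) (a - d) = 1"
      using ex_mutation by blast
    define \<beta> where "\<beta> = a - d"
    have dX: "d \<in> zmod.span X"
      using d(1) by (rule subsetD[OF zmod.span_mono, rotated]) (auto simp: ys_def)
    have "S \<beta> y = 0" if "y \<in> X" for y
    proof (cases "y \<in> set l1")
      case True
      then have "S a y = 0" "S d y = 0"
        using \<open>\<forall>x\<in>set l1. \<forall>y\<in>set (a # ys). S y x = 0\<close> vanish_left_on_span[OF _ d(1), of y] by auto
      then show ?thesis by (simp add: \<beta>_def bilin)
    next
      case False
      then have "y \<in> set ys" using that X(1) xa(3) unfolding l ys_def by auto
      then show ?thesis using d(2) by (simp add: \<beta>_def zmod.span_base)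
    qed
    then have \<beta>X: "\<forall>w\<in>zmod.span X. S \<beta> w = 0" using vanish_right_on_span[of X \<beta>] by blast
    \<comment> \<open>The mutation does not disconnect the new root: if \<open>\<beta>\<close> were
      orthogonal to \<open>X\<close> on both sides, then \<open>S a a = 1 + S d d\<close> would
      force \<open>d = 0\<close>, and \<open>a = \<beta>\<close> would not be connected to
      \<open>x\<close>.\<close>
    have "\<exists>y\<in>X. S y \<beta> \<noteq> 0"
    proof (rule ccontr)
      assume "\<not> ?thesis"
      then have X\<beta>: "\<forall>w\<in>zmod.span X. S w \<beta> = 0" using vanish_left_on_span[of X \<beta>] by blast
      have "S a a = 1" using exc xa(2) by (simp add: exceptional_def)
      moreover have "S (\<beta> + d) (\<beta> + d) = 1 + S d d"
        using \<beta>X X\<beta> dX d(3) by (simp add: add_left add_right flip: \<beta>_def)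
      ultimately have "S d d = 0" by (simp add: \<beta>_def)
      then have "a = \<beta>" using eq_0_if_nonpos[of d] by (simp add: \<beta>_def)
      then show False using xa(1,4) \<beta>X X\<beta> by (simp add: zmod.span_base)
    qed
    then have "has_form (Suc (Suc k)) (zmod.span (insert \<beta> X))"
      using has_form_extend[OF fin X(2) _ X(3) \<beta>X] d(3) by (simp add: \<beta>_def)
    moreover have "zmod.span (insert \<beta> X) \<subseteq> zmod.span (insert a X)"
      using dX unfolding \<beta>_def by (intro zmod.span_minimal zmod.subspace_span)
        (auto intro!: zmod.span_diff intro: zmod.span_base subsetD[OF zmod.span_mono, rotated])
    ultimately have "has_form (Suc (Suc k)) (zmod.span (insert a X))" by (rule has_form_mono)
    moreover have "insert a X \<subseteq> set bs" "card (insert a X) = Suc (Suc k)"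
      using X(1,2) xa(2,3) fin by auto
    ultimately show ?case by blast
  qed
  from this[of "length bs - 1"] obtain X where X: "X \<subseteq> set bs" "card X = length bs"
    "has_form (length bs) (zmod.span X)"
    using ne by (auto simp: Suc_le_eq)
  then have "X = set bs" using card by (intro card_subset_eq) auto
  then show ?thesis
    using has_form_has_bipartite[OF _ zmod.subspace_span] X(3) ne by (simp add: Suc_le_eq)
qed

end

section \<open>The Coxeter transformation and the Weyl group\<close>

context generalized_root_system
begin

lemma cartan_add_left: "cartan R (x + y) z = cartan R x z + cartan R y z"
  and cartan_add_right: "cartan R x (y + z) = cartan R x y + cartan R x z"
  and cartan_diff_left: "cartan R (x - y) z = cartan R x z - cartan R y z"
  using additive.add[OF cartan_additive_left] additive.add[OF cartan_additive]
    additive.diff[OF cartan_additive_left] by auto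

lemma cartan_zscale_left: "cartan R (zscale n x) y = n * cartan R x y"
  by (metis cartan_sym cartan_zscale)

lemma reflection_involution:
  assumes "a \<in> re_roots R"
  shows "reflection R a \<circ> reflection R a = id"
proof
  fix x
  have "cartan R (x - zscale (cartan R x a) a) a = - cartan R x a"
    using cartan_re_root[OF assms] by (simp add: cartan_diff_left cartan_zscale_left)
  then show "(reflection R a \<circ> reflection R a) x = id x"
    by (simp add: reflection_def[of R a] zmod.scale_minus_left)
qed

text \<open>Positivity is given on the real extension, so the point is that
  \<open>tensor_one\<close> kills no nonzero vector: the coordinate functions of a lattice basis
  extend to real functionals, which detect \<open>x\<close>.\<close>

lemma cartan_pos:
  assumes "positive_definite R" "x \<noteq> 0"
  shows "0 < cartan R x x"
proof -
  obtain B :: "'k list" where B: "zbasis B" using free_of_rank by blast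
  have ind: "zmod.independent (set B)" and spn: "zmod.span (set B) = UNIV"
    using B by (simp_all add: zbasis_def)
  have "tensor_one x \<noteq> 0"
  proof
    assume 0: "tensor_one x = 0"
    have "zmod.representation (set B) x b = 0" for b
    proof -
      have add: "additive (\<lambda>k. real_of_int (zmod.representation (set B) k b))"
        by standard (simp add: zmod.representation_add[OF ind] spn)
      have "real_of_int (zmod.representation (set B) x b) = 0"
        using linear_extension_tensor_one[OF add, of x] linear_0[OF linear_linear_extension[OF add]] 0
        by simp
      then show ?thesis by simp
    qed
    then have "x = 0"
      using zmod.sum_nonzero_representation_eq[OF ind, of x] spn by simp
    then show False using assms(2) by simp
  qed
  then show ?thesis
    using assms(1) real_form_cartan[of x x] unfolding positive_definite_def by (metis of_int_0_less_iff)
qed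

text \<open>The triangular half \<open>U\<close> of the Gram matrix is extended bilinearly through
  coordinates. Positivity is inherited because \<open>2 * S x x\<close> is the Cartan norm.\<close>

lemma ex_seifert_form:
  assumes pd: "positive_definite R" and B: "zbasis B" and roots: "set B \<subseteq> re_roots R"
  shows "\<exists>S. integral_form S \<and> (\<forall>x y. S x y + S y x = cartan R x y) \<and> integral_form.exceptional S B"
proof -
  have ind: "zmod.independent (set B)" and spn: "zmod.span (set B) = UNIV" and dist: "distinct B"
    using B by (simp_all add: zbasis_def)
  let ?r = "\<lambda>x i. zmod.representation (set B) x (B ! i)"
  let ?n = "length B"
  define U where "U i j = (if i < j then cartan R (B ! i) (B ! j) else if i = j then 1 else 0)" for i j
  define S where "S x y = (\<Sum>i<?n. \<Sum>j<?n. ?r x i * ?r y j * U i j)" for x y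
  have rep_add: "?r (x + y) i = ?r x i + ?r y i" for x y i
    using zmod.representation_add[OF ind] spn by simp
  have Sadd: "S (x + y) z = S x z + S y z" "S x (y + z) = S x y + S x z" for x y z
    by (simp_all add: S_def rep_add algebra_simps sum.distrib)
  have rep_basis: "?r (B ! j) i = (if i = j then 1 else 0)" if "i < ?n" "j < ?n" for i j
    using zmod.representation_basis[OF ind, of "B ! j"] dist that by (auto simp: nth_eq_iff_index_eq)
  have SB: "S (B ! i) (B ! j) = U i j" if "i < ?n" "j < ?n" for i j
  proof -
    have "S (B ! i) (B ! j) = (\<Sum>a<?n. \<Sum>b<?n. if b = j then (if a = i then U a b else 0) else 0)"
      unfolding S_def using that by (intro sum.cong) (auto simp: rep_basis)
    also have "\<dots> = (\<Sum>a<?n. if a = i then U a j else 0)" using that by (intro sum.cong) auto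
    finally show ?thesis using that by simp
  qed
  have Sscale: "S (zscale c x) y = c * S x y" "S y (zscale c x) = c * S y x" for c x y
    using spn by (simp_all add: S_def zmod.representation_scale[OF ind] sum_distrib_left mult_ac)
  have S0: "S 0 y = 0" "S y 0 = 0" for y
    using Sadd(1)[of 0 0 y] Sadd(2)[of y 0 0] by simp_all
  have cartan0: "cartan R 0 y = 0" "cartan R y 0 = 0" for y
    using cartan_add_left[of 0 0 y] cartan_add_right[of y 0 0] by simp_all
  have symB: "S (B ! i) (B ! j) + S (B ! j) (B ! i) = cartan R (B ! i) (B ! j)"
    if "i < ?n" "j < ?n" for i j
    using that cartan_sym roots cartan_re_root by (auto simp: SB U_def subset_iff)
  have sym1: "S b y + S y b = cartan R b y" if b: "b \<in> set B" for b y
  proof -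
    have "y \<in> zmod.span (set B)" using spn by simp
    then show ?thesis
    proof (induction rule: zmod.span_induct_alt)
      case (step c x y)
      have "S b x + S x b = cartan R b x" using symB b step(1) by (metis in_set_conv_nth)
      then have "c * (S b x + S x b) = c * cartan R b x" by simp
      then show ?case
        using step by (simp add: Sadd Sscale cartan_add_right cartan_zscale algebra_simps)
    qed (simp add: S0 cartan0)
  qed
  have sym: "S x y + S y x = cartan R x y" for x y
  proof -
    have "x \<in> zmod.span (set B)" using spn by simp
    then show ?thesis
    proof (induction rule: zmod.span_induct_alt)
      case (step c b x)
      have "c * (S b y + S y b) = c * cartan R b y" using sym1[OF step(1), of y] by simp
      then show ?case
        using step by (simp add: Sadd Sscale cartan_add_left cartan_zscale_left algebra_simps)
    qed (simp add: S0 cartan0)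
  qed
  have "0 < S x x" if "x \<noteq> 0" for x
    using cartan_pos[OF pd that] sym[of x x] by simp
  then interpret integral_form S by unfold_locales (simp_all add: Sadd)
  have "exceptional B"
    by (auto simp: exceptional_def sorted_wrt_iff_nth_less in_set_conv_nth SB U_def)
  then show ?thesis using sym integral_form_axioms by blast
qed

end

section \<open>The Coxeter transformation in terms of \<open>S\<close>\<close>

locale seifert_form = generalized_root_system R \<mu> + integral_form S
  for R :: "('k::ab_group_add) root_data" and \<mu> :: nat and S :: "'k \<Rightarrow> 'k \<Rightarrow> int" +
  assumes symmetrization: "S x y + S y x = cartan R x y"
begin

lemma cartan_self: "cartan R x x = 2 * S x x"
  using symmetrization[of x x] by simp

lemma reflection_prod_Cons: "reflection_prod R (x # xs) z = reflection R x (reflection_prod R xs z)"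
  by (simp add: reflection_prod_def)

lemma reflection_prod_append: "reflection_prod R (xs @ ys) = reflection_prod R xs \<circ> reflection_prod R ys"
  by (induction xs) (auto simp: reflection_prod_def fun_eq_iff)

text \<open>The displacement \<open>d\<close> solves a triangular system. A further reflection in
  front changes it by a multiple of \<open>x\<close>, which \<open>S w\<close> does not see for
  later \<open>w\<close>; and \<open>S d x = 0\<close> makes the reflection coefficient equal to
  \<open>cartan R x z - S x d\<close>, the amount missing in the equation for
  \<open>x\<close>.\<close>

lemma reflection_prod_exceptional:
  assumes "exceptional xs"
  shows "\<exists>d\<in>zmod.span (set xs). reflection_prod R xs z = z - d \<and> (\<forall>w\<in>set xs. S w d = cartan R w z)"
  using assms
proof (induction xs)
  case Nil
  then show ?case by (simp add: reflection_prod_def)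
next
  case (Cons x xs)
  then obtain d where d: "d \<in> zmod.span (set xs)" "reflection_prod R xs z = z - d"
    "\<forall>w\<in>set xs. S w d = cartan R w z"
    by (auto simp: exceptional_Cons)
  define e where "e = d + zscale (cartan R (z - d) x) x"
  have "S d x = 0" using vanish_left_on_span[OF _ d(1)] Cons.prems by (auto simp: exceptional_Cons)
  then have "cartan R (z - d) x = cartan R x z - S x d"
    using symmetrization[of d x] cartan_sym[of z x] by (simp add: cartan_diff_left)
  then have "S x e = cartan R x z"
    using Cons.prems by (simp add: e_def bilin exceptional_Cons)
  moreover have "\<forall>w\<in>set xs. S w e = cartan R w z"
    using Cons.prems d(3) by (simp add: e_def bilin exceptional_Cons)
  moreover have "reflection_prod R (x # xs) z = z - e"
    by (simp add: reflection_prod_Cons d(2) reflection_def e_def)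
  moreover have "e \<in> zmod.span (set (x # xs))"
    using d(1) unfolding e_def by (auto intro!: zmod.span_add zmod.span_scale intro: zmod.span_base
        subsetD[OF zmod.span_mono, rotated])
  ultimately show ?case by (intro bexI[of _ e]) auto
qed

text \<open>The condition \<open>S w d = cartan R w z\<close> for all \<open>w\<close> does not
  mention the list, and positivity makes its solution unique. With the Cartan form written as
  \<open>S w z + S z w\<close> it reads \<open>S w (z - d) = - S z w\<close>.\<close>

lemma reflection_prod_unique:
  assumes "exceptional xs" "exceptional ys" "zmod.span (set xs) = UNIV" "zmod.span (set ys) = UNIV"
  shows "reflection_prod R xs = reflection_prod R ys"
proof
  fix z
  have "\<exists>d. reflection_prod R xs z = z - d \<and> (\<forall>w. S w d = cartan R w z)"
    if exc: "exceptional xs" and spn: "zmod.span (set xs) = UNIV" for xs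
  proof -
    obtain d where d: "reflection_prod R xs z = z - d" "\<forall>w\<in>set xs. S w d = cartan R w z"
      using reflection_prod_exceptional[OF exc] by blast
    have "S w d = cartan R w z" for w
    proof -
      have "w \<in> zmod.span (set xs)" using spn by simp
      then show ?thesis
      proof (induction rule: zmod.span_induct_alt)
        case base
        then show ?case using cartan_add_left[of 0 0 z] by (simp add: bilin)
      next
        case (step c x w)
        then show ?case using d(2) by (simp add: bilin cartan_add_left cartan_zscale_left)
      qed
    qed
    then show ?thesis using d(1) by blast
  qed
  from this[OF assms(1,3)] this[OF assms(2,4)] obtain d e
    where "reflection_prod R xs z = z - d" "reflection_prod R ys z = z - e"
      and "\<forall>w. S w d = cartan R w z" "\<forall>w. S w e = cartan R w z" by blast
  moreover from this(3,4) have "S (d - e) (d - e) = 0" unfolding diff_right by simp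
  then have "d = e" using eq_0_if_nonpos[of "d - e"] by simp
  ultimately show "reflection_prod R xs z = reflection_prod R ys z" by simp
qed

text \<open>
  In a sum of roots of minimal length with value \<open>x\<close>, no two summands have negative inner product,
  since otherwise their sum is a root or zero. So the norm of \<open>x\<close> is at least twice the length.
\<close>

lemma norm_two_in_roots:
  assumes \<Phi>: "\<And>a. a \<in> \<Phi> \<Longrightarrow> S a a = 1" "\<And>a b. a \<in> \<Phi> \<Longrightarrow> b \<in> \<Phi> \<Longrightarrow> reflection R a b \<in> \<Phi>"
    and x: "x \<in> zmod.span \<Phi>" "S x x = 1"
  shows "x \<in> \<Phi>"
proof -
  have neg: "- a \<in> \<Phi>" if "a \<in> \<Phi>" for a
  proof -
    have "reflection R a a = - a"
      using \<Phi>(1)[OF that] zmod.scale_left_distrib[of 1 1 a]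
      by (simp add: reflection_def cartan_self)
    then show ?thesis using \<Phi>(2)[OF that that] by simp
  qed
  have ex: "\<exists>xs. set xs \<subseteq> \<Phi> \<and> sum_list xs = y" if "y \<in> zmod.span \<Phi>" for y
    using that
  proof (induction rule: zmod.span_induct_alt)
    case base
    then show ?case by (intro exI[of _ "[]"]) simp
  next
    case (step c a y)
    then obtain xs where xs: "set xs \<subseteq> \<Phi>" "sum_list xs = y" by blast
    have "sum_list (replicate n b) = zscale (int n) b" for n and b :: 'k
      by (induction n) (simp_all add: zmod.scale_left_distrib)
    then have "sum_list (replicate (nat c) a @ replicate (nat (- c)) (- a) @ xs) = zscale c a + y"
      using xs(2) by (cases "0 \<le> c") simp_all
    moreover have "set (replicate (nat c) a @ replicate (nat (- c)) (- a) @ xs) \<subseteq> \<Phi>"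
      using xs(1) step.hyps neg by (auto simp: set_replicate_conv_if)
    ultimately show ?case by blast
  qed
  define P where "P n \<longleftrightarrow> (\<exists>xs. set xs \<subseteq> \<Phi> \<and> sum_list xs = x \<and> length xs = n)" for n
  have "\<exists>n. P n" using ex[OF x(1)] by (auto simp: P_def)
  then have "P (LEAST n. P n)" by (rule LeastI_ex)
  then obtain xs where xs: "set xs \<subseteq> \<Phi>" "sum_list xs = x" "length xs = (LEAST n. P n)"
    by (auto simp: P_def)
  have min: "length xs \<le> length ys" if "set ys \<subseteq> \<Phi>" "sum_list ys = x" for ys
    unfolding xs(3) using that by (intro Least_le) (auto simp: P_def)
  have nonneg: "0 \<le> cartan R a b" if split: "xs = us @ a # vs @ b # ws" for us a vs b ws
  proof (rule ccontr)
    assume "\<not> ?thesis"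
    then have neg_ab: "cartan R a b < 0" by simp
    have ab: "a \<in> \<Phi>" "b \<in> \<Phi>" using xs(1) split by auto
    have norm: "S (a + b) (a + b) = 2 + cartan R a b"
      using \<Phi>(1)[OF ab(1)] \<Phi>(1)[OF ab(2)] symmetrization[of a b] by (simp add: bilin)
    \<comment> \<open>At inner product -1 the sum is a reflected root; at -2 or below its norm is
      not positive, so it is 0.\<close>
    have "a + b = 0 \<or> a + b \<in> \<Phi>"
    proof (cases "cartan R a b = - 1")
      case True
      then have "reflection R a b = a + b"
        by (simp add: reflection_def cartan_sym[of b a] zmod.scale_minus_left add.commute)
      then show ?thesis using \<Phi>(2)[OF ab] by simp
    next
      case False
      then show ?thesis using neg_ab norm eq_0_if_nonpos[of "a + b"] by simp
    qed
    then show False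
    proof
      assume "a + b = 0"
      then have "sum_list (us @ vs @ ws) = x"
        unfolding xs(2)[symmetric] split by (simp add: algebra_simps)
      then show False using min[of "us @ vs @ ws"] xs(1) by (auto simp: split)
    next
      assume "a + b \<in> \<Phi>"
      moreover have "sum_list (us @ (a + b) # vs @ ws) = x"
        unfolding xs(2)[symmetric] split by (simp add: algebra_simps)
      ultimately show False using min[of "us @ (a + b) # vs @ ws"] xs(1) by (auto simp: split)
    qed
  qed
  have bound: "int (length ys) \<le> S (sum_list ys) (sum_list ys)"
    if "set ys \<subseteq> \<Phi>" "sorted_wrt (\<lambda>a b. 0 \<le> cartan R a b) ys" for ys
    using that
  proof (induction ys)
    case (Cons y ys)
    have "0 \<le> cartan R y (sum_list zs)" if "\<forall>z\<in>set zs. 0 \<le> cartan R y z" for zs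
      using that cartan_add_right[of y 0 0] by (induction zs) (simp_all add: cartan_add_right)
    then have "0 \<le> cartan R y (sum_list ys)" using Cons.prems by simp
    moreover have "S (y + sum_list ys) (y + sum_list ys) =
        1 + cartan R y (sum_list ys) + S (sum_list ys) (sum_list ys)"
      using Cons.prems \<Phi>(1) symmetrization[of y "sum_list ys"] by (simp add: bilin)
    ultimately show ?case using Cons by simp
  qed (simp add: bilin)
  have "sorted_wrt (\<lambda>a b. 0 \<le> cartan R a b) xs"
    unfolding sorted_wrt_iff_nth_less
  proof (intro allI impI)
    fix i j
    assume ij: "i < j" "j < length xs"
    have "xs = take i xs @ xs ! i # drop (Suc i) xs" using ij by (simp add: id_take_nth_drop)
    moreover have "drop (Suc i) xs = take (j - Suc i) (drop (Suc i) xs) @ xs ! j # drop (Suc j) xs"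
      using ij id_take_nth_drop[of "j - Suc i" "drop (Suc i) xs"] by simp
    ultimately show "0 \<le> cartan R (xs ! i) (xs ! j)" using nonneg by metis
  qed
  then have "length xs \<le> 1" using bound[OF xs(1)] xs(2) x(2) by simp
  moreover have "xs \<noteq> []" using xs(2) x(2) by (auto simp: bilin)
  ultimately obtain a where "xs = [a]" by (cases xs) auto
  then show ?thesis using xs(1,2) by simp
qed

lemma reflection_image:
  assumes "f \<in> carrier (aut_group R)"
  shows "reflection R (f a) \<circ> f = f \<circ> reflection R a"
proof
  fix x
  have f: "additive f" "cartan R (f x) (f a) = cartan R x a"
    using assms by (auto simp: aut_group_def)
  have "f (zscale n y) = zscale n (f y)" for n y
    by (simp add: zscale_def additive.diff[OF f(1)] additive.sum[OF f(1)])
  then show "(reflection R (f a) \<circ> f) x = (f \<circ> reflection R a) x"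
    using additive.diff[OF f(1)] f(2) by (simp add: reflection_def)
qed

text \<open>The roots whose reflections lie in the smaller group are closed under their own
  reflections, by conjugation. They contain \<open>X\<close> and thus span the lattice, so
  \<open>norm_two_in_roots\<close> puts every root among them.\<close>

lemma reflection_group_spanning:
  assumes X: "X \<subseteq> re_roots R" and spn: "zmod.span X = UNIV"
  shows "reflection_group R X = weyl_group R"
proof
  interpret G: group "aut_group R" by (rule group_aut_group)
  have refl: "reflection R ` re_roots R \<subseteq> carrier (aut_group R)"
    using reflection_in_aut_group by blast
  then have reflX: "reflection R ` X \<subseteq> carrier (aut_group R)" using X by blast
  show "reflection_group R X \<subseteq> weyl_group R"
    unfolding weyl_group_def reflection_group_def by (rule G.mono_generate) (use X in blast)
  define H where "H = reflection_group R X"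
  have H: "subgroup H (aut_group R)"
    unfolding H_def reflection_group_def by (rule G.generate_is_subgroup[OF reflX])
  define \<Phi> where "\<Phi> = {a \<in> re_roots R. reflection R a \<in> H}"
  have S1: "S a a = 1" if "a \<in> re_roots R" for a
    using cartan_re_root[OF that] cartan_self[of a] by simp
  have "reflection R a b \<in> \<Phi>" if "a \<in> \<Phi>" "b \<in> \<Phi>" for a b
  proof -
    let ?s = "reflection R a"
    have a: "a \<in> re_roots R" "?s \<in> H" and b: "b \<in> re_roots R" "reflection R b \<in> H"
      using that by (auto simp: \<Phi>_def)
    have s: "?s \<in> carrier (aut_group R)" by (rule reflection_in_aut_group[OF a(1)])
    have root: "?s b \<in> re_roots R" using reflection_re_roots[OF a(1)] b(1) by blast
    have inv: "?s \<circ> ?s = id" by (rule reflection_involution[OF a(1)])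
    have "reflection R (?s b) = reflection R (?s b) \<circ> (?s \<circ> ?s)" by (simp add: inv)
    also have "\<dots> = ?s \<circ> reflection R b \<circ> ?s"
      using reflection_image[OF s, of b] by (simp add: comp_assoc[symmetric])
    also have "\<dots> = ?s \<otimes>\<^bsub>aut_group R\<^esub> reflection R b \<otimes>\<^bsub>aut_group R\<^esub> ?s"
      by (simp add: aut_group_def)
    also have "\<dots> \<in> H" using a(2) b(2) H by (intro subgroup.m_closed)
    finally show ?thesis using root by (simp add: \<Phi>_def)
  qed
  moreover have "X \<subseteq> \<Phi>"
    using X by (auto simp: \<Phi>_def H_def reflection_group_def intro: generate.incl)
  then have "zmod.span \<Phi> = UNIV" using spn zmod.span_mono by blast
  ultimately have "re_roots R \<subseteq> \<Phi>"
    using norm_two_in_roots[of \<Phi>] S1 by (auto simp: \<Phi>_def)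
  then have "reflection R ` re_roots R \<subseteq> H" by (auto simp: \<Phi>_def)
  then show "weyl_group R \<subseteq> reflection_group R X"
    using G.generate_subgroup_incl[OF _ H] by (simp add: weyl_group_def reflection_group_def H_def)
qed

text \<open>The vectors of the bipartite basis are at first only lattice vectors of norm one; this
  makes them roots.\<close>

lemma norm_one_root:
  assumes "S x x = 1"
  shows "x \<in> re_roots R"
proof (rule norm_two_in_roots[OF _ _ _ assms])
  show "S a a = 1" if "a \<in> re_roots R" for a
    using cartan_re_root[OF that] cartan_self[of a] by simp
  show "reflection R a b \<in> re_roots R" if "a \<in> re_roots R" "b \<in> re_roots R" for a b
    using reflection_re_roots[OF that(1)] that(2) by blast
qed (simp add: span_re_roots)

end

context generalized_root_system
begin

text \<open>Inverses of generators need no separate hypothesis, as reflections are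
  involutions.\<close>

lemma reflection_group_orbit:
  assumes X: "\<And>a b. a \<in> X \<Longrightarrow> b \<in> Y \<Longrightarrow> reflection R a b \<in> Y"
    and sub: "X \<subseteq> re_roots R" and w: "w \<in> reflection_group R X"
  shows "y \<in> Y \<Longrightarrow> w y \<in> Y"
  using w unfolding reflection_group_def
proof (induction arbitrary: y rule: generate.induct)
  case one
  then show ?case by (simp add: aut_group_def)
next
  case (incl h)
  then show ?case using X by auto
next
  case (inv h)
  interpret G: group "aut_group R" by (rule group_aut_group)
  from inv obtain a where a: "a \<in> X" "h = reflection R a" by blast
  then have root: "a \<in> re_roots R" using sub by blast
  have h: "h \<in> carrier (aut_group R)" using reflection_in_aut_group[OF root] a(2) by simp
  have "h \<circ> h = id" unfolding a(2) by (rule reflection_involution[OF root])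
  then have "h \<otimes>\<^bsub>aut_group R\<^esub> h = \<one>\<^bsub>aut_group R\<^esub>" by (simp add: aut_group_def)
  then have "inv\<^bsub>aut_group R\<^esub> h = h" using G.inv_equality h by blast
  then show ?case using X a inv.prems by simp
next
  case (eng h1 h2)
  then show ?case by (simp add: aut_group_def)
qed

text \<open>If \<open>X\<close> were orthogonal to the rest of the basis, the union of the two spans
  would be stable under the basis reflections. The roots form the orbit of the basis, so each would
  lie in one of the spans, and this splits the root system.\<close>

lemma basis_indecomposable:
  assumes B: "root_basis R B" and irr: "\<not> reducible R"
    and X: "X \<noteq> {}" "X \<subset> set B"
  shows "\<exists>x\<in>X. \<exists>a\<in>set B - X. cartan R x a \<noteq> 0"
proof (rule ccontr)
  assume contra: "\<not> ?thesis"
  let ?X' = "set B - X"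
  have orth: "cartan R x a = 0" if "x \<in> zmod.span X" "a \<in> zmod.span ?X'" for x a
  proof -
    have 1: "cartan R y a = 0" if "y \<in> X" for y
      using \<open>a \<in> zmod.span ?X'\<close>
    proof (induction rule: zmod.span_induct_alt)
      case base
      then show ?case using cartan_add_right[of y 0 0] by simp
    next
      case (step c b a)
      then show ?case using contra that by (simp add: cartan_add_right cartan_zscale)
    qed
    show ?thesis using that(1)
    proof (induction rule: zmod.span_induct_alt)
      case base
      then show ?case using cartan_add_left[of 0 0 a] by simp
    next
      case (step c b x)
      then show ?case using 1 by (simp add: cartan_add_left cartan_zscale_left)
    qed
  qed
  define \<Delta>1 where "\<Delta>1 = re_roots R \<inter> zmod.span X"
  define \<Delta>2 where "\<Delta>2 = re_roots R \<inter> zmod.span ?X'"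
  have BR: "set B \<subseteq> re_roots R" and W: "weyl_group R = reflection_group R (set B)"
    and orbit: "re_roots R = {w b | w b. w \<in> weyl_group R \<and> b \<in> set B}"
    using B unfolding root_basis_def by blast+
  have stable: "reflection R a b \<in> zmod.span X \<union> zmod.span ?X'"
    if ab: "a \<in> set B" "b \<in> zmod.span X \<union> zmod.span ?X'" for a b
  proof -
    consider "a \<in> X" "b \<in> zmod.span X" | "a \<in> ?X'" "b \<in> zmod.span ?X'"
      | "cartan R b a = 0"
      using ab orth cartan_sym zmod.span_base by (metis Diff_iff UnE)
    then show ?thesis
    proof cases
      case 1
      then show ?thesis unfolding reflection_def
        by (intro UnI1 zmod.span_diff zmod.span_scale) (auto intro: zmod.span_base)
    next
      case 2
      then show ?thesis unfolding reflection_def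
        by (intro UnI2 zmod.span_diff zmod.span_scale) (auto intro: zmod.span_base)
    next
      case 3
      then show ?thesis using ab(2) by (simp add: reflection_def)
    qed
  qed
  have "re_roots R \<subseteq> zmod.span X \<union> zmod.span ?X'"
  proof
    fix r
    assume "r \<in> re_roots R"
    then obtain w b where wb: "r = w b" "w \<in> reflection_group R (set B)" "b \<in> set B"
      unfolding W[symmetric] by (subst (asm) orbit) blast
    have "b \<in> zmod.span X \<union> zmod.span ?X'" using wb(3) by (auto intro: zmod.span_base)
    then show "r \<in> zmod.span X \<union> zmod.span ?X'"
      using reflection_group_orbit[OF stable BR wb(2)] wb(1) by blast
  qed
  then have "re_roots R = \<Delta>1 \<union> \<Delta>2" by (auto simp: \<Delta>1_def \<Delta>2_def)
  moreover have "\<Delta>1 \<noteq> {}" "\<Delta>2 \<noteq> {}"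
    using X BR by (auto simp: \<Delta>1_def \<Delta>2_def intro: zmod.span_base)
  moreover have orth12: "\<forall>a\<in>\<Delta>1. \<forall>b\<in>\<Delta>2. cartan R a b = 0" using orth by (auto simp: \<Delta>1_def \<Delta>2_def)
  moreover have "\<Delta>1 \<inter> \<Delta>2 = {}"
  proof (rule ccontr)
    assume "\<Delta>1 \<inter> \<Delta>2 \<noteq> {}"
    then obtain a where "a \<in> \<Delta>1" "a \<in> \<Delta>2" by blast
    then show False using orth12 cartan_re_root[of a] by (auto simp: \<Delta>1_def)
  qed
  ultimately show False using irr unfolding reducible_def by blast
qed

end

theorem proposition3p9:
  fixes R :: "('k::ab_group_add) root_data" and \<mu> :: nat
  assumes "generalized_root_system R \<mu>"
    and "\<mu> \<ge> 1"
    and "\<not> reducible R"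
    and "positive_definite R"
  shows "admissible \<mu> R (coxeter R)"
proof -
  interpret generalized_root_system R \<mu> by fact
  obtain bs where bs: "root_basis R bs" "length bs = \<mu>" using ex_root_basis by blast
  then have basis: "zbasis bs" "set bs \<subseteq> re_roots R" and spn: "zmod.span (set bs) = UNIV"
    by (auto simp: root_basis_def zbasis_def)
  obtain S where S: "integral_form S" "\<And>x y. S x y + S y x = cartan R x y"
    "integral_form.exceptional S bs"
    using ex_seifert_form[OF assms(4) basis] by blast
  interpret seifert_form R \<mu> S
    using S(1,2) generalized_root_system_axioms by (simp add: seifert_form_def seifert_form_axioms_def)
  have "has_bipartite (length bs) (zmod.span (set bs))"
  proof (rule indecomposable_has_bipartite[OF S(3)])
    show "bs \<noteq> []" using bs(2) assms(2) by auto
    show "\<exists>x\<in>X. \<exists>a\<in>set bs - X. S x a \<noteq> 0 \<or> S a x \<noteq> 0" if X: "X \<noteq> {}" "X \<subset> set bs" for X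
    proof -
      obtain x a where "x \<in> X" "a \<in> set bs - X" "S x a + S a x \<noteq> 0"
        using basis_indecomposable[OF bs(1) assms(3) X] symmetrization by metis
      then show ?thesis by (intro bexI[of _ x] bexI[of _ a]) auto
    qed
  qed
  then obtain A B where AB: "bipartite_pair A B" "length A + length B = \<mu>"
    unfolding has_bipartite_def bs(2) by blast
  have exc: "exceptional (A @ B)" by (rule bipartite_pair_exceptional[OF AB(1)])
  \<comment> \<open>The exceptional list \<open>A @ B\<close> has as many elements as the root
    basis, hence it spans the whole lattice.\<close>
  have AB_spn: "zmod.span (set (A @ B)) = UNIV"
    using exceptional_spans[OF exc, of "set bs"] spn AB(2) bs(2) card_length[of bs] by simp
  have "coxeter R = reflection_prod R (A @ B)"
    using reflection_prod_unique[OF S(3) exc spn AB_spn] bs(1) by (simp add: root_basis_def)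
  then have cox: "coxeter R = reflection_prod R A \<circ> reflection_prod R B"
    by (simp add: reflection_prod_append)
  have roots: "set (A @ B) \<subseteq> re_roots R"
    using exc norm_one_root by (auto simp: exceptional_def)
  have ind: "distinct (map tensor_one (A @ B))" "independent (tensor_one ` set (A @ B))"
    using exceptional_independent[OF exc] .
  have orth: "sorted_wrt (\<lambda>x y. cartan R x y = 0) C" if "orthonormal C" for C
    using that sorted_wrt_mono_rel[of C "\<lambda>x y. S x y = 0 \<and> S y x = 0"]
    by (simp add: orthonormal_def flip: symmetrization)
  have gen: "weyl_group R = reflection_group R (set (A @ B))"
    using reflection_group_spanning[OF roots AB_spn] by simp
  have orthAB: "orthonormal A" "orthonormal B" using AB(1) by (simp_all add: bipartite_pair_def)
  have "\<exists>\<beta>s \<gamma>s. admissible_representation \<mu> R (coxeter R) \<beta>s \<gamma>s \<and>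
      weyl_group R = reflection_group R (set (\<beta>s @ \<gamma>s))"
  \<comment> \<open>The first list of an admissible representation must be nonempty. If
    \<open>A\<close> is empty, \<open>B\<close> takes its place and the second list is
    empty.\<close>
  proof (cases "A = []")
    case False
    then have "admissible_representation \<mu> R (coxeter R) A B"
      using cox AB(2) roots ind orth orthAB
      by (simp add: admissible_representation_def Suc_le_eq)
    then show ?thesis using gen by blast
  next
    case True
    then have "admissible_representation \<mu> R (coxeter R) B []"
      using cox AB(2) roots ind orth orthAB assms(2)
      by (simp add: admissible_representation_def reflection_prod_def)
    then show ?thesis using gen True by (metis append_Nil append_Nil2)
  qed
  then show ?thesis using coxeter_in_weyl_group by (simp add: admissible_def)
qed

end
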